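(* Let $G$ be a subgroup of the ring automorphism group $\mathrm{Aut}(\mathcal O)$ isomorphic to $D_n$ for some $n\in\{1,2,3,4,6\}$, and let $G$ act on $\mathcal O/N\mathcal O$ via reduction for integers $N\geq1$. (a) If $N$ is coprime to $2$ and $3$, then $(\mathcal O/N\mathcal O)^G\simeq(\mathbb Z/N\mathbb Z)^2$ if $G\simeq D_1$, and $(\mathcal O/N\mathcal O)^G\simeq \mathbb Z/N\mathbb Z$ if $G\simeq D_2,D_3,D_4$ or $D_6$. (b) $(\mathcal O/3\mathcal O)^G$ is isomorphic to $(\mathbb Z/3\mathbb Z)^2$ if $G\simeq D_1$; to $\mathbb Z/3\mathbb Z$ if $G\simeq D_2,D_4,D_6$; and to $\mathbb Z/3\mathbb Z$ or $(\mathbb Z/3\mathbb Z)^2$ if $G\simeq D_3$. (c) $(\mathcal O/2\mathcal O)^G$ is isomorphic to $(\mathbb Z/2\mathbb Z)^2$, $(\mathbb Z/2\mathbb Z)^3$ or $(\mathbb Z/2\mathbb Z)^4$ if $G\simeq D_1$; to $(\mathbb Z/2\mathbb Z)^2$ or $(\mathbb Z/2\mathbb Z)^3$ if $G\simeq D_2$; to $(\mathbb Z/2\mathbb Z)^2$ if $G\simeq D_4$; and to $\mathbb Z/2\mathbb Z$ if $G\simeq D_3$ or $D_6$.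
   Context: Let $B$ be an indefinite quaternion algebra over $\mathbb Q$ (i.e. $B\otimes\mathbb R\simeq\mathrm{Mat}_2(\mathbb R)$) which is a division algebra, and let $\mathcal O$ be a maximal order of $B$. $D_n$ denotes the dihedral group of order $2n$ (so $D_1\simeq C_2$ and $D_2\simeq C_2\times C_2$). For a group $G$ acting on a set $X$, $X^G$ denotes the set of $G$-fixed points. *)

theory Defs
  imports
    "HOL-Algebra.Algebra"
    "HOL-Algebra.Algebraic_Closure_Type"
    "Jordan_Normal_Form.Matrix"
begin

section \<open>Quaternion algebras over the rationals\<close>

text \<open>The algebra \<open>(a, b | \<rat>)\<close> with basis \<open>1, i, j, k\<close>, where \<open>i\<^sup>2 = a\<close>, \<open>j\<^sup>2 = b\<close> and
  \<open>ij = k = -ji\<close>; hence \<open>k\<^sup>2 = -ab\<close>, \<open>ik = aj = -ki\<close> and \<open>kj = bi = -jk\<close>.\<close>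

fun quat_mult :: "rat \<Rightarrow> rat \<Rightarrow> rat \<times> rat \<times> rat \<times> rat \<Rightarrow> rat \<times> rat \<times> rat \<times> rat
    \<Rightarrow> rat \<times> rat \<times> rat \<times> rat" where
  "quat_mult a b (x0, x1, x2, x3) (y0, y1, y2, y3) =
    (x0 * y0 + a * x1 * y1 + b * x2 * y2 - a * b * x3 * y3,
     x0 * y1 + x1 * y0 + b * x3 * y2 - b * x2 * y3,
     x0 * y2 + x2 * y0 + a * x1 * y3 - a * x3 * y1,
     x0 * y3 + x3 * y0 + x1 * y2 - x2 * y1)"

fun quat_add :: "rat \<times> rat \<times> rat \<times> rat \<Rightarrow> rat \<times> rat \<times> rat \<times> rat
    \<Rightarrow> rat \<times> rat \<times> rat \<times> rat" where
  "quat_add (x0, x1, x2, x3) (y0, y1, y2, y3) = (x0 + y0, x1 + y1, x2 + y2, x3 + y3)"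

definition quat_ring :: "rat \<Rightarrow> rat \<Rightarrow> (rat \<times> rat \<times> rat \<times> rat) ring" where
  "quat_ring a b = \<lparr>carrier = UNIV, monoid.mult = quat_mult a b, one = (1, 0, 0, 0),
     ring.zero = (0, 0, 0, 0), ring.add = quat_add\<rparr>"

lemma ring_quat_ring: "ring (quat_ring a b)"
proof (rule ringI)
  show "abelian_group (quat_ring a b)"
  proof (rule abelian_groupI)
    fix x assume "x \<in> carrier (quat_ring a b)"
    obtain x0 x1 x2 x3 where "x = (x0, x1, x2, x3)" by (cases x)
    then show "\<exists>y\<in>carrier (quat_ring a b). y \<oplus>\<^bsub>quat_ring a b\<^esub> x = \<zero>\<^bsub>quat_ring a b\<^esub>"
      by (intro bexI[of _ "(- x0, - x1, - x2, - x3)"]) (auto simp: quat_ring_def)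
  qed (auto simp: quat_ring_def algebra_simps)
  show "Group.monoid (quat_ring a b)"
    by (rule monoidI) (auto simp: quat_ring_def algebra_simps)
qed (auto simp: quat_ring_def algebra_simps)

text \<open>A ring isomorphism between \<open>\<rat>\<close>-algebras is \<open>\<rat>\<close>-linear, and a ring carries at most one
  structure of a \<open>\<rat>\<close>-algebra, so the scalars need not be recorded separately.\<close>

definition quaternion_algebra :: "('a, 'm) ring_scheme \<Rightarrow> bool" where
  "quaternion_algebra B \<longleftrightarrow>
     Ring.ring B \<and> (\<exists>a b. a \<noteq> 0 \<and> b \<noteq> 0 \<and> B \<simeq> quat_ring a b)"

definition division_algebra :: "('a, 'm) ring_scheme \<Rightarrow> bool" where
  "division_algebra B \<longleftrightarrow>
     Ring.ring B \<and> \<one>\<^bsub>B\<^esub> \<noteq> \<zero>\<^bsub>B\<^esub> \<and> Units B = carrier B - {\<zero>\<^bsub>B\<^esub>}"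


section \<open>Tensor products of rings\<close>

text \<open>A list \<open>[(r\<^sub>1, s\<^sub>1), \<dots>, (r\<^sub>n, s\<^sub>n)]\<close> stands for \<open>r\<^sub>1 \<otimes> s\<^sub>1 + \<dots> + r\<^sub>n \<otimes> s\<^sub>n\<close>. The relation below is
  the congruence on such formal sums generated by biadditivity, so that the quotient is the tensor
  product over \<open>\<int>\<close>. (The relation \<open>[(r, 0)] \<sim> []\<close> is a consequence of the others.)\<close>

definition formal_sums :: "('a, 'm) ring_scheme \<Rightarrow> ('b, 'n) ring_scheme \<Rightarrow> ('a \<times> 'b) list set" where
  "formal_sums R S = lists (carrier R \<times> carrier S)"

inductive tensor_eq ::
    "('a, 'm) ring_scheme \<Rightarrow> ('b, 'n) ring_scheme \<Rightarrow> ('a \<times> 'b) list \<Rightarrow> ('a \<times> 'b) list \<Rightarrow> bool"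
  for R S where
  refl: "xs \<in> formal_sums R S \<Longrightarrow> tensor_eq R S xs xs"
| sym: "tensor_eq R S xs ys \<Longrightarrow> tensor_eq R S ys xs"
| trans: "tensor_eq R S xs ys \<Longrightarrow> tensor_eq R S ys zs \<Longrightarrow> tensor_eq R S xs zs"
| append: "tensor_eq R S xs xs' \<Longrightarrow> tensor_eq R S ys ys' \<Longrightarrow> tensor_eq R S (xs @ ys) (xs' @ ys')"
| comm: "xs \<in> formal_sums R S \<Longrightarrow> ys \<in> formal_sums R S \<Longrightarrow> tensor_eq R S (xs @ ys) (ys @ xs)"
| zero: "s \<in> carrier S \<Longrightarrow> tensor_eq R S [(\<zero>\<^bsub>R\<^esub>, s)] []"
| add_left: "r \<in> carrier R \<Longrightarrow> r' \<in> carrier R \<Longrightarrow> s \<in> carrier S \<Longrightarrow>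
    tensor_eq R S [(r \<oplus>\<^bsub>R\<^esub> r', s)] [(r, s), (r', s)]"
| add_right: "r \<in> carrier R \<Longrightarrow> s \<in> carrier S \<Longrightarrow> s' \<in> carrier S \<Longrightarrow>
    tensor_eq R S [(r, s \<oplus>\<^bsub>S\<^esub> s')] [(r, s), (r, s')]"

definition tensor_class ::
    "('a, 'm) ring_scheme \<Rightarrow> ('b, 'n) ring_scheme \<Rightarrow> ('a \<times> 'b) list \<Rightarrow> ('a \<times> 'b) list set" where
  "tensor_class R S xs = {ys. tensor_eq R S xs ys}"

definition formal_mult ::
    "('a, 'm) ring_scheme \<Rightarrow> ('b, 'n) ring_scheme \<Rightarrow> ('a \<times> 'b) list \<Rightarrow> ('a \<times> 'b) list \<Rightarrow> ('a \<times> 'b) list"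
  where
  "formal_mult R S xs ys =
     concat (map (\<lambda>(r, s). map (\<lambda>(r', s'). (r \<otimes>\<^bsub>R\<^esub> r', s \<otimes>\<^bsub>S\<^esub> s')) ys) xs)"

definition tensor_ring ::
    "('a, 'm) ring_scheme \<Rightarrow> ('b, 'n) ring_scheme \<Rightarrow> ('a \<times> 'b) list set ring" where
  "tensor_ring R S =
    \<lparr>carrier = tensor_class R S ` formal_sums R S,
     monoid.mult = (\<lambda>U V. \<Union>xs\<in>U. \<Union>ys\<in>V. tensor_class R S (formal_mult R S xs ys)),
     one = tensor_class R S [(\<one>\<^bsub>R\<^esub>, \<one>\<^bsub>S\<^esub>)],
     ring.zero = tensor_class R S [],
     ring.add = (\<lambda>U V. \<Union>xs\<in>U. \<Union>ys\<in>V. tensor_class R S (xs @ ys))\<rparr>"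

context
  fixes R :: "('a, 'm) ring_scheme" (structure) and S :: "('b, 'n) ring_scheme"
  assumes R: "Ring.ring R" and S: "Ring.ring S"
begin

interpretation R: Ring.ring R by (fact R)
interpretation S: Ring.ring S by (fact S)

lemma formal_sums_simps [simp]:
  "[] \<in> formal_sums R S"
  "(r, s) # xs \<in> formal_sums R S \<longleftrightarrow> r \<in> carrier R \<and> s \<in> carrier S \<and> xs \<in> formal_sums R S"
  "xs @ ys \<in> formal_sums R S \<longleftrightarrow> xs \<in> formal_sums R S \<and> ys \<in> formal_sums R S"
  by (auto simp: formal_sums_def)

lemma tensor_eq_formal_sums:
  "tensor_eq R S xs ys \<Longrightarrow> xs \<in> formal_sums R S \<and> ys \<in> formal_sums R S"
  by (induction rule: tensor_eq.induct) auto

lemma tensor_eq_mset: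
  "mset xs = mset ys \<Longrightarrow> xs \<in> formal_sums R S \<Longrightarrow> tensor_eq R S xs ys"
proof (induction xs arbitrary: ys)
  case Nil
  then show ?case by (auto intro: tensor_eq.refl)
next
  case (Cons x xs)
  obtain as bs where ys: "ys = as @ x # bs"
    using Cons.prems(1) by (metis list.set_intros(1) set_mset_mset split_list)
  have ms: "mset xs = mset (as @ bs)" using Cons.prems(1) ys by simp
  have x: "[x] \<in> formal_sums R S" "xs \<in> formal_sums R S"
    using Cons.prems(2) by (cases x; simp)+
  have e: "tensor_eq R S xs (as @ bs)" using Cons.IH[OF ms x(2)] .
  then have ab: "as \<in> formal_sums R S" "bs \<in> formal_sums R S"
    by (auto dest!: tensor_eq_formal_sums)
  have "tensor_eq R S ([x] @ xs) ([x] @ (as @ bs))"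
    using tensor_eq.append[OF tensor_eq.refl[OF x(1)] e] .
  moreover have "tensor_eq R S (([x] @ as) @ bs) ((as @ [x]) @ bs)"
    using tensor_eq.append[OF tensor_eq.comm[OF x(1) ab(1)] tensor_eq.refl[OF ab(2)]] .
  ultimately show ?case using tensor_eq.trans ys by fastforce
qed

lemma formal_mult_simps [simp]:
  "formal_mult R S [] ys = []"
  "formal_mult R S xs [] = []"
  "formal_mult R S (xs @ xs') ys = formal_mult R S xs ys @ formal_mult R S xs' ys"
  "formal_mult R S [(r, s)] ((r', s') # ys) = (r \<otimes> r', s \<otimes>\<^bsub>S\<^esub> s') # formal_mult R S [(r, s)] ys"
  by (auto simp: formal_mult_def)

lemma formal_mult_append_right:
  "mset (formal_mult R S xs (ys @ ys')) = mset (formal_mult R S xs ys @ formal_mult R S xs ys')"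
  by (induction xs) (auto simp: formal_mult_def)

lemma formal_mult_closed [simp]:
  "xs \<in> formal_sums R S \<Longrightarrow> ys \<in> formal_sums R S \<Longrightarrow> formal_mult R S xs ys \<in> formal_sums R S"
  by (fastforce simp: formal_sums_def formal_mult_def)

lemma formal_mult_assoc:
  assumes "xs \<in> formal_sums R S" "ys \<in> formal_sums R S" "zs \<in> formal_sums R S"
  shows "formal_mult R S (formal_mult R S xs ys) zs = formal_mult R S xs (formal_mult R S ys zs)"
proof -
  have 1: "formal_mult R S (map (\<lambda>(r', s'). (r \<otimes> r', s \<otimes>\<^bsub>S\<^esub> s')) ys) zs =
      map (\<lambda>(r', s'). (r \<otimes> r', s \<otimes>\<^bsub>S\<^esub> s')) (formal_mult R S ys zs)"
    if "r \<in> carrier R" "s \<in> carrier S" for r s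
    using assms(2,3) that
    by (induction ys) (force simp: formal_mult_def formal_sums_def R.m_assoc S.m_assoc)+
  from assms(1) show ?thesis
  proof (induction xs)
    case (Cons x xs)
    obtain r s where x: "x = (r, s)" by (cases x)
    have e: "formal_mult R S ((r, s) # xs) vs =
        map (\<lambda>(r', s'). (r \<otimes> r', s \<otimes>\<^bsub>S\<^esub> s')) vs @ formal_mult R S xs vs" for vs
      by (simp add: formal_mult_def)
    show ?case using Cons x 1 by (simp add: e)
  qed simp
qed

lemma tensor_eq_formal_mult_append:
  assumes "xs \<in> formal_sums R S" "ys \<in> formal_sums R S" "ys' \<in> formal_sums R S"
  shows "tensor_eq R S (formal_mult R S xs (ys @ ys')) (formal_mult R S xs ys @ formal_mult R S xs ys')"
  using assms by (intro tensor_eq_mset formal_mult_append_right) auto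

lemma tensor_eq_formal_mult_right:
  assumes "tensor_eq R S ys ys'" "xs \<in> formal_sums R S"
  shows "tensor_eq R S (formal_mult R S xs ys) (formal_mult R S xs ys')"
  using assms(2)
proof (induction xs)
  case Nil
  then show ?case by (auto intro: tensor_eq.refl)
next
  case (Cons x xs)
  obtain r s where x: "x = (r, s)" "r \<in> carrier R" "s \<in> carrier S" "xs \<in> formal_sums R S"
    using Cons.prems by (cases x) auto
  have app: "formal_mult R S [x] (us @ vs) = formal_mult R S [x] us @ formal_mult R S [x] vs"
    for us vs by (simp add: formal_mult_def x)
  have "tensor_eq R S (formal_mult R S [x] ys) (formal_mult R S [x] ys')"
    using assms(1)
  proof (induction rule: tensor_eq.induct)
    case (refl us)
    then show ?case using x by (intro tensor_eq.refl) auto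
  next
    case (append us us' vs vs')
    then show ?case unfolding app by (intro tensor_eq.append)
  next
    case (comm us vs)
    then show ?case unfolding app using x by (intro tensor_eq.comm) auto
  next
    case (zero s')
    then show ?case using x by (auto intro: tensor_eq.zero)
  next
    case (add_left r1 r2 s')
    then show ?case using x by (auto simp: R.r_distr intro!: tensor_eq.add_left)
  next
    case (add_right r1 s1 s2)
    then show ?case using x by (auto simp: S.r_distr intro!: tensor_eq.add_right)
  qed (blast intro: tensor_eq.sym tensor_eq.trans)+
  moreover have "formal_mult R S (x # xs) us = formal_mult R S [x] us @ formal_mult R S xs us"
    for us by (simp add: formal_mult_def)
  ultimately show ?case using Cons.IH x by (auto intro: tensor_eq.append)
qed

lemma tensor_eq_formal_mult_left:
  assumes "tensor_eq R S xs xs'" "ys \<in> formal_sums R S"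
  shows "tensor_eq R S (formal_mult R S xs ys) (formal_mult R S xs' ys)"
  using assms(2)
proof (induction ys)
  case Nil
  then show ?case by (auto intro: tensor_eq.refl)
next
  case (Cons y ys)
  obtain r s where y: "y = (r, s)" "r \<in> carrier R" "s \<in> carrier S" "ys \<in> formal_sums R S"
    using Cons.prems by (cases y) auto
  have "tensor_eq R S (formal_mult R S xs [y]) (formal_mult R S xs' [y])"
    using assms(1)
  proof (induction rule: tensor_eq.induct)
    case (refl us)
    then show ?case using y by (intro tensor_eq.refl) auto
  next
    case (append us us' vs vs')
    then show ?case unfolding formal_mult_simps by (intro tensor_eq.append)
  next
    case (comm us vs)
    then show ?case unfolding formal_mult_simps using y by (intro tensor_eq.comm) auto
  next
    case (zero s')
    then show ?case using y by (auto intro: tensor_eq.zero)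
  next
    case (add_left r1 r2 s')
    then show ?case using y by (auto simp: formal_mult_def R.l_distr intro!: tensor_eq.add_left)
  next
    case (add_right r1 s1 s2)
    then show ?case using y by (auto simp: formal_mult_def S.l_distr intro!: tensor_eq.add_right)
  qed (blast intro: tensor_eq.sym tensor_eq.trans)+
  then have *: "tensor_eq R S (formal_mult R S xs [y] @ formal_mult R S xs ys)
      (formal_mult R S xs' [y] @ formal_mult R S xs' ys)"
    using Cons.IH y by (intro tensor_eq.append) auto
  have "tensor_eq R S (formal_mult R S us ([y] @ ys)) (formal_mult R S us [y] @ formal_mult R S us ys)"
    if "us \<in> formal_sums R S" for us
    using that y by (intro tensor_eq_formal_mult_append) auto
  then show ?case
    using * tensor_eq_formal_sums[OF assms(1)]
    by (metis append_Cons append_Nil tensor_eq.sym tensor_eq.trans)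
qed

lemma tensor_class_eq_iff:
  "xs \<in> formal_sums R S \<Longrightarrow> tensor_class R S xs = tensor_class R S ys \<longleftrightarrow> tensor_eq R S xs ys"
  unfolding tensor_class_def
  by (blast intro: tensor_eq.refl tensor_eq.sym tensor_eq.trans)

lemma UN_UN_eqI:
  assumes "a \<in> A" "b \<in> B" "\<And>x y. x \<in> A \<Longrightarrow> y \<in> B \<Longrightarrow> f x y = C"
  shows "(\<Union>x\<in>A. \<Union>y\<in>B. f x y) = C"
proof -
  have "(\<Union>x\<in>A. \<Union>y\<in>B. f x y) = (\<Union>x\<in>A. \<Union>y\<in>B. C)"
    by (intro SUP_cong HOL.refl assms(3))
  also have "\<dots> = C" using assms(1,2) by blast
  finally show ?thesis .
qed

lemma tensor_class_add:
  assumes "xs \<in> formal_sums R S" "ys \<in> formal_sums R S"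
  shows "tensor_class R S xs \<oplus>\<^bsub>tensor_ring R S\<^esub> tensor_class R S ys = tensor_class R S (xs @ ys)"
proof -
  have "tensor_class R S (us @ vs) = tensor_class R S (xs @ ys)"
    if "us \<in> tensor_class R S xs" "vs \<in> tensor_class R S ys" for us vs
    using that assms
    by (subst eq_commute, subst tensor_class_eq_iff)
       (auto simp: tensor_class_def intro: tensor_eq.append)
  moreover have "xs \<in> tensor_class R S xs" "ys \<in> tensor_class R S ys"
    using assms by (auto simp: tensor_class_def intro: tensor_eq.refl)
  ultimately have "(\<Union>us\<in>tensor_class R S xs. \<Union>vs\<in>tensor_class R S ys. tensor_class R S (us @ vs)) =
      tensor_class R S (xs @ ys)"
    by (rule UN_UN_eqI[rotated 2])
  then show ?thesis by (simp add: tensor_ring_def)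
qed

lemma tensor_class_mult:
  assumes "xs \<in> formal_sums R S" "ys \<in> formal_sums R S"
  shows "tensor_class R S xs \<otimes>\<^bsub>tensor_ring R S\<^esub> tensor_class R S ys =
    tensor_class R S (formal_mult R S xs ys)"
proof -
  have "tensor_class R S (formal_mult R S us vs) = tensor_class R S (formal_mult R S xs ys)"
    if "us \<in> tensor_class R S xs" "vs \<in> tensor_class R S ys" for us vs
  proof -
    have "tensor_eq R S (formal_mult R S xs ys) (formal_mult R S us ys)"
      using that assms by (auto simp: tensor_class_def intro: tensor_eq_formal_mult_left)
    moreover have "tensor_eq R S (formal_mult R S us ys) (formal_mult R S us vs)"
      using that assms tensor_eq_formal_sums
      by (auto simp: tensor_class_def intro!: tensor_eq_formal_mult_right)
    ultimately show ?thesis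
      using assms by (metis formal_mult_closed tensor_class_eq_iff tensor_eq.trans)
  qed
  moreover have "xs \<in> tensor_class R S xs" "ys \<in> tensor_class R S ys"
    using assms by (auto simp: tensor_class_def intro: tensor_eq.refl)
  ultimately have "(\<Union>us\<in>tensor_class R S xs. \<Union>vs\<in>tensor_class R S ys. tensor_class R S (formal_mult R S us vs)) =
      tensor_class R S (formal_mult R S xs ys)"
    by (rule UN_UN_eqI[rotated 2])
  then show ?thesis by (simp add: tensor_ring_def)
qed

lemma tensor_neg: "xs \<in> formal_sums R S \<Longrightarrow>
  tensor_eq R S (map (\<lambda>(r, s). (\<ominus> r, s)) xs @ xs) [] \<and>
  map (\<lambda>(r, s). (\<ominus> r, s)) xs \<in> formal_sums R S"
proof (induction xs)
  case Nil
  then show ?case by (auto intro: tensor_eq.refl)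
next
  case (Cons x xs)
  obtain r s where x: "x = (r, s)" "r \<in> carrier R" "s \<in> carrier S" "xs \<in> formal_sums R S"
    using Cons.prems by (cases x) auto
  let ?n = "map (\<lambda>(r, s). (\<ominus> r, s)) xs"
  have "tensor_eq R S [(\<ominus> r \<oplus> r, s)] [(\<ominus> r, s), (r, s)]"
    using x by (intro tensor_eq.add_left) auto
  then have "tensor_eq R S [(\<ominus> r, s), (r, s)] []"
    using x tensor_eq.zero[of s S R] by (metis R.l_neg tensor_eq.sym tensor_eq.trans)
  then have "tensor_eq R S ([(\<ominus> r, s), (r, s)] @ (?n @ xs)) ([] @ [])"
    using Cons.IH x by (intro tensor_eq.append) auto
  moreover have "tensor_eq R S (map (\<lambda>(r, s). (\<ominus> r, s)) (x # xs) @ x # xs)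
      ([(\<ominus> r, s), (r, s)] @ (?n @ xs))"
    using Cons.IH x by (intro tensor_eq_mset) auto
  ultimately show ?case using tensor_eq.trans Cons.IH x by fastforce
qed

theorem ring_tensor_ring: "Ring.ring (tensor_ring R S)"
proof -
  let ?T = "tensor_ring R S"
  have carrier: "x \<in> carrier ?T \<longleftrightarrow> (\<exists>xs\<in>formal_sums R S. x = tensor_class R S xs)" for x
    by (auto simp: tensor_ring_def)
  have zero: "\<zero>\<^bsub>?T\<^esub> = tensor_class R S []" and one: "\<one>\<^bsub>?T\<^esub> = tensor_class R S [(\<one>, \<one>\<^bsub>S\<^esub>)]"
    by (auto simp: tensor_ring_def)
  have unit: "formal_mult R S [(\<one>, \<one>\<^bsub>S\<^esub>)] xs = xs \<and> formal_mult R S xs [(\<one>, \<one>\<^bsub>S\<^esub>)] = xs"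
    if "xs \<in> formal_sums R S" for xs
    using that by (induction xs) (auto simp: formal_mult_def)
  note simps = carrier zero one tensor_class_add tensor_class_mult
  show ?thesis
  proof (rule ringI)
    show "abelian_group ?T"
    proof (rule abelian_groupI)
      fix x assume "x \<in> carrier ?T"
      then obtain xs where xs: "xs \<in> formal_sums R S" "x = tensor_class R S xs"
        by (auto simp: carrier)
      show "\<exists>y\<in>carrier ?T. y \<oplus>\<^bsub>?T\<^esub> x = \<zero>\<^bsub>?T\<^esub>"
        using tensor_neg[OF xs(1)] xs
        by (intro bexI[of _ "tensor_class R S (map (\<lambda>(r, s). (\<ominus> r, s)) xs)"])
           (auto simp: simps tensor_class_eq_iff intro: tensor_eq.refl)
    next
      fix x y assume "x \<in> carrier ?T" "y \<in> carrier ?T"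
      then show "x \<oplus>\<^bsub>?T\<^esub> y = y \<oplus>\<^bsub>?T\<^esub> x"
        by (elim carrier[THEN iffD1, THEN bexE])
           (simp add: simps tensor_class_eq_iff tensor_eq.comm)
    qed (auto simp: simps)
    show "Group.monoid ?T"
      by (rule monoidI) (auto simp: simps formal_mult_assoc unit)
    fix x y z assume "x \<in> carrier ?T" "y \<in> carrier ?T" "z \<in> carrier ?T"
    then show "(x \<oplus>\<^bsub>?T\<^esub> y) \<otimes>\<^bsub>?T\<^esub> z = x \<otimes>\<^bsub>?T\<^esub> z \<oplus>\<^bsub>?T\<^esub> y \<otimes>\<^bsub>?T\<^esub> z"
      and "z \<otimes>\<^bsub>?T\<^esub> (x \<oplus>\<^bsub>?T\<^esub> y) = z \<otimes>\<^bsub>?T\<^esub> x \<oplus>\<^bsub>?T\<^esub> z \<otimes>\<^bsub>?T\<^esub> y"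
      by (elim carrier[THEN iffD1, THEN bexE];
          simp add: simps tensor_class_eq_iff tensor_eq_formal_mult_append)+
  qed
qed

end

text \<open>For a \<open>\<rat>\<close>-algebra \<open>B\<close>, the tensor products of \<open>B\<close> and \<open>\<real>\<close> over \<open>\<int>\<close> and over \<open>\<rat>\<close> agree, since
  \<open>(x / m) \<otimes> r = (x / m) \<otimes> (m \<cdot> (r / m)) = x \<otimes> (r / m)\<close>. As \<open>\<real>\<close> is the centre of \<open>Mat\<^sub>2(\<real>)\<close> and has
  no nontrivial field automorphism, a ring isomorphism with \<open>Mat\<^sub>2(\<real>)\<close> is automatically
  \<open>\<real>\<close>-linear.\<close>

definition indefinite :: "('a, 'm) ring_scheme \<Rightarrow> bool" where
  "indefinite B \<longleftrightarrow>
     tensor_ring B (ring_of_type_algebra :: real ring) \<simeq> (ring_mat TYPE(real) 2 () :: real mat ring)"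


section \<open>Orders\<close>

text \<open>The last conjunct says that the lattice \<open>\<O>\<close> spans \<open>B\<close> over \<open>\<rat>\<close>.\<close>

definition is_order :: "('a, 'm) ring_scheme \<Rightarrow> 'a set \<Rightarrow> bool" where
  "is_order B \<O> \<longleftrightarrow>
     subring \<O> B \<and>
     (\<exists>S. finite S \<and> S \<subseteq> \<O> \<and> \<O> = generate (add_monoid B) S) \<and>
     (\<forall>x\<in>carrier B. \<exists>m::nat. m > 0 \<and> [m] \<cdot>\<^bsub>B\<^esub> x \<in> \<O>)"

definition maximal_order :: "('a, 'm) ring_scheme \<Rightarrow> 'a set \<Rightarrow> bool" where
  "maximal_order B \<O> \<longleftrightarrow>
     is_order B \<O> \<and> (\<forall>\<O>'. is_order B \<O>' \<and> \<O> \<subseteq> \<O>' \<longrightarrow> \<O>' = \<O>)"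


section \<open>Ring automorphisms and their reductions\<close>

text \<open>As for groups in \<^theory>\<open>HOL-Algebra.Bij\<close>.\<close>

definition ring_auto :: "('a, 'm) ring_scheme \<Rightarrow> ('a \<Rightarrow> 'a) set" where
  "ring_auto R = Ring.ring_hom R R \<inter> Bij (carrier R)"

definition RingAutoGroup :: "('a, 'm) ring_scheme \<Rightarrow> ('a \<Rightarrow> 'a) monoid" where
  "RingAutoGroup R = BijGroup (carrier R) \<lparr>carrier := ring_auto R\<rparr>"

definition multiples :: "('a, 'm) ring_scheme \<Rightarrow> nat \<Rightarrow> 'a set" where
  "multiples R N = (\<lambda>x. [N] \<cdot>\<^bsub>R\<^esub> x) ` carrier R"

definition mod_ring :: "('a, 'm) ring_scheme \<Rightarrow> nat \<Rightarrow> 'a set ring" where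
  "mod_ring R N = R Quot (multiples R N)"

text \<open>The automorphism of \<open>R / NR\<close> induced by \<open>g\<close>. It is written as the image of a coset, which is
  \<open>g (x + NR) = g x + NR\<close> by the lemma below.\<close>

definition reduce_auto :: "('a, 'm) ring_scheme \<Rightarrow> nat \<Rightarrow> ('a \<Rightarrow> 'a) \<Rightarrow> 'a set \<Rightarrow> 'a set" where
  "reduce_auto R N g = (\<lambda>C\<in>carrier (mod_ring R N). g ` C)"

lemma reduce_auto_coset:
  assumes "Ring.ring R" "g \<in> ring_auto R" "x \<in> carrier R"
  shows "reduce_auto R N g (multiples R N +>\<^bsub>R\<^esub> x) = multiples R N +>\<^bsub>R\<^esub> g x"
proof -
  interpret Ring.ring R by fact
  have g: "g \<in> Ring.ring_hom R R" "g ` carrier R = carrier R"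
    using assms(2) by (auto simp: ring_auto_def Bij_def bij_betw_def)
  interpret g: ring_hom_ring R R g
    using g(1) by (intro ring_hom_ringI2) (auto intro: assms(1))
  have nat: "g ([n] \<cdot>\<^bsub>R\<^esub> y) = [n] \<cdot>\<^bsub>R\<^esub> g y" if "y \<in> carrier R" for y and n :: nat
    using that by (induction n) auto
  have "g ` multiples R N = (\<lambda>y. [N] \<cdot>\<^bsub>R\<^esub> y) ` (g ` carrier R)"
    unfolding multiples_def image_image using nat by (intro image_cong) auto
  then have m: "g ` multiples R N = multiples R N"
    unfolding g(2) multiples_def .
  have sub: "multiples R N \<subseteq> carrier R" by (auto simp: multiples_def)
  have "multiples R N +>\<^bsub>R\<^esub> x \<in> carrier (mod_ring R N)"
    using assms(3) by (auto simp: mod_ring_def FactRing_def A_RCOSETS_def' a_r_coset_def')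
  moreover have "g ` (multiples R N +>\<^bsub>R\<^esub> x) = (\<lambda>y. g (y \<oplus>\<^bsub>R\<^esub> x)) ` multiples R N"
    by (auto simp: a_r_coset_def')
  moreover have "\<dots> = (\<lambda>y. y \<oplus>\<^bsub>R\<^esub> g x) ` (g ` multiples R N)"
    unfolding image_image using sub assms(3) by (intro image_cong) auto
  ultimately show ?thesis
    unfolding m by (auto simp: reduce_auto_def a_r_coset_def')
qed

definition fixed_points :: "('a, 'm) ring_scheme \<Rightarrow> nat \<Rightarrow> ('a \<Rightarrow> 'a) set \<Rightarrow> 'a set set" where
  "fixed_points R N G = {C \<in> carrier (mod_ring R N). \<forall>g\<in>G. reduce_auto R N g C = C}"

definition fixed_group :: "('a, 'm) ring_scheme \<Rightarrow> nat \<Rightarrow> ('a \<Rightarrow> 'a) set \<Rightarrow> 'a set monoid" where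
  "fixed_group R N G = (add_monoid (mod_ring R N)) \<lparr>carrier := fixed_points R N G\<rparr>"


section \<open>Dihedral groups and powers of cyclic groups\<close>

text \<open>The pair \<open>(u, e)\<close> stands for \<open>\<rho>\<^sup>u\<close> if \<open>e\<close> is false and for \<open>\<rho>\<^sup>u \<sigma>\<close> otherwise, where \<open>\<rho>\<close> has
  order \<open>n\<close>, \<open>\<sigma>\<close> has order 2 and \<open>\<sigma> \<rho> \<sigma> = \<rho>\<^sup>-\<^sup>1\<close>.\<close>

definition dihedral_group :: "nat \<Rightarrow> (int \<times> bool) monoid" where
  "dihedral_group n =
    \<lparr>carrier = {0..<int n} \<times> UNIV,
     monoid.mult = (\<lambda>(u, e) (v, f). ((if e then u - v else u + v) mod int n, e \<noteq> f)),
     one = (0, False)\<rparr>"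

lemma group_dihedral_group:
  assumes "n > 0"
  shows "Group.group (dihedral_group n)"
proof (rule groupI)
  fix x assume "x \<in> carrier (dihedral_group n)"
  then obtain u e where x: "x = (u, e)" "0 \<le> u" "u < int n"
    by (auto simp: dihedral_group_def)
  show "\<exists>y\<in>carrier (dihedral_group n). y \<otimes>\<^bsub>dihedral_group n\<^esub> x = \<one>\<^bsub>dihedral_group n\<^esub>"
    using x assms
    by (intro bexI[of _ "(if e then u else (- u) mod int n, e)"])
       (auto simp: dihedral_group_def mod_simps)
next
  fix x y z
  assume "x \<in> carrier (dihedral_group n)" "y \<in> carrier (dihedral_group n)"
    "z \<in> carrier (dihedral_group n)"
  obtain u e v f w g where "x = (u, e)" "y = (v, f)" "z = (w, g)"
    by (metis surj_pair)
  then show "x \<otimes>\<^bsub>dihedral_group n\<^esub> y \<otimes>\<^bsub>dihedral_group n\<^esub> z =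
      x \<otimes>\<^bsub>dihedral_group n\<^esub> (y \<otimes>\<^bsub>dihedral_group n\<^esub> z)"
    by (cases e; cases f; simp add: dihedral_group_def mod_simps;
        intro arg_cong[of _ _ "\<lambda>t. t mod int n"]; linarith)
qed (use assms in \<open>auto simp: dihedral_group_def\<close>)

lemma order_dihedral_group: "Coset.order (dihedral_group n) = 2 * n"
  by (simp add: Coset.order_def dihedral_group_def card_cartesian_product)

definition zmod_power :: "nat \<Rightarrow> nat \<Rightarrow> (nat \<Rightarrow> int) monoid" where
  "zmod_power N k = product_group {..<k} (\<lambda>_. integer_mod_group N)"

end

theory Submission
  imports Defs
begin

text \<open>\<open>B\<close> embeds into the \<open>2 \<times> 2\<close> complex matrices, so that \<open>\<O>\<close> becomes a ring \<open>L\<close> with integral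
  trace and norm satisfying the Cayley--Hamilton identity.

  A nontrivial involution of \<open>L\<close> fixes a pure element \<open>x \<noteq> 0\<close> and is conjugation by \<open>x\<close>. Hence two distinct
  involutions have only \<open>\<int>\<close> as common fixed ring, which settles all cases where the order of a suitable
  subgroup is prime to \<open>N\<close> by averaging. A product of two involutions is conjugation by the product \<open>c\<close>
  of their elements. If it has order 3, then \<open>c\<close> is an integer multiple of some \<open>\<omega>\<close> with
  \<open>\<omega>\<^sup>2 + \<omega> + 1 = 0\<close>; if it has order 4, then \<open>2c\<close> is an integer multiple of \<open>1 + i\<close> with \<open>i\<^sup>2 = -1\<close>.
  As \<open>\<omega>\<close> and \<open>i\<close> normalise \<open>L\<close>, they lie in \<open>L\<close> by maximality, and \<open>L\<close> becomes a module over \<open>\<int>[\<omega>]\<close> or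
  \<open>\<int>[i]\<close>, in which the fixed points modulo 3 and 2 can be computed.

  For \<open>N = 2\<close> one more consequence of maximality is needed: some element of \<open>L\<close> has odd trace. This
  excludes a trivial action of \<open>D\<^sub>2\<close> on \<open>L / 2L\<close> and bounds the fixed points of \<open>D\<^sub>4\<close>.\<close>

section \<open>Bases modulo an integer\<close>

text \<open>Averaging needs the order of the acting subgroup to be invertible modulo
  \<open>N\<close>. Where it is not, a fixed class of L/NL need not lift to a fixed element of L,
  and this obstacle shapes the proof. For an involution g modulo 2 the image of g - 1 is again
  fixed, so kernel and image bound each other inside L/2L, which has 16 elements. Fixed points are
  therefore represented by their preimages in L and measured by coefficient families modulo
  \<open>N\<close>, a notion that covers ranks over the integers and dimensions over prime fields
  alike. The equations for \<omega> and i come from Cayley-Hamilton: if conjugation by c has order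
  m, then c^m is central, so the coefficient of c vanishes when c^m is reduced to a linear
  expression in c. With trace t and norm n of c this coefficient is t^2 - n for m = 3 and t (t^2 -
  2n) for m = 4. The division property of B enters as anisotropy of the norm: it gives
  torsion-freeness, cancellation and nondegeneracy of the trace form.\<close>

definition add_subgroup :: "'a::ab_group_add set \<Rightarrow> bool" where
  "add_subgroup A \<longleftrightarrow> 0 \<in> A \<and> (\<forall>x\<in>A. \<forall>y\<in>A. x - y \<in> A)"

lemma add_subgroupD:
  assumes "add_subgroup A"
  shows "0 \<in> A" and "x \<in> A \<Longrightarrow> y \<in> A \<Longrightarrow> x - y \<in> A" and "x \<in> A \<Longrightarrow> - x \<in> A"
    and "x \<in> A \<Longrightarrow> y \<in> A \<Longrightarrow> x + y \<in> A"
proof -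
  show 0: "0 \<in> A" and d: "\<And>x y. x \<in> A \<Longrightarrow> y \<in> A \<Longrightarrow> x - y \<in> A"
    using assms by (auto simp: add_subgroup_def)
  show n: "\<And>x. x \<in> A \<Longrightarrow> - x \<in> A" using 0 d by (metis diff_0)
  show "x \<in> A \<Longrightarrow> y \<in> A \<Longrightarrow> x + y \<in> A" using d n by (metis diff_minus_eq_add)
qed

lemma add_subgroup_sum:
  assumes "add_subgroup A" "\<And>i. i \<in> I \<Longrightarrow> f i \<in> A"
  shows "sum f I \<in> A"
  using assms(2) by (induction I rule: infinite_finite_induct) (auto intro: add_subgroupD[OF assms(1)])

lemma add_subgroup_of_int_mult:
  fixes x :: "'a::ring_1"
  assumes "add_subgroup A" "x \<in> A"
  shows "of_int n * x \<in> A"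
proof -
  have "of_nat k * x \<in> A" for k
    by (induction k) (auto simp: algebra_simps intro: add_subgroupD[OF assms(1)] assms(2))
  then show ?thesis
    by (cases n) (simp_all add: add_subgroupD(3)[OF assms(1)] del: of_nat_Suc)
qed

lemma add_subgroup_minus_cong:
  assumes "add_subgroup M" "x - y \<in> M"
  shows "x \<in> M \<longleftrightarrow> y \<in> M"
  using assms add_subgroupD(2,4)[OF assms(1)] by (metis diff_add_cancel diff_diff_eq2 add_diff_cancel_left')

text \<open>For \<open>N = 0\<close> and \<open>M = {0}\<close> this is a basis of the abelian group \<open>A\<close>; for \<open>N > 0\<close> and
  \<open>NA \<subseteq> M\<close> it is a basis of \<open>A / M\<close> as a module over \<open>\<int>/N\<int>\<close>.\<close>

definition zbasis :: "int \<Rightarrow> 'a::ring_1 set \<Rightarrow> 'a set \<Rightarrow> nat \<Rightarrow> (nat \<Rightarrow> 'a) \<Rightarrow> bool" where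
  "zbasis N A M r e \<longleftrightarrow> (\<forall>i<r. e i \<in> A) \<and>
     (\<forall>x\<in>A. \<exists>n. x - (\<Sum>i<r. of_int (n i) * e i) \<in> M) \<and>
     (\<forall>n. (\<Sum>i<r. of_int (n i) * e i) \<in> M \<longrightarrow> (\<forall>i<r. N dvd n i))"

lemma zbasisD:
  assumes "zbasis N A M r e"
  shows "i < r \<Longrightarrow> e i \<in> A" and "x \<in> A \<Longrightarrow> \<exists>n. x - (\<Sum>i<r. of_int (n i) * e i) \<in> M"
    and "(\<Sum>i<r. of_int (n i) * e i) \<in> M \<Longrightarrow> i < r \<Longrightarrow> N dvd n i"
  using assms by (auto simp: zbasis_def)

section \<open>Bases of extensions, and lattices given by integer functionals\<close>

lemma sum_lessThan_add:
  fixes g :: "nat \<Rightarrow> 'a::comm_monoid_add"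
  shows "sum g {..<k + l} = sum g {..<k} + (\<Sum>j<l. g (k + j))"
  by (induction l) (simp_all add: add.assoc)

text \<open>A basis of the kernel is joined with lifts of a basis of the image. Independence uses
  that \<open>N\<close> maps \<open>A\<close> into \<open>M\<close>: once the coefficients of the
  lifts are divisible by \<open>N\<close>, their contribution lies in \<open>M\<close> and a
  relation in the kernel remains. With \<open>N = 0\<close> and zero subgroups this is additivity of
  ranks, for prime \<open>N\<close> additivity of dimensions.\<close>

lemma zbasis_append:
  fixes f :: "'a::ring_1 \<Rightarrow> 'b::ring_1"
  assumes A: "add_subgroup A" and M: "add_subgroup M" "M \<subseteq> A" and M': "add_subgroup M'"
    and NA: "\<And>x. x \<in> A \<Longrightarrow> of_int N * x \<in> M"
    and f: "\<And>x y. x \<in> A \<Longrightarrow> y \<in> A \<Longrightarrow> f (x + y) = f x + f y" "f ` M \<subseteq> M'"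
    and e: "zbasis N {x \<in> A. f x \<in> M'} M k e" and e': "zbasis N (f ` A) M' l e'"
  shows "\<exists>e''. zbasis N A M (k + l) e''"
proof -
  have f0: "f 0 = 0" using f(1)[of 0 0] add_subgroupD(1)[OF A] by simp
  have fd: "f (x - y) = f x - f y" if "x \<in> A" "y \<in> A" for x y
    using f(1)[of "x - y" y] that add_subgroupD(2)[OF A] by simp
  have fsum: "f (sum h I) = (\<Sum>i\<in>I. f (h i))" if "\<And>i. i \<in> I \<Longrightarrow> h i \<in> A" for h and I :: "nat set"
    using that
  proof (induction I rule: infinite_finite_induct)
    case (insert i I)
    then show ?case using f(1)[of "h i" "sum h I"] add_subgroup_sum[OF A, of I h] by simp
  qed (auto simp: f0)
  have fnat: "f (of_nat n * x) = of_nat n * f x" if "x \<in> A" for n x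
  proof (induction n)
    case (Suc n)
    have "of_nat n * x \<in> A" using add_subgroup_of_int_mult[OF A that, of "int n"] by simp
    then have "f (x + of_nat n * x) = f x + f (of_nat n * x)" by (rule f(1)[OF that])
    then show ?case using Suc by (simp add: distrib_right)
  qed (simp add: f0)
  have fint: "f (of_int n * x) = of_int n * f x" if "x \<in> A" for n x
  proof (cases n)
    case (neg m)
    have "of_nat (Suc m) * x \<in> A"
      using add_subgroup_of_int_mult[OF A that, of "int (Suc m)"] by (simp del: of_nat_Suc)
    then have "f (0 - of_nat (Suc m) * x) = 0 - of_nat (Suc m) * f x"
      using fd[of 0] f0 fnat[OF that, of "Suc m"] add_subgroupD(1)[OF A] by simp
    then show ?thesis using neg by (simp del: of_nat_Suc)
  qed (use fnat[OF that] in simp)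
  have "\<forall>j<l. \<exists>a. a \<in> A \<and> f a = e' j" using e' unfolding zbasis_def by force
  then obtain a where a: "\<And>j. j < l \<Longrightarrow> a j \<in> A" "\<And>j. j < l \<Longrightarrow> f (a j) = e' j" by metis
  define e'' where "e'' i = (if i < k then e i else a (i - k))" for i
  have eA: "e i \<in> A" "f (e i) \<in> M'" if "i < k" for i using e that unfolding zbasis_def by auto
  have split: "(\<Sum>i<k + l. of_int (n i) * e'' i) =
      (\<Sum>i<k. of_int (n i) * e i) + (\<Sum>j<l. of_int (n (k + j)) * a j)" for n
    unfolding sum_lessThan_add by (simp add: e''_def)
  have sA: "(\<Sum>j<l. of_int (n j) * a j) \<in> A" "(\<Sum>i<k. of_int (n' i) * e i) \<in> A" for n n'
    using a(1) eA by (auto intro!: add_subgroup_sum[OF A] add_subgroup_of_int_mult[OF A])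
  have fa: "f (\<Sum>j<l. of_int (n j) * a j) = (\<Sum>j<l. of_int (n j) * e' j)" for n
    by (subst fsum) (auto intro!: sum.cong add_subgroup_of_int_mult[OF A] a(1) simp: fint a)
  have fe: "f (\<Sum>i<k. of_int (n i) * e i) \<in> M'" for n
    by (subst fsum) (auto intro!: add_subgroup_sum[OF M'] add_subgroup_of_int_mult[OF A]
        add_subgroup_of_int_mult[OF M'] simp: eA fint)
  have "zbasis N A M (k + l) e''"
    unfolding zbasis_def
  proof (intro conjI allI impI ballI)
    fix i assume "i < k + l"
    then show "e'' i \<in> A" using eA a(1) by (auto simp: e''_def)
  next
    fix x assume x: "x \<in> A"
    then obtain m where m: "f x - (\<Sum>j<l. of_int (m j) * e' j) \<in> M'"
      using e' unfolding zbasis_def by blast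
    let ?y = "x - (\<Sum>j<l. of_int (m j) * a j)"
    have "?y \<in> {x \<in> A. f x \<in> M'}"
      using m x sA(1) by (simp add: fd fa add_subgroupD(2)[OF A])
    then obtain n where n: "?y - (\<Sum>i<k. of_int (n i) * e i) \<in> M"
      using e unfolding zbasis_def by blast
    have "x - (\<Sum>i<k + l. of_int (if i < k then n i else m (i - k)) * e'' i) =
        ?y - (\<Sum>i<k. of_int (n i) * e i)"
      unfolding split by (simp add: algebra_simps)
    then have "x - (\<Sum>i<k + l. of_int (if i < k then n i else m (i - k)) * e'' i) \<in> M"
      using n by (simp only:)
    then show "\<exists>n. x - (\<Sum>i<k + l. of_int (n i) * e'' i) \<in> M"
      by (intro exI[of _ "\<lambda>i. if i < k then n i else m (i - k)"])
  next
    fix n i assume n: "(\<Sum>i<k + l. of_int (n i) * e'' i) \<in> M" and i: "i < k + l"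
    have "f (\<Sum>i<k + l. of_int (n i) * e'' i) \<in> M'" using n f(2) by blast
    then have "f (\<Sum>i<k. of_int (n i) * e i) + (\<Sum>j<l. of_int (n (k + j)) * e' j) \<in> M'"
      unfolding split f(1)[OF sA(2) sA(1)] fa .
    then have "(\<Sum>j<l. of_int (n (k + j)) * e' j) \<in> M'"
      using fe add_subgroupD(2)[OF M'] by (metis add_diff_cancel_left')
    then have l: "N dvd n (k + j)" if "j < l" for j
      using zbasisD(3)[OF e', of "\<lambda>j. n (k + j)"] that by blast
    have "of_int (n (k + j)) * a j \<in> M" if "j < l" for j
    proof -
      obtain q where "n (k + j) = q * N" using l[OF \<open>j < l\<close>] by (auto simp: dvd_def mult.commute)
      then show ?thesis
        using add_subgroup_of_int_mult[OF M(1) NA[OF a(1)[OF that]], of q] by (simp add: mult.assoc)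
    qed
    then have "(\<Sum>j<l. of_int (n (k + j)) * a j) \<in> M" by (auto intro: add_subgroup_sum[OF M(1)])
    then have "(\<Sum>i<k. of_int (n i) * e i) \<in> M"
      using n add_subgroupD(2)[OF M(1)] unfolding split by (metis add_diff_cancel_right')
    then have "N dvd n i" if "i < k" for i using e that unfolding zbasis_def by blast
    then show "N dvd n i" using l[of "i - k"] i by (cases "i < k") auto
  qed
  then show ?thesis by blast
qed

text \<open>The least positive element of \<open>A\<close> divides every other one, since a nonzero
  remainder would be a smaller positive element of \<open>A\<close>.\<close>

lemma int_subgroup_zbasis:
  fixes A :: "int set"
  assumes A: "add_subgroup A" and x: "x \<in> A" "x \<noteq> 0"
  shows "\<exists>d. zbasis 0 A {0} 1 (\<lambda>_. d)"
proof -
  define P where "P n \<longleftrightarrow> n > 0 \<and> int n \<in> A" for n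
  have "\<bar>x\<bar> \<in> A" using x add_subgroupD(3)[OF A] by (auto simp: abs_if)
  then have ex: "P (nat \<bar>x\<bar>)" using x by (simp add: P_def)
  define d where "d = (LEAST n. P n)"
  have d: "d > 0" "int d \<in> A" using LeastI[of P, OF ex] by (auto simp: P_def d_def)
  have dvd: "int d dvd y" if "y \<in> A" for y
  proof (rule ccontr)
    assume n: "\<not> int d dvd y"
    have "y mod int d = y - of_int (y div int d) * int d" by (simp add: minus_div_mult_eq_mod)
    then have "y mod int d \<in> A"
      using add_subgroupD(2)[OF A that add_subgroup_of_int_mult[OF A d(2)]] by simp
    moreover have "0 < y mod int d" "y mod int d < int d"
      using n d(1) pos_mod_sign[of "int d" y] pos_mod_bound[of "int d" y] mod_0_imp_dvd[of y "int d"]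
      by linarith+
    ultimately have "P (nat (y mod int d))" "nat (y mod int d) < d" by (auto simp: P_def)
    then show False using not_less_Least unfolding d_def by blast
  qed
  have "\<exists>n::nat \<Rightarrow> int. y - (\<Sum>i<1. of_int (n i) * int d) \<in> {0}" if "y \<in> A" for y
    using dvd[OF that] by (intro exI[of _ "\<lambda>_. y div int d"]) simp
  then have "zbasis 0 A {0} 1 (\<lambda>_. int d)"
    unfolding zbasis_def using d by simp
  then show ?thesis by blast
qed

text \<open>Induction on \<open>r\<close>: the last functional maps \<open>A\<close> onto a nonzero,
  hence infinite cyclic, subgroup of the integers, and its kernel satisfies the hypotheses for the
  remaining functionals. The elements \<open>f i\<close> are dual to the functionals only up to
  nonzero factors; they keep each image from vanishing, so that the rank is exactly
  \<open>r\<close>. Finite generation of \<open>A\<close> comes out as a conclusion.\<close>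

lemma zbasis_of_functionals:
  fixes A :: "'a::ring_1 set" and c :: "nat \<Rightarrow> 'a \<Rightarrow> int"
  assumes "add_subgroup A"
    and "\<And>i x y. i < r \<Longrightarrow> x \<in> A \<Longrightarrow> y \<in> A \<Longrightarrow> c i (x + y) = c i x + c i y"
    and "\<And>x. x \<in> A \<Longrightarrow> (\<And>i. i < r \<Longrightarrow> c i x = 0) \<Longrightarrow> x = 0"
    and "\<And>i. i < r \<Longrightarrow> f i \<in> A" "\<And>i. i < r \<Longrightarrow> c i (f i) \<noteq> 0"
    and "\<And>i j. i < r \<Longrightarrow> j < r \<Longrightarrow> i \<noteq> j \<Longrightarrow> c j (f i) = 0"
  shows "\<exists>e. zbasis 0 A {0} r e"
  using assms
proof (induction r arbitrary: A)
  case 0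
  then show ?case by (auto simp: zbasis_def)
next
  case (Suc r)
  note A = Suc.prems(1) and c = Suc.prems(2)
  let ?K = "{x \<in> A. c r x \<in> {0}}"
  have c0: "c r 0 = 0" using c[of r 0 0] add_subgroupD(1)[OF A] by simp
  have cd: "c r (x - y) = c r x - c r y" if "x \<in> A" "y \<in> A" for x y
    using c[of r "x - y" y] that add_subgroupD(2)[OF A] by simp
  have "\<exists>e. zbasis 0 ?K {0} r e"
  proof (rule Suc.IH)
    show "add_subgroup ?K"
      using add_subgroupD[OF A] by (auto simp: add_subgroup_def c0 cd)
    show "x = 0" if "x \<in> ?K" "\<And>i. i < r \<Longrightarrow> c i x = 0" for x
      using that Suc.prems(3)[of x] by (auto simp: less_Suc_eq)
  qed (use Suc.prems in auto)
  then obtain e where e: "zbasis 0 ?K {0} r e" by blast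
  have "add_subgroup (c r ` A)"
    unfolding add_subgroup_def
  proof (intro conjI ballI)
    show "0 \<in> c r ` A" using c0 add_subgroupD(1)[OF A] by (metis imageI)
    fix x y assume "x \<in> c r ` A" "y \<in> c r ` A"
    then obtain x' y' where "x = c r x'" "y = c r y'" "x' \<in> A" "y' \<in> A" by blast
    then show "x - y \<in> c r ` A" using cd add_subgroupD(2)[OF A] by (metis imageI)
  qed
  moreover have "c r (f r) \<in> c r ` A" "c r (f r) \<noteq> 0" using Suc.prems(4,5) by auto
  ultimately obtain d where d: "zbasis 0 (c r ` A) {0} 1 (\<lambda>_. d)"
    using int_subgroup_zbasis by blast
  have "\<exists>e. zbasis 0 A {0} (r + 1) e"
    by (rule zbasis_append[OF A _ _ _ _ _ _ e d])
       (auto simp: add_subgroup_def c0 c add_subgroupD(1)[OF A])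
  then show ?case by simp
qed

section \<open>Reduction modulo \<open>N\<close> and counting of cosets\<close>

lemma zbasis_multiples:
  assumes A: "add_subgroup A" and e: "zbasis 0 A {0} r e"
  shows "zbasis N A ((*) (of_int N) ` A) r e"
  unfolding zbasis_def
proof (intro conjI allI impI ballI)
  fix x assume "x \<in> A"
  then obtain n where "x - (\<Sum>i<r. of_int (n i) * e i) \<in> {0}" using e unfolding zbasis_def by blast
  then show "\<exists>n. x - (\<Sum>i<r. of_int (n i) * e i) \<in> (*) (of_int N) ` A"
    using add_subgroupD(1)[OF A] by (intro exI[of _ n]) (auto intro!: image_eqI[of _ _ 0])
next
  fix n i assume "(\<Sum>i<r. of_int (n i) * e i) \<in> (*) (of_int N) ` A" and i: "i < r"
  then obtain x where x: "x \<in> A" "(\<Sum>i<r. of_int (n i) * e i) = of_int N * x" by blast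
  obtain m where "x = (\<Sum>i<r. of_int (m i) * e i)" using e x(1) unfolding zbasis_def by force
  then have "(\<Sum>i<r. of_int (n i - N * m i) * e i) = 0"
    using x(2) by (simp add: left_diff_distrib sum_subtractf sum_distrib_left mult.assoc)
  moreover have "\<forall>n. (\<Sum>i<r. of_int (n i) * e i) \<in> {0} \<longrightarrow> (\<forall>i<r. 0 dvd n i)"
    using e unfolding zbasis_def by blast
  ultimately have "0 dvd n i - N * m i" using i by (metis singletonI)
  then show "N dvd n i" by simp
qed (use e in \<open>auto simp: zbasis_def\<close>)

definition quo :: "'a::ab_group_add set \<Rightarrow> 'a set \<Rightarrow> 'a set set" where
  "quo M A = (\<lambda>x. (+) x ` M) ` A"

lemma coset_eq_iff:
  assumes M: "add_subgroup M"
  shows "(+) x ` M = (+) y ` M \<longleftrightarrow> x - y \<in> M"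
proof
  assume "(+) x ` M = (+) y ` M"
  moreover have "x + 0 \<in> (+) x ` M" using add_subgroupD(1)[OF M] by blast
  ultimately obtain m where "m \<in> M" "x = y + m" by auto
  then show "x - y \<in> M" by simp
next
  have sub: "(+) x ` M \<subseteq> (+) y ` M" if "x - y \<in> M" for x y
  proof
    fix z assume "z \<in> (+) x ` M"
    then obtain m where m: "m \<in> M" "z = x + m" by blast
    then have "z = y + ((x - y) + m)" by simp
    then show "z \<in> (+) y ` M" using m that add_subgroupD(4)[OF M] by blast
  qed
  assume "x - y \<in> M"
  moreover then have "y - x \<in> M" using add_subgroupD(3)[OF M] by fastforce
  ultimately show "(+) x ` M = (+) y ` M" using sub by blast
qed

lemma quo_eq_imp_eq:
  assumes M: "add_subgroup M" and A: "add_subgroup A" "M \<subseteq> A" and "A \<subseteq> A'" and "quo M A = quo M A'"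
  shows "A = A'"
proof
  show "A' \<subseteq> A"
  proof
    fix x assume "x \<in> A'"
    then have "(+) x ` M \<in> quo M A" using assms(5) by (auto simp: quo_def)
    then obtain y where y: "y \<in> A" "x - y \<in> M" by (auto simp: quo_def coset_eq_iff[OF M])
    then show "x \<in> A" using add_subgroup_minus_cong[OF A(1)] A(2) by blast
  qed
qed fact

lemma independent_inj_on:
  assumes M: "add_subgroup M" and ind: "\<forall>n. (\<Sum>i<r. of_int (n i) * e i) \<in> M \<longrightarrow> (\<forall>i<r. N dvd n i)"
    and N: "N > 0"
  shows "inj_on (\<lambda>n. (+) (\<Sum>i<r. of_int (n i) * e i) ` M) (PiE {..<r} (\<lambda>_. {0..<N}))"
proof (rule inj_onI)
  fix n m assume n: "n \<in> PiE {..<r} (\<lambda>_. {0..<N})" and m: "m \<in> PiE {..<r} (\<lambda>_. {0..<N})"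
    and "(+) (\<Sum>i<r. of_int (n i) * e i) ` M = (+) (\<Sum>i<r. of_int (m i) * e i) ` M"
  then have "(\<Sum>i<r. of_int (n i - m i) * e i) \<in> M"
    by (simp add: coset_eq_iff[OF M] left_diff_distrib sum_subtractf)
  then have "N dvd n i - m i" if "i < r" for i
    using ind[rule_format, of "\<lambda>i. n i - m i"] that by blast
  then have "n i mod N = m i mod N" if "i < r" for i using that by (simp add: mod_eq_dvd_iff)
  moreover have "n i mod N = n i" "m i mod N = m i" if "i < r" for i
    using n m that by (auto simp: PiE_iff intro!: mod_pos_pos_trivial)
  ultimately show "n = m" using n m by (intro PiE_ext[OF n m]) auto
qed

text \<open>Extensional coefficient functions with values in \<open>{0..<N}\<close> represent each
  coset once. The same functions form the carrier of \<open>zmod_power\<close>, so the bijection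
  serves for counting and also yields the final isomorphism.\<close>

lemma zbasis_bij_betw:
  assumes M: "add_subgroup M" and A: "add_subgroup A" and NA: "\<And>x. x \<in> A \<Longrightarrow> of_int N * x \<in> M"
    and N: "N > 0" and e: "zbasis N A M r e"
  shows "bij_betw (\<lambda>n. (+) (\<Sum>i<r. of_int (n i) * e i) ` M) (PiE {..<r} (\<lambda>_. {0..<N})) (quo M A)"
  unfolding bij_betw_def
proof
  show "inj_on (\<lambda>n. (+) (\<Sum>i<r. of_int (n i) * e i) ` M) (PiE {..<r} (\<lambda>_. {0..<N}))"
    using e by (intro independent_inj_on[OF M _ N]) (auto simp: zbasis_def)
  have eA: "e i \<in> A" if "i < r" for i using e that by (auto simp: zbasis_def)
  show "(\<lambda>n. (+) (\<Sum>i<r. of_int (n i) * e i) ` M) ` (PiE {..<r} (\<lambda>_. {0..<N})) = quo M A"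
  proof
    show "(\<lambda>n. (+) (\<Sum>i<r. of_int (n i) * e i) ` M) ` (PiE {..<r} (\<lambda>_. {0..<N})) \<subseteq> quo M A"
      unfolding quo_def by (auto intro!: add_subgroup_sum[OF A] add_subgroup_of_int_mult[OF A] eA imageI)
    show "quo M A \<subseteq> (\<lambda>n. (+) (\<Sum>i<r. of_int (n i) * e i) ` M) ` (PiE {..<r} (\<lambda>_. {0..<N}))"
    proof
      fix Y assume "Y \<in> quo M A"
      then obtain x where x: "x \<in> A" "Y = (+) x ` M" by (auto simp: quo_def)
      then obtain n where n: "x - (\<Sum>i<r. of_int (n i) * e i) \<in> M" using e unfolding zbasis_def by blast
      define m where "m = (\<lambda>i\<in>{..<r}. n i mod N)"
      have "(\<Sum>i<r. of_int (n i) * e i) - (\<Sum>i<r. of_int (m i) * e i) =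
          (\<Sum>i<r. of_int (n i div N) * (of_int N * e i))"
        unfolding sum_subtractf[symmetric]
      proof (rule sum.cong)
        fix i assume "i \<in> {..<r}"
        then have "n i = n i div N * N + m i" by (simp add: m_def)
        then show "of_int (n i) * e i - of_int (m i) * e i = of_int (n i div N) * (of_int N * e i)"
          by (metis (no_types, lifting) add_diff_cancel_right' left_diff_distrib mult.assoc of_int_add of_int_mult)
      qed simp
      also have "\<dots> \<in> M"
        by (auto intro!: add_subgroup_sum[OF M] add_subgroup_of_int_mult[OF M] NA eA)
      finally have "x - (\<Sum>i<r. of_int (m i) * e i) \<in> M"
        using add_subgroupD(4)[OF M n] by fastforce
      moreover have "m \<in> PiE {..<r} (\<lambda>_. {0..<N})" using N by (auto simp: m_def)
      ultimately show "Y \<in> (\<lambda>n. (+) (\<Sum>i<r. of_int (n i) * e i) ` M) ` (PiE {..<r} (\<lambda>_. {0..<N}))"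
        using x(2) coset_eq_iff[OF M] by blast
    qed
  qed
qed

lemma card_PiE_const: "card (PiE {..<r} (\<lambda>_. {0..<N::int})) = nat N ^ r"
  by (simp add: card_PiE)

lemma zbasis_card:
  assumes "add_subgroup M" "add_subgroup A" "\<And>x. x \<in> A \<Longrightarrow> of_int N * x \<in> M" "N > 0" "zbasis N A M r e"
  shows "finite (quo M A)" and "card (quo M A) = nat N ^ r"
proof -
  have "finite (PiE {..<r} (\<lambda>_. {0..<N}))" by (auto intro: finite_PiE)
  then show "finite (quo M A)" using bij_betw_finite[OF zbasis_bij_betw[OF assms]] by blast
  show "card (quo M A) = nat N ^ r"
    using bij_betw_same_card[OF zbasis_bij_betw[OF assms]] by (simp add: card_PiE_const)
qed

text \<open>As over a field, a largest independent family spans: a relation in which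
  \<open>x\<close> has a coefficient prime to \<open>p\<close> can be solved for \<open>x\<close> by
  Bezout, so an \<open>x\<close> outside the span could be adjoined. A largest family exists because
  \<open>k\<close> independent elements give \<open>nat p ^ k > k\<close> distinct cosets.\<close>

lemma zbasis_exists_prime:
  assumes M: "add_subgroup M" and A: "add_subgroup A" and pA: "\<And>x. x \<in> A \<Longrightarrow> of_int p * x \<in> M"
    and p: "Factorial_Ring.prime p" and fin: "finite (quo M A)"
  shows "\<exists>k e. zbasis p A M k e"
proof -
  define ind where "ind k e \<longleftrightarrow> (\<forall>i<k. e i \<in> A) \<and>
    (\<forall>n. (\<Sum>i<k. of_int (n i) * e i) \<in> M \<longrightarrow> (\<forall>i<k. p dvd n i))" for k and e :: "nat \<Rightarrow> 'a"
  have p1: "p > 1" using p by (rule prime_gt_1_int)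
  have bound: "k \<le> card (quo M A)" if "ind k e" for k e
  proof -
    have "card (PiE {..<k} (\<lambda>_. {0..<p})) \<le> card (quo M A)"
      using that p1 unfolding ind_def
      by (intro card_inj_on_le[OF independent_inj_on[OF M] _ fin])
         (auto simp: quo_def intro!: imageI add_subgroup_sum[OF A] add_subgroup_of_int_mult[OF A])
    moreover have "k < nat p ^ k" using p1 by (intro power_gt_expt) auto
    ultimately show ?thesis by (simp add: card_PiE_const)
  qed
  obtain k where k: "\<exists>e. ind k e" "\<And>k'. \<exists>e. ind k' e \<Longrightarrow> k' \<le> k"
    using GreatestI_ex_nat[of "\<lambda>k. \<exists>e. ind k e" "card (quo M A)"]
      Greatest_le_nat[of "\<lambda>k. \<exists>e. ind k e" _ "card (quo M A)"] bound
    by (metis (no_types, lifting) ind_def less_nat_zero_code)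
  then obtain e where e: "ind k e" by blast
  have "\<exists>n. x - (\<Sum>i<k. of_int (n i) * e i) \<in> M" if x: "x \<in> A" for x
  proof (rule ccontr)
    assume no: "\<nexists>n. x - (\<Sum>i<k. of_int (n i) * e i) \<in> M"
    have upd: "(\<Sum>i<Suc k. of_int (n i) * (e(k := x)) i) = (\<Sum>i<k. of_int (n i) * e i) + of_int (n k) * x" for n
      by simp
    have "ind (Suc k) (e(k := x))"
      unfolding ind_def upd
    proof (intro conjI allI impI)
      show "(e(k := x)) i \<in> A" if "i < Suc k" for i using e x that by (auto simp: ind_def less_Suc_eq)
      fix n i assume n: "(\<Sum>i<k. of_int (n i) * e i) + of_int (n k) * x \<in> M" and i: "i < Suc k"
      have pk: "p dvd n k"
      proof (rule ccontr)
        assume "\<not> p dvd n k"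
        then have "coprime p (n k)" using p by (simp add: prime_imp_coprime)
        then obtain u v where uv: "u * p + v * n k = 1"
          using bezout_int coprime_iff_gcd_eq_1 by metis
        have "x - (\<Sum>i<k. of_int (- v * n i) * e i) =
            of_int (u * p + v * n k) * x + of_int v * (\<Sum>i<k. of_int (n i) * e i)"
          unfolding uv by (simp add: sum_distrib_left sum_negf mult.assoc)
        also have "\<dots> = of_int u * (of_int p * x) + of_int v * ((\<Sum>i<k. of_int (n i) * e i) + of_int (n k) * x)"
          by (simp add: distrib_right distrib_left mult.assoc add.assoc)
        also have "\<dots> \<in> M"
          by (intro add_subgroupD(4)[OF M] add_subgroup_of_int_mult[OF M] n pA x)
        finally show False using no[simplified, rule_format, of "\<lambda>i. - v * n i"] by blast
      qed
      then obtain q where q: "n k = q * p" by (auto simp: dvd_def mult.commute)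
      have "of_int (n k) * x \<in> M"
        using add_subgroup_of_int_mult[OF M pA[OF x], of q] q by (simp add: mult.assoc)
      then have "(\<Sum>i<k. of_int (n i) * e i) \<in> M"
        using n add_subgroupD(2)[OF M] by (metis add_diff_cancel_right')
      then show "p dvd n i" using e pk i by (auto simp: ind_def less_Suc_eq)
    qed
    then show False using k(2)[of "Suc k"] by auto
  qed
  then have "zbasis p A M k e" using e by (auto simp: zbasis_def ind_def)
  then show ?thesis by blast
qed

lemma quo_mono: "A \<subseteq> A' \<Longrightarrow> quo M A \<subseteq> quo M A'"
  by (auto simp: quo_def)

text \<open>Rank-nullity for the endomorphism that \<open>f\<close> induces on the quotient by
  \<open>M\<close>. In terms of cardinalities it combines directly with inclusions between kernel
  and image.\<close>

lemma card_quo_kernel_image: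
  fixes f :: "'a::ring_1 \<Rightarrow> 'a"
  assumes A: "add_subgroup A" and M: "add_subgroup M" "M \<subseteq> A"
    and pA: "\<And>x. x \<in> A \<Longrightarrow> of_int p * x \<in> M" and p: "Factorial_Ring.prime p" and fin: "finite (quo M A)"
    and f: "\<And>x y. x \<in> A \<Longrightarrow> y \<in> A \<Longrightarrow> f (x + y) = f x + f y" "f ` M \<subseteq> M" "f ` A \<subseteq> A"
  shows "card (quo M A) = card (quo M {x \<in> A. f x \<in> M}) * card (quo M (f ` A))"
proof -
  let ?K = "{x \<in> A. f x \<in> M}"
  have fd: "f (x - y) = f x - f y" if "x \<in> A" "y \<in> A" for x y
    using f(1)[of "x - y" y] that add_subgroupD(2)[OF A] by simp
  have f0: "f 0 = 0" using f(1)[of 0 0] add_subgroupD(1)[OF A] by simp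
  have K: "add_subgroup ?K"
    using add_subgroupD(1,2)[OF A] add_subgroupD(1,2)[OF M(1)] by (simp add: add_subgroup_def fd f0)
  have I: "add_subgroup (f ` A)"
    unfolding add_subgroup_def
  proof (intro conjI ballI)
    show "0 \<in> f ` A" using f0 add_subgroupD(1)[OF A] by (metis imageI)
    fix x y assume "x \<in> f ` A" "y \<in> f ` A"
    then obtain x' y' where "x = f x'" "y = f y'" "x' \<in> A" "y' \<in> A" by blast
    then show "x - y \<in> f ` A" using fd add_subgroupD(2)[OF A] by (metis imageI)
  qed
  have p0: "p > 0" using prime_gt_1_int[OF p] by simp
  have pK: "\<And>x. x \<in> ?K \<Longrightarrow> of_int p * x \<in> M" and pI: "\<And>x. x \<in> f ` A \<Longrightarrow> of_int p * x \<in> M"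
    using pA f(3) by auto
  obtain k e where e: "zbasis p ?K M k e"
    using zbasis_exists_prime[OF M(1) K pK p finite_subset[OF quo_mono fin]] by blast
  obtain l e' where e': "zbasis p (f ` A) M l e'"
    using zbasis_exists_prime[OF M(1) I pI p finite_subset[OF quo_mono[OF f(3)] fin]] by blast
  obtain e'' where e'': "zbasis p A M (k + l) e''"
    using zbasis_append[OF A M M(1) pA f(1,2) e e'] by blast
  show ?thesis
    using zbasis_card(2)[OF M(1) K pK p0 e] zbasis_card(2)[OF M(1) I pI p0 e']
      zbasis_card(2)[OF M(1) A pA p0 e''] by (simp add: power_add)
qed

section \<open>Quaternion orders\<close>

text \<open>A scalar multiplication of its own lets the simplifier move integers past noncommuting factors.\<close>

definition sm :: "int \<Rightarrow> 'a::ring_1 \<Rightarrow> 'a" (infixr \<open>\<star>\<close> 75) where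
  "k \<star> x = of_int k * x"

lemma sm_simps:
  fixes x y :: "'a::ring_1"
  shows "(k \<star> x) * y = k \<star> (x * y)" "x * (k \<star> y) = k \<star> (x * y)" "k \<star> (l \<star> x) = (k * l) \<star> x"
    "k \<star> (x + y) = k \<star> x + k \<star> y" "k \<star> (x - y) = k \<star> x - k \<star> y" "k \<star> (- x) = - (k \<star> x)"
    "(k + l) \<star> x = k \<star> x + l \<star> x" "(k - l) \<star> x = k \<star> x - l \<star> x" "(- k) \<star> x = - (k \<star> x)"
    "1 \<star> x = x" "0 \<star> x = 0" "k \<star> (0::'a) = 0"
proof -
  have "x * of_int k = of_int k * x" by (rule mult_of_int_commute[symmetric])
  then show "x * (k \<star> y) = k \<star> (x * y)" by (metis mult.assoc sm_def)
qed (auto simp: sm_def algebra_simps)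

text \<open>Small coefficients are unfolded into repeated sums, where additive normalisation decides
  identities; \<open>sm_simps\<close> does not relate \<open>2 \<star> x\<close> to
  \<open>x + x\<close>.\<close>

lemma sm_numerals:
  fixes x :: "'a::ring_1"
  shows "2 \<star> x = x + x" "3 \<star> x = x + x + x" "4 \<star> x = x + x + x + x"
    "6 \<star> x = x + x + x + x + x + x"
    "(2 * k) \<star> x = k \<star> x + k \<star> x" "(3 * k) \<star> x = k \<star> x + k \<star> x + k \<star> x"
    "(4 * k) \<star> x = k \<star> x + k \<star> x + k \<star> x + k \<star> x"
proof -
  show "2 \<star> x = x + x" using sm_simps(7)[of 1 1 x] by (simp add: sm_simps)
  show "3 \<star> x = x + x + x" using sm_simps(7)[of 2 1 x] sm_simps(7)[of 1 1 x] by (simp add: sm_simps(10))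
  show "4 \<star> x = x + x + x + x" using sm_simps(7)[of 2 2 x] sm_simps(7)[of 1 1 x] by (simp add: sm_simps(10) algebra_simps)
  show "6 \<star> x = x + x + x + x + x + x"
    using sm_simps(7)[of 4 2 x] sm_simps(7)[of 2 2 x] sm_simps(7)[of 1 1 x] by (simp add: sm_simps(10) algebra_simps)
  show "(2 * k) \<star> x = k \<star> x + k \<star> x" using sm_simps(7)[of k k x] by simp
  show "(3 * k) \<star> x = k \<star> x + k \<star> x + k \<star> x"
    using sm_simps(7)[of "k + k" k x] sm_simps(7)[of k k x] by simp
  show "(4 * k) \<star> x = k \<star> x + k \<star> x + k \<star> x + k \<star> x"
    using sm_simps(7)[of "k + k + k" k x] sm_simps(7)[of "k + k" k x] sm_simps(7)[of k k x] by simp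
qed

lemma sm_in: "add_subgroup A \<Longrightarrow> x \<in> A \<Longrightarrow> k \<star> x \<in> A"
  unfolding sm_def by (rule add_subgroup_of_int_mult)

text \<open>\<open>T\<close> and \<open>D\<close> are the reduced trace and norm. The last assumption is maximality without denominators:
  if \<open>L + L (c / d)\<close> is closed under multiplication, then \<open>c / d\<close> lies in \<open>L\<close>.\<close>

locale quat_order =
  fixes L :: "'a::ring_1 set" and T D :: "'a \<Rightarrow> int"
  assumes L_subgroup: "add_subgroup L" and one_in: "1 \<in> L"
    and mult_in: "x \<in> L \<Longrightarrow> y \<in> L \<Longrightarrow> x * y \<in> L"
    and T_add: "x \<in> L \<Longrightarrow> y \<in> L \<Longrightarrow> T (x + y) = T x + T y"
    and T_one: "T 1 = 2"
    and T_comm: "x \<in> L \<Longrightarrow> y \<in> L \<Longrightarrow> T (x * y) = T (y * x)"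
    and cayley: "x \<in> L \<Longrightarrow> x * x = T x \<star> x - D x \<star> 1"
    and D_mult: "x \<in> L \<Longrightarrow> y \<in> L \<Longrightarrow> D (x * y) = D x * D y"
    and D_eq_0: "x \<in> L \<Longrightarrow> D x = 0 \<Longrightarrow> x = 0"
    and noncomm: "\<exists>x\<in>L. \<exists>y\<in>L. x * y \<noteq> y * x"
    and maximal: "c \<in> L \<Longrightarrow> d \<noteq> 0 \<Longrightarrow> (\<And>x. x \<in> L \<Longrightarrow> \<exists>p\<in>L. \<exists>q\<in>L. c * x = d \<star> p + q * c) \<Longrightarrow>
      \<exists>p\<in>L. \<exists>q\<in>L. c * c = (d * d) \<star> p + d \<star> (q * c) \<Longrightarrow> \<exists>w\<in>L. c = d \<star> w"
begin

section \<open>Consequences of the Cayley-Hamilton identity and of the anisotropic norm\<close>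

lemma L_closed [simp, intro]:
  "0 \<in> L" "1 \<in> L" "x \<in> L \<Longrightarrow> y \<in> L \<Longrightarrow> x * y \<in> L" "x \<in> L \<Longrightarrow> y \<in> L \<Longrightarrow> x + y \<in> L"
  "x \<in> L \<Longrightarrow> y \<in> L \<Longrightarrow> x - y \<in> L" "x \<in> L \<Longrightarrow> - x \<in> L" "x \<in> L \<Longrightarrow> k \<star> x \<in> L"
  using add_subgroupD[OF L_subgroup] sm_in[OF L_subgroup] one_in mult_in by auto

lemma T_0: "T 0 = 0"
  using T_add[of 0 0] by simp

lemma T_neg: "x \<in> L \<Longrightarrow> T (- x) = - T x"
  using T_add[of x "- x"] T_0 by simp

lemma T_diff: "x \<in> L \<Longrightarrow> y \<in> L \<Longrightarrow> T (x - y) = T x - T y"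
  using T_add[of "x - y" y] by simp

lemma T_sm: assumes "x \<in> L" shows "T (k \<star> x) = k * T x"
proof (induction k rule: int_induct[of _ 0])
  case base
  then show ?case by (simp add: sm_simps T_0)
next
  case (step1 i)
  then show ?case using assms by (simp add: sm_simps T_add algebra_simps)
next
  case (step2 i)
  then show ?case using assms by (simp add: sm_simps T_diff algebra_simps)
qed

lemma T_int: "T (k \<star> 1) = 2 * k"
  by (simp add: T_sm T_one)

lemma int_eq_iff: "k \<star> 1 = (l \<star> 1 :: 'a) \<longleftrightarrow> k = l"
  using T_int by (metis mult_cancel_left zero_neq_numeral)

lemma D_int: "D (k \<star> 1) = k * k"
proof -
  have "(k * k) \<star> (1::'a) = (2 * k * k - D (k \<star> 1)) \<star> 1"
    using cayley[of "k \<star> 1"] by (simp add: sm_simps T_int)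
  then show ?thesis unfolding int_eq_iff by simp
qed

lemma D_0: "D 0 = 0"
  using D_int[of 0] by (simp add: sm_simps)

lemma D_1: "D 1 = 1"
  using D_int[of 1] by (simp add: sm_simps)

lemma D_sm: "x \<in> L \<Longrightarrow> D (k \<star> x) = k * k * D x"
  using D_mult[of "k \<star> 1" x] by (simp add: sm_simps D_int)

text \<open>The ambient ring may have torsion; in \<open>L\<close> it is excluded by
  \<open>D (k \<star> x) = k * k * D x\<close> and the anisotropy of \<open>D\<close>.\<close>

lemma sm_eq_0_iff: "x \<in> L \<Longrightarrow> k \<star> x = 0 \<longleftrightarrow> k = 0 \<or> x = 0"
  using D_sm[of x k] D_eq_0[of x] D_0 by (auto simp: sm_simps)

lemma sm_cancel: "k \<star> x = k \<star> y \<Longrightarrow> k \<noteq> 0 \<Longrightarrow> x \<in> L \<Longrightarrow> y \<in> L \<Longrightarrow> x = y"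
  using sm_eq_0_iff[of "x - y" k] by (simp add: sm_simps)

lemma double_eq_0: "x + x = 0 \<Longrightarrow> x \<in> L \<Longrightarrow> x = 0"
  using sm_eq_0_iff[of x 2] by (simp add: sm_numerals)

text \<open>Cayley-Hamilton for \<open>x + y\<close> minus the identities for \<open>x\<close> and
  \<open>y\<close> leaves an unknown multiple \<open>?d\<close> of 1. Taking traces determines
  \<open>?d\<close>, so both formulas come together.\<close>

lemma D_add: "x \<in> L \<Longrightarrow> y \<in> L \<Longrightarrow> D (x + y) = D x + D y + T x * T y - T (x * y)"
  and polar: "x \<in> L \<Longrightarrow> y \<in> L \<Longrightarrow> x * y + y * x = T x \<star> y + T y \<star> x + (T (x * y) - T x * T y) \<star> 1"
proof -
  assume xy: "x \<in> L" "y \<in> L"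
  let ?d = "D (x + y) - D x - D y"
  have "(x + y) * (x + y) = (T x + T y) \<star> (x + y) - D (x + y) \<star> 1"
    using cayley[of "x + y"] xy by (simp add: T_add)
  then have e: "x * y + y * x = T x \<star> y + T y \<star> x - ?d \<star> 1"
    using cayley[of x] cayley[of y] xy by (simp add: sm_simps algebra_simps)
  then have "T (x * y + y * x) = T (T x \<star> y + T y \<star> x - ?d \<star> 1)" by simp
  then have "?d = T x * T y - T (x * y)"
    using xy T_comm[of x y] by (simp add: T_add T_diff T_sm T_one)
  then show "D (x + y) = D x + D y + T x * T y - T (x * y)"
    and "x * y + y * x = T x \<star> y + T y \<star> x + (T (x * y) - T x * T y) \<star> 1"
    using e by (simp_all add: sm_simps)
qed

lemma D_neg: "x \<in> L \<Longrightarrow> D (- x) = D x"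
  using D_sm[of x "- 1"] by (simp add: sm_simps)

lemma pure_polar: "x \<in> L \<Longrightarrow> y \<in> L \<Longrightarrow> T x = 0 \<Longrightarrow> T y = 0 \<Longrightarrow> x * y + y * x = T (x * y) \<star> 1"
  using polar[of x y] by (simp add: sm_simps)

lemma anticomm: "x \<in> L \<Longrightarrow> y \<in> L \<Longrightarrow> T x = 0 \<Longrightarrow> T y = 0 \<Longrightarrow> T (x * y) = 0 \<Longrightarrow> y * x = - (x * y)"
  using pure_polar[of x y] by (simp add: sm_simps eq_neg_iff_add_eq_0 add.commute)

lemma pure_sq: "x \<in> L \<Longrightarrow> T x = 0 \<Longrightarrow> x * x = - (D x \<star> 1)"
  using cayley[of x] by (simp add: sm_simps)

lemma mult_eq_0: "x * y = 0 \<Longrightarrow> x \<in> L \<Longrightarrow> y \<in> L \<Longrightarrow> x = 0 \<or> y = 0"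
  using D_mult[of x y] D_0 D_eq_0[of x] D_eq_0[of y] by auto

lemma right_cancel: "y * x = z * x \<Longrightarrow> x \<noteq> 0 \<Longrightarrow> x \<in> L \<Longrightarrow> y \<in> L \<Longrightarrow> z \<in> L \<Longrightarrow> y = z"
  using mult_eq_0[of "y - z" x] by (auto simp: algebra_simps)

text \<open>Norms give \<open>m * m * D x = k * k\<close>, so \<open>m\<close> divides
  \<open>k\<close>: integrality of the norm plays the role of integral closedness of the
  integers.\<close>

lemma rational_in_L:
  assumes "x \<in> L" "m \<noteq> 0" "m \<star> x = k \<star> 1"
  shows "\<exists>n. x = n \<star> 1"
proof -
  have "m * m * D x = k * k" using assms D_sm D_int by metis
  then have "m ^ 2 dvd k ^ 2" by (metis dvd_triv_left power2_eq_square)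
  then have "m dvd k" by (simp add: pow_divides_pow_iff)
  then obtain n where "k = m * n" by (auto simp: dvd_def)
  then have "m \<star> x = m \<star> (n \<star> 1)" using assms(3) by (simp add: sm_simps)
  then show ?thesis using sm_cancel assms by blast
qed

text \<open>Under the hypotheses \<open>1, w, v, wv\<close> is an orthogonal basis for the trace form.\<close>

lemma trace_form_nondegenerate:
  assumes w: "w \<in> L" "w \<noteq> 0" "T w = 0" and v: "v \<in> L" "v \<noteq> 0" "T v = 0" and wv: "T (w * v) = 0"
    and x: "x \<in> L" "T x = 0" "T (x * w) = 0" "T (x * v) = 0" "T (x * (w * v)) = 0"
  shows "x = 0"
proof -
  have 1: "w * x = - (x * w)" "v * x = - (x * v)" "(w * v) * x = - (x * (w * v))"
    using w v wv x by (auto intro!: anticomm)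
  \<comment> \<open>Moving \<open>x\<close> past \<open>w\<close> and then past \<open>v\<close>
    changes the sign twice, whereas orthogonality to \<open>w * v\<close> changes it once.\<close>
  have "w * v * x = - (w * x * v)" using 1(2) by (simp add: mult.assoc)
  also have "\<dots> = x * (w * v)" using 1(1) by (simp add: mult.assoc)
  finally have "w * v * x = x * (w * v)" .
  then have "x * (w * v) + x * (w * v) = 0"
    using 1(3) by (simp add: neg_eq_iff_add_eq_0)
  then have "x * (w * v) = 0" by (rule double_eq_0) (use w v x in simp)
  then show ?thesis using mult_eq_0 w v x by blast
qed

subsection \<open>Involutions\<close>

definition aut :: "('a \<Rightarrow> 'a) \<Rightarrow> bool" where
  "aut g \<longleftrightarrow> (\<forall>x\<in>L. g x \<in> L) \<and> (\<forall>x\<in>L. \<forall>y\<in>L. g (x + y) = g x + g y) \<and>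
     (\<forall>x\<in>L. \<forall>y\<in>L. g (x * y) = g x * g y) \<and> g 1 = 1 \<and> (\<forall>x\<in>L. g x = 0 \<longrightarrow> x = 0)"

lemma autD:
  assumes "aut g"
  shows "x \<in> L \<Longrightarrow> g x \<in> L" "x \<in> L \<Longrightarrow> y \<in> L \<Longrightarrow> g (x + y) = g x + g y"
    "x \<in> L \<Longrightarrow> y \<in> L \<Longrightarrow> g (x * y) = g x * g y" "g 1 = 1" "x \<in> L \<Longrightarrow> g x = 0 \<Longrightarrow> x = 0"
    "g 0 = 0" "x \<in> L \<Longrightarrow> g (- x) = - g x" "x \<in> L \<Longrightarrow> y \<in> L \<Longrightarrow> g (x - y) = g x - g y"
    "x \<in> L \<Longrightarrow> g (k \<star> x) = k \<star> g x"
proof -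
  have add: "\<And>x y. x \<in> L \<Longrightarrow> y \<in> L \<Longrightarrow> g (x + y) = g x + g y" using assms by (auto simp: aut_def)
  show z: "g 0 = 0" using add[of 0 0] by simp
  show n: "g (- x) = - g x" if "x \<in> L" for x using add[of x "- x"] z that by (simp add: eq_neg_iff_add_eq_0 add.commute)
  show d: "g (x - y) = g x - g y" if "x \<in> L" "y \<in> L" for x y using add[of x "- y"] n that by simp
  show "g (k \<star> x) = k \<star> g x" if x: "x \<in> L"
  proof (induction k rule: int_induct[of _ 0])
    case base
    then show ?case by (simp add: sm_simps z)
  next
    case (step1 i)
    then show ?case using x add[of "i \<star> x" x] by (simp add: sm_simps)
  next
    case (step2 i)
    then show ?case using x d[of "i \<star> x" x] by (simp add: sm_simps)
  qed
qed (use assms in \<open>auto simp: aut_def\<close>)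

text \<open>Applying \<open>g\<close> to the Cayley-Hamilton equation of \<open>x\<close> gives a
  second monic quadratic equation for \<open>g x\<close>. If the linear coefficients differed,
  \<open>g x\<close> would be an integer, hence \<open>x\<close> the same integer, and the traces
  would agree after all.\<close>

lemma T_aut:
  assumes g: "aut g" and x: "x \<in> L"
  shows "T (g x) = T x"
proof (rule ccontr)
  assume ne: "T (g x) \<noteq> T x"
  have "g (x * x) = g (T x \<star> x - D x \<star> 1)" using cayley[OF x] by simp
  then have "g x * g x = T x \<star> g x - D x \<star> 1" using x by (simp add: autD[OF g])
  then have "(T (g x) - T x) \<star> g x = (D (g x) - D x) \<star> 1"
    using cayley[OF autD(1)[OF g x]] by (simp add: sm_simps algebra_simps)
  then obtain n where "g x = n \<star> 1" using rational_in_L ne autD(1)[OF g x] by force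
  then have "g (x - n \<star> 1) = 0" using x by (simp add: autD[OF g])
  then have "x - n \<star> 1 = 0" using autD(5)[OF g, of "x - n \<star> 1"] x by blast
  then have "x = n \<star> 1" by simp
  then show False using \<open>g x = n \<star> 1\<close> ne by simp
qed

definition invol :: "('a \<Rightarrow> 'a) \<Rightarrow> bool" where
  "invol g \<longleftrightarrow> aut g \<and> (\<forall>x\<in>L. g (g x) = x) \<and> (\<exists>x\<in>L. g x \<noteq> x)"

lemma invol_anti_ex:
  assumes "invol g"
  shows "\<exists>v\<in>L. v \<noteq> 0 \<and> g v = - v"
proof -
  obtain x where "x \<in> L" "g x \<noteq> x" and g: "aut g" "\<And>x. x \<in> L \<Longrightarrow> g (g x) = x"
    using assms by (auto simp: invol_def)
  then show ?thesis by (intro bexI[of _ "x - g x"]) (auto simp: autD[OF g(1)])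
qed

lemma anti_pure:
  assumes "aut g" "x \<in> L" "g x = - x"
  shows "T x = 0"
  using T_aut[OF assms(1,2)] T_neg[OF assms(2)] assms(3) by simp

text \<open>An involution is conjugation by any of its fixed pure elements.\<close>

lemma invol_conj:
  assumes g: "invol g" and x: "x \<in> L" "T x = 0" "x \<noteq> 0" "g x = x" and y: "y \<in> L"
  shows "x * y = g y * x"
proof -
  have a: "aut g" and gg: "\<And>x. x \<in> L \<Longrightarrow> g (g x) = x" using g by (auto simp: invol_def)
  note au = autD[OF a]
  obtain v where v: "v \<in> L" "v \<noteq> 0" "g v = - v" using invol_anti_ex[OF g] by blast
  have Tv: "T v = 0" "T (x * v) = 0"
    using v x by (auto intro!: anti_pure[OF a] simp: au)
  let ?m = "y - g y" and ?p = "y + g y"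
  have m: "?m * x = - (x * ?m)"
    using x y by (intro anticomm anti_pure[OF a] x(2)) (auto simp: au gg algebra_simps)
  \<comment> \<open>The part \<open>?m\<close> negated by \<open>g\<close> anticommutes with
    \<open>x\<close>; the fixed part \<open>?p\<close> must be shown to commute with it. The
    commutator is orthogonal to 1 and \<open>x\<close> by cyclicity of the trace, and to
    \<open>v\<close> and \<open>x * v\<close> because \<open>g\<close> negates its products with
    these.\<close>
  let ?w = "x * ?p - ?p * x"
  have "?w = 0"
  proof (rule trace_form_nondegenerate[OF x(1,3,2) v(1,2) Tv])
    have pL: "?p \<in> L" "?w \<in> L" using x y au by auto
    have w: "g ?w = ?w" using x y by (simp add: au gg algebra_simps)
    show "?w \<in> L" by (rule pL)
    show "T ?w = 0" using x(1) pL T_comm by (simp add: T_diff)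
    have "T (x * (?p * x)) = T ((?p * x) * x)" using x(1) pL by (intro T_comm) auto
    then show "T (?w * x) = 0" using x(1) pL by (simp add: T_diff left_diff_distrib mult.assoc)
    show "T (?w * v) = 0" "T (?w * (x * v)) = 0"
      using x(1,4) pL v(1,3) w by (auto intro!: anti_pure[OF a] simp: au(3,1))
  qed
  then have "x * ?p = ?p * x" by simp
  then have "x * ?m + x * ?p = ?p * x - ?m * x" using m by simp
  then have "(x * y - g y * x) + (x * y - g y * x) = 0" by (simp add: algebra_simps)
  then have "x * y - g y * x = 0" by (rule double_eq_0) (use x y au(1) in simp)
  then show ?thesis by simp
qed

text \<open>Otherwise every fixed element is rational. With \<open>v\<close> negated by
  \<open>g\<close>, both \<open>y + g y\<close> and \<open>(y - g y) * v\<close> are fixed, so every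
  \<open>y\<close> has a nonzero multiple in the span of 1 and \<open>v\<close>, and
  \<open>L\<close> would be commutative.\<close>

lemma invol_fixed_ex:
  assumes g: "invol g"
  shows "\<exists>x\<in>L. x \<noteq> 0 \<and> T x = 0 \<and> g x = x"
proof (rule ccontr)
  assume no: "\<not> ?thesis"
  have a: "aut g" and gg: "\<And>x. x \<in> L \<Longrightarrow> g (g x) = x" using g by (auto simp: invol_def)
  note au = autD[OF a]
  obtain v where v: "v \<in> L" "v \<noteq> 0" "g v = - v" using invol_anti_ex[OF g] by blast
  have Tv: "T v = 0" using anti_pure[OF a v(1,3)] .
  have fixd: "2 \<star> z = T z \<star> 1" if "z \<in> L" "g z = z" for z
  proof -
    have "g (2 \<star> z - T z \<star> 1) = 2 \<star> z - T z \<star> 1" "T (2 \<star> z - T z \<star> 1) = 0"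
      using that by (simp_all add: au T_diff T_sm T_one)
    then show ?thesis using no that(1) by (metis L_closed eq_iff_diff_eq_0)
  qed
  have rep: "\<exists>m a b. m \<noteq> 0 \<and> m \<star> y = a \<star> 1 + b \<star> v" if y: "y \<in> L" for y
  proof -
    let ?m = "y - g y" and ?p = "y + g y"
    have p: "2 \<star> ?p = T ?p \<star> 1" using y by (intro fixd) (auto simp: au gg algebra_simps)
    have "2 \<star> (?m * v) = T (?m * v) \<star> 1" using y v by (intro fixd) (auto simp: au gg algebra_simps)
    then have "(2 \<star> (?m * v)) * v = T (?m * v) \<star> v" by (simp add: sm_simps)
    then have "(- 2 * D v) \<star> ?m = T (?m * v) \<star> v"
      using pure_sq[OF v(1) Tv] by (simp add: sm_simps mult.assoc)
    moreover have "(- 2 * D v) \<star> ?p = (- D v * T ?p) \<star> 1"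
      using arg_cong[OF p, of "\<lambda>z. (- D v) \<star> z"] by (simp only: sm_simps(3)) (simp add: mult.commute)
    ultimately have "(- 2 * D v) \<star> (?p + ?m) = (- D v * T ?p) \<star> 1 + T (?m * v) \<star> v"
      by (simp only: sm_simps(4))
    moreover have "?p + ?m = 2 \<star> y" by (simp add: sm_numerals)
    ultimately have "(- 2 * D v * 2) \<star> y = (- D v * T ?p) \<star> 1 + T (?m * v) \<star> v"
      by (simp only: sm_simps(3))
    moreover have "D v \<noteq> 0" using v D_eq_0 by blast
    ultimately show ?thesis by (metis mult_eq_0_iff neg_equal_0_iff_equal zero_neq_numeral)
  qed
  obtain y z where yz: "y \<in> L" "z \<in> L" "y * z \<noteq> z * y" using noncomm by blast
  obtain m a b where m: "m \<noteq> 0" "m \<star> y = a \<star> 1 + b \<star> v" using rep yz by blast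
  obtain m' a' b' where m': "m' \<noteq> 0" "m' \<star> z = a' \<star> 1 + b' \<star> v" using rep yz by blast
  have "(m \<star> y) * (m' \<star> z) = (m' \<star> z) * (m \<star> y)"
    unfolding m m' by (simp add: sm_simps algebra_simps)
  then have "(m * m') \<star> (y * z) = (m * m') \<star> (z * y)" by (simp add: sm_simps mult.commute)
  then show False using yz m m' by (auto dest!: sm_cancel)
qed

text \<open>The doubled pure part \<open>2 \<star> x - T x \<star> 1\<close> is fixed by both
  involutions. If it were nonzero, both would be conjugation by it and so agree.\<close>

lemma fixed_by_two_invols:
  assumes g: "invol g" and h: "invol h" and ne: "\<exists>y\<in>L. g y \<noteq> h y"
    and x: "x \<in> L" "g x = x" "h x = x"
  shows "\<exists>n. x = n \<star> 1"
proof -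
  have a: "aut g" "aut h" using g h by (auto simp: invol_def)
  let ?z = "2 \<star> x - T x \<star> 1"
  have z: "?z \<in> L" "T ?z = 0" "g ?z = ?z" "h ?z = ?z"
    using x by (simp_all add: autD[OF a(1)] autD[OF a(2)] T_diff T_sm T_one)
  have "?z = 0"
  proof (rule ccontr)
    assume "?z \<noteq> 0"
    then have "g y = h y" if "y \<in> L" for y
      using invol_conj[OF g z(1,2) _ z(3) that] invol_conj[OF h z(1,2) _ z(4) that] z(1) that
      by (metis autD(1) a right_cancel)
    then show False using ne by blast
  qed
  then show ?thesis using rational_in_L[OF x(1), of 2 "T x"] by simp
qed

text \<open>\<open>c = x * y\<close> for fixed pure elements \<open>x\<close> of \<open>g\<close>
  and \<open>y\<close> of \<open>h\<close>, so conjugation by \<open>c\<close> is the composite. As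
  \<open>g\<close> is conjugation by \<open>x\<close>, it sends \<open>x * y\<close> to
  \<open>y * x\<close>, the quaternion conjugate of \<open>c\<close>; this later determines
  \<open>g\<close> on \<omega> and i.\<close>

lemma two_invols:
  assumes g: "invol g" and h: "invol h"
  obtains c where "c \<in> L" "c \<noteq> 0" "\<And>y. y \<in> L \<Longrightarrow> c * y = g (h y) * c" "g c = T c \<star> 1 - c"
proof -
  have a: "aut g" "aut h" using g h by (auto simp: invol_def)
  obtain x where x: "x \<in> L" "x \<noteq> 0" "T x = 0" "g x = x" using invol_fixed_ex[OF g] by blast
  obtain y where y: "y \<in> L" "y \<noteq> 0" "T y = 0" "h y = y" using invol_fixed_ex[OF h] by blast
  have "x * y * z = g (h z) * (x * y)" if "z \<in> L" for z
    using invol_conj[OF g x(1,3,2,4), of "h z"] invol_conj[OF h y(1,3,2,4) that] autD(1)[OF a(2) that]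
    by (metis mult.assoc)
  moreover have "g (x * y) = y * x"
  proof -
    have "g (x * y) = g (g y * x)" using invol_conj[OF g x(1,3,2,4) y(1)] by simp
    also have "\<dots> = y * x" using g x y by (simp add: autD[OF a(1)] invol_def)
    finally show ?thesis .
  qed
  then have "g (x * y) = T (x * y) \<star> 1 - x * y"
    using pure_polar[OF x(1) y(1) x(3) y(3)] by (simp add: algebra_simps)
  moreover have "x * y \<noteq> 0" using mult_eq_0 x y by blast
  ultimately show ?thesis using that x y by blast
qed
subsection \<open>Fixed points modulo an integer\<close>

definition NL :: "int \<Rightarrow> 'a set" where "NL N = (\<star>) N ` L"

text \<open>The preimage in \<open>L\<close> of the points of L/NL fixed by \<open>S\<close>, so
  that computations stay inside \<open>L\<close>.\<close>

definition Fix :: "int \<Rightarrow> ('a \<Rightarrow> 'a) set \<Rightarrow> 'a set" where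
  "Fix N S = {x \<in> L. \<forall>g\<in>S. g x - x \<in> NL N}"

lemma NL_I: "x \<in> L \<Longrightarrow> N \<star> x \<in> NL N"
  by (auto simp: NL_def)

lemma NL_eq: "NL N = (*) (of_int N) ` L"
  by (simp add: NL_def sm_def)

lemma NL_subset: "NL N \<subseteq> L"
  by (auto simp: NL_def)

lemma NL_subgroup: "add_subgroup (NL N)"
  unfolding add_subgroup_def NL_def
  by (auto simp flip: sm_simps(5) intro!: imageI image_eqI[of _ _ 0] simp: sm_simps(12))

lemmas NL_closed = add_subgroupD[OF NL_subgroup] sm_in[OF NL_subgroup]

lemma NL_mult: "x \<in> NL N \<Longrightarrow> y \<in> L \<Longrightarrow> x * y \<in> NL N" "x \<in> NL N \<Longrightarrow> y \<in> L \<Longrightarrow> y * x \<in> NL N"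
  by (auto simp: NL_def sm_simps)

lemma NL_aut: "aut g \<Longrightarrow> x \<in> NL N \<Longrightarrow> g x \<in> NL N"
  by (auto simp: NL_def autD)

lemma NL_of_int: "x \<in> L \<Longrightarrow> of_int N * x \<in> NL N"
  by (auto simp: NL_eq)

lemma NL_trans: "x - y \<in> NL N \<Longrightarrow> y - z \<in> NL N \<Longrightarrow> x - z \<in> NL N"
  using NL_closed(4)[of "x - y" N "y - z"] by simp

lemma NL_sym: "x - y \<in> NL N \<Longrightarrow> y - x \<in> NL N"
  using NL_closed(3)[of "x - y" N] by simp

lemma int_in_NL_iff: "k \<star> 1 \<in> NL N \<longleftrightarrow> N dvd k"
proof
  assume "k \<star> 1 \<in> NL N"
  then obtain w where w: "w \<in> L" "N \<star> w = k \<star> 1" by (auto simp: NL_def)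
  show "N dvd k"
  proof (cases "N = 0")
    case True
    then show ?thesis using w int_eq_iff[of 0 k] by (simp add: sm_simps)
  next
    case False
    then obtain n where "w = n \<star> 1" using rational_in_L w by blast
    then show ?thesis using w(2) by (auto simp: sm_simps int_eq_iff)
  qed
next
  assume "N dvd k"
  then show "k \<star> 1 \<in> NL N" by (auto simp: dvd_def NL_def intro!: image_eqI[of _ _ "_ \<star> 1"] simp: sm_simps)
qed

lemma Fix_subgroup:
  assumes "\<And>g. g \<in> S \<Longrightarrow> aut g"
  shows "add_subgroup (Fix N S)"
proof -
  have "g (x - y) - (x - y) \<in> NL N" if "g \<in> S" "x \<in> Fix N S" "y \<in> Fix N S" for g x y
  proof -
    have eq: "g (x - y) - (x - y) = (g x - x) - (g y - y)"
      using that autD(8)[OF assms, of g x y] by (simp add: Fix_def)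
    show ?thesis unfolding eq by (rule NL_closed(2)) (use that in \<open>auto simp: Fix_def\<close>)
  qed
  then show ?thesis
    using NL_closed(1) by (auto simp: add_subgroup_def Fix_def autD(6)[OF assms])
qed

lemma NL_subset_Fix: "(\<And>g. g \<in> S \<Longrightarrow> aut g) \<Longrightarrow> NL N \<subseteq> Fix N S"
  using NL_subset NL_closed(2)[OF NL_aut] by (force simp: Fix_def)

lemma one_in_Fix: "(\<And>g. g \<in> S \<Longrightarrow> aut g) \<Longrightarrow> 1 \<in> Fix N S"
  using NL_closed(1) by (auto simp: Fix_def autD(4))

text \<open>The factor \<open>c\<close> is the order of the group over which one averages; it is
  inverted modulo \<open>N\<close> by Bezout. The class of 1 has order exactly \<open>N\<close> by
  \<open>int_in_NL_iff\<close>.\<close>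

lemma zbasis_one:
  assumes F: "F \<subseteq> L" "1 \<in> F"
    and c: "\<And>x. x \<in> F \<Longrightarrow> \<exists>c n. coprime c N \<and> c \<star> x - n \<star> 1 \<in> NL N"
  shows "zbasis N F (NL N) 1 (\<lambda>_. 1)"
proof -
  have "\<exists>n::nat \<Rightarrow> int. x - (\<Sum>i<1. of_int (n i) * 1) \<in> NL N" if x: "x \<in> F" for x
  proof -
    obtain c n where c: "coprime c N" "c \<star> x - n \<star> 1 \<in> NL N" using c[OF x] by blast
    then obtain u v where uv: "u * c + v * N = 1" using bezout_int coprime_iff_gcd_eq_1 by metis
    have "u \<star> (c \<star> x - n \<star> 1) + N \<star> (v \<star> x) = (u * c + v * N) \<star> x - (u * n) \<star> 1"
      by (simp add: sm_simps(3,5,7) mult.commute)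
    moreover have "u \<star> (c \<star> x - n \<star> 1) + N \<star> (v \<star> x) \<in> NL N"
      using c(2) x F(1) by (intro NL_closed(4,5) NL_I) auto
    ultimately have "x - (u * n) \<star> 1 \<in> NL N" unfolding uv by (simp only: sm_simps(10))
    then show ?thesis by (intro exI[of _ "\<lambda>_. u * n"]) (simp add: sm_def)
  qed
  moreover have "\<forall>n::nat \<Rightarrow> int. (\<Sum>i<1. of_int (n i) * 1) \<in> NL N \<longrightarrow> (\<forall>i<1. N dvd n i)"
    using int_in_NL_iff by (simp add: sm_def)
  ultimately show ?thesis using F unfolding zbasis_def by blast
qed

text \<open>The functionals that pair \<open>x\<close> with \<open>b i\<close> under the trace form
  are diagonal on the family \<open>b\<close>. The \<open>b i\<close> need only be orthogonal, not a
  basis of \<open>A\<close>.\<close>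

lemma orthogonal_zbasis:
  assumes A: "add_subgroup A" "A \<subseteq> L" and b: "\<And>i. i < r \<Longrightarrow> b i \<in> A" "\<And>i. i < r \<Longrightarrow> T (b i * b i) \<noteq> 0"
    "\<And>i j. i < r \<Longrightarrow> j < r \<Longrightarrow> i \<noteq> j \<Longrightarrow> T (b i * b j) = 0"
    and 0: "\<And>x. x \<in> A \<Longrightarrow> (\<And>i. i < r \<Longrightarrow> T (x * b i) = 0) \<Longrightarrow> x = 0"
  shows "\<exists>e. zbasis 0 A {0} r e"
proof (rule zbasis_of_functionals[of A r "\<lambda>i x. T (x * b i)" b])
  have L: "\<And>x. x \<in> A \<Longrightarrow> x \<in> L" "\<And>i. i < r \<Longrightarrow> b i \<in> L" using A b by auto
  show "T ((x + y) * b i) = T (x * b i) + T (y * b i)" if "i < r" "x \<in> A" "y \<in> A" for i x y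
    using that L by (simp add: distrib_right T_add)
qed (use assms in auto)

lemma pure_sq_trace: "x \<in> L \<Longrightarrow> T x = 0 \<Longrightarrow> x \<noteq> 0 \<Longrightarrow> T (x * x) \<noteq> 0"
  using D_eq_0[of x] pure_sq[of x] by (auto simp: T_neg T_int)

text \<open>Two noncommuting elements have noncommuting doubled pure parts \<open>w\<close> and
  \<open>u\<close>. Their commutator \<open>v\<close> is nonzero, pure and orthogonal to
  \<open>w\<close>, so \<open>1, w, v, w * v\<close> is an orthogonal family for the trace
  form.\<close>

lemma L_zbasis: "\<exists>e. zbasis 0 L {0} 4 e"
proof -
  obtain x y where xy: "x \<in> L" "y \<in> L" "x * y \<noteq> y * x" using noncomm by blast
  define w where "w = 2 \<star> x - T x \<star> 1"
  define u where "u = 2 \<star> y - T y \<star> 1"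
  define v where "v = w * u - u * w"
  have wu: "w \<in> L" "T w = 0" "u \<in> L" "T u = 0"
    using xy by (auto simp: w_def u_def T_diff T_sm T_one)
  have "v = 4 \<star> (x * y - y * x)" by (simp add: v_def w_def u_def sm_simps mult.commute algebra_simps)
  then have v: "v \<in> L" "v \<noteq> 0" using xy sm_eq_0_iff[of "x * y - y * x" 4] by auto
  have w0: "w \<noteq> 0" using v by (auto simp: v_def)
  have Tv: "T v = 0" using wu T_comm[of w u] by (simp add: v_def T_diff)
  have Twv: "T (w * v) = 0"
    using wu T_comm[of "w * u" w] by (simp add: v_def T_diff right_diff_distrib mult.assoc)
  have vw: "T (v * w) = 0" using Twv T_comm[of v w] v wu by simp
  have 1: "T (w * (w * v)) = 0" "T (w * v * w) = 0"
    using pure_sq[of w] wu v Tv T_comm[of "w * v" w]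
    by (simp_all add: mult.assoc[symmetric] sm_simps T_neg T_sm)
  have 2: "T (v * (w * v)) = 0" "T (w * v * v) = 0"
    using pure_sq[of v] wu v Tv T_comm[of v "w * v"]
    by (simp_all add: mult.assoc sm_simps T_neg T_sm)
  have wv0: "w * v \<noteq> 0" using mult_eq_0 wu v w0 by blast
  define b where "b i = [1, w, v, w * v] ! i" for i
  have lt4: "i < 4 \<longleftrightarrow> i = 0 \<or> i = 1 \<or> i = 2 \<or> i = (3::nat)" for i by auto
  have bs: "b 0 = 1" "b 1 = w" "b 2 = v" "b 3 = w * v" by (simp_all add: b_def)
  show ?thesis
  proof (rule orthogonal_zbasis[of L 4 b])
    show "T (b i * b i) \<noteq> 0" if "i < 4" for i
      using that pure_sq_trace[of w] pure_sq_trace[of v] pure_sq_trace[of "w * v"] wu v w0 wv0 Tv Twv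
      unfolding lt4 by (elim disjE; simp only: bs) (simp_all add: T_one)
    show "T (b i * b j) = 0" if "i < 4" "j < 4" "i \<noteq> j" for i j
      using that wu Tv Twv 1 2 vw unfolding lt4 by (elim disjE; simp only: bs) simp_all
    fix x assume x: "x \<in> L" "\<And>i. i < 4 \<Longrightarrow> T (x * b i) = 0"
    show "x = 0"
      using trace_form_nondegenerate[OF wu(1) w0 wu(2) v Tv Twv x(1)] x(2)[of 0] x(2)[of 1] x(2)[of 2] x(2)[of 3]
      unfolding bs by simp
  next
    show "b i \<in> L" if "i < 4" for i
      using that wu v unfolding lt4 by (elim disjE; simp only: bs) simp_all
  qed (simp_all add: L_subgroup)
qed

lemma card_quo_L: "finite (quo (NL 2) L)" "card (quo (NL 2) L) = 16"
proof -
  obtain e where "zbasis 0 L {0} 4 e" using L_zbasis by blast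
  then have e: "zbasis 2 L (NL 2) 4 e"
    unfolding NL_eq by (rule zbasis_multiples[OF L_subgroup])
  have *: "of_int 2 * x \<in> NL 2" if "x \<in> L" for x using NL_of_int[OF that, of 2] .
  show "finite (quo (NL 2) L)" using zbasis_card(1)[OF NL_subgroup L_subgroup * _ e] by simp
  show "card (quo (NL 2) L) = 16" using zbasis_card(2)[OF NL_subgroup L_subgroup * _ e] by simp
qed

text \<open>A fixed element is automatically orthogonal to \<open>v\<close> and
  \<open>x * v\<close>, which \<open>g\<close> negates; hence the pairings with 1 and
  \<open>x\<close> already separate the fixed ring.\<close>

lemma invol_fixed_zbasis:
  assumes g: "invol g"
  shows "\<exists>e. zbasis 0 {x \<in> L. g x = x} {0} 2 e"
proof -
  have a: "aut g" using g by (auto simp: invol_def)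
  obtain x where x: "x \<in> L" "x \<noteq> 0" "T x = 0" "g x = x" using invol_fixed_ex[OF g] by blast
  obtain v where v: "v \<in> L" "v \<noteq> 0" "g v = - v" using invol_anti_ex[OF g] by blast
  have Tv: "T v = 0" "T (x * v) = 0"
    using v x by (auto intro!: anti_pure[OF a] simp: autD[OF a])
  define b where "b i = (if i = 0 then 1 else x)" for i :: nat
  show ?thesis
  proof (rule orthogonal_zbasis[of _ 2 b])
    show "add_subgroup {x \<in> L. g x = x}" by (auto simp: add_subgroup_def autD[OF a])
    show "b i \<in> {x \<in> L. g x = x}" for i using x by (simp add: b_def autD[OF a])
    show "T (b i * b i) \<noteq> 0" for i using x pure_sq_trace[of x] by (simp add: b_def T_one)
    show "T (b i * b j) = 0" if "i < 2" "j < 2" "i \<noteq> j" for i j using that x by (auto simp: b_def)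
    fix y assume y: "y \<in> {x \<in> L. g x = x}" "\<And>i. i < 2 \<Longrightarrow> T (y * b i) = 0"
    have yL: "y \<in> L" "g y = y" using y by auto
    have "T (y * v) = 0" "T (y * (x * v)) = 0"
      using yL x v by (auto intro!: anti_pure[OF a] simp: autD(3,1)[OF a])
    then show "y = 0"
      using trace_form_nondegenerate[OF x(1,2,3) v(1,2) Tv, of y] yL y(2)[of 0] y(2)[of 1]
      by (simp add: b_def)
  qed auto
qed

text \<open>For \<open>N = 2 * m + 1\<close> the number \<open>m + 1\<close> is an inverse of 2, so
  \<open>(m + 1) \<star> (x + g x)\<close> is an honest fixed point congruent to \<open>x\<close>.
  Torsion-freeness shows that a fixed element of NL is \<open>N\<close> times a fixed
  element.\<close>

lemma zbasis_Fix_invol_odd: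
  assumes g: "invol g" and N: "odd N"
  shows "\<exists>e. zbasis N (Fix N {g}) (NL N) 2 e"
proof -
  have a: "aut g" and gg: "\<And>x. x \<in> L \<Longrightarrow> g (g x) = x" using g by (auto simp: invol_def)
  let ?P = "{x \<in> L. g x = x}"
  have P: "add_subgroup ?P" by (auto simp: add_subgroup_def autD[OF a])
  obtain e where "zbasis 0 ?P {0} 2 e" using invol_fixed_zbasis[OF g] by blast
  then have e: "zbasis N ?P ((*) (of_int N) ` ?P) 2 e" by (rule zbasis_multiples[OF P])
  have N0: "N \<noteq> 0" using N by auto
  have NP: "x \<in> (*) (of_int N) ` ?P" if x: "x \<in> ?P" "x \<in> NL N" for x
  proof -
    obtain w where w: "w \<in> L" "x = N \<star> w" using x(2) by (auto simp: NL_def)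
    then have "N \<star> g w = N \<star> w" using x(1) by (simp add: autD(9)[OF a])
    then have "g w = w" using sm_cancel[OF _ N0] w autD(1)[OF a] by blast
    then show ?thesis using w by (auto simp: sm_def)
  qed
  obtain m where m: "N = 2 * m + 1" using N by (auto elim: oddE)
  have "zbasis N (Fix N {g}) (NL N) 2 e"
    unfolding zbasis_def
  proof (intro conjI ballI allI impI)
    show "e i \<in> Fix N {g}" if "i < 2" for i
      using zbasisD(1)[OF e that] by (simp add: Fix_def NL_closed)
    show "N dvd n i" if "(\<Sum>i<2. of_int (n i) * e i) \<in> NL N" "i < 2" for n i
    proof -
      have "(\<Sum>i<2. of_int (n i) * e i) \<in> ?P"
        using zbasisD(1)[OF e] by (intro add_subgroup_sum[OF P] add_subgroup_of_int_mult[OF P]) auto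
      then show ?thesis using zbasisD(3)[OF e] NP that by blast
    qed
    fix x assume x: "x \<in> Fix N {g}"
    then have xL: "x \<in> L" "g x - x \<in> NL N" by (auto simp: Fix_def)
    let ?y = "(m + 1) \<star> (x + g x)"
    have "?y \<in> ?P" using xL by (simp add: autD[OF a] gg add.commute)
    then obtain n where n: "?y - (\<Sum>i<2. of_int (n i) * e i) \<in> (*) (of_int N) ` ?P"
      using zbasisD(2)[OF e] by blast
    then have n': "?y - (\<Sum>i<2. of_int (n i) * e i) \<in> NL N" by (auto simp: NL_eq)
    have "?y - x = (m + 1) \<star> (g x - x) + N \<star> x"
      unfolding m by (simp add: sm_simps sm_numerals)
    then have "x - ?y \<in> NL N" using NL_sym NL_closed(4) NL_closed(5)[OF xL(2)] NL_I[OF xL(1)] by metis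
    from NL_trans[OF this n'] show "\<exists>n. x - (\<Sum>i<2. of_int (n i) * e i) \<in> NL N" by blast
  qed
  then show ?thesis by blast
qed

lemma card_quo_kernel_image_2:
  assumes A: "add_subgroup A" "NL 2 \<subseteq> A" "A \<subseteq> L"
    and f: "\<And>x y. x \<in> A \<Longrightarrow> y \<in> A \<Longrightarrow> f (x + y) = f x + f y" "f ` NL 2 \<subseteq> NL 2" "f ` A \<subseteq> A"
  shows "card (quo (NL 2) A) = card (quo (NL 2) {x \<in> A. f x \<in> NL 2}) * card (quo (NL 2) (f ` A))"
proof (rule card_quo_kernel_image[OF A(1) NL_subgroup A(2) _ _ _ f, of 2])
  show "of_int 2 * x \<in> NL 2" if "x \<in> A" for x using NL_of_int[of x 2] that A by blast
  show "finite (quo (NL 2) A)" using card_quo_L(1) quo_mono[OF A(3)] finite_subset by blast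
qed auto

lemma zbasis_Fix_2:
  assumes "\<And>g. g \<in> S \<Longrightarrow> aut g"
  shows "\<exists>k e. zbasis 2 (Fix 2 S) (NL 2) k e \<and> card (quo (NL 2) (Fix 2 S)) = 2 ^ k \<and> k \<le> 4"
proof -
  have s: "Fix 2 S \<subseteq> L" by (auto simp: Fix_def)
  have *: "of_int 2 * x \<in> NL 2" if "x \<in> Fix 2 S" for x using NL_of_int[of x 2] that s by blast
  have fin: "finite (quo (NL 2) (Fix 2 S))" using card_quo_L(1) quo_mono[OF s] finite_subset by blast
  obtain k e where e: "zbasis 2 (Fix 2 S) (NL 2) k e"
    using zbasis_exists_prime[OF NL_subgroup Fix_subgroup[OF assms] * _ fin] by auto
  have c: "card (quo (NL 2) (Fix 2 S)) = 2 ^ k"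
    using zbasis_card(2)[OF NL_subgroup Fix_subgroup[OF assms] * _ e] by simp
  moreover have "(2::nat) ^ k \<le> 2 ^ 4"
    using c card_mono[OF card_quo_L(1) quo_mono[OF s]] by (simp add: card_quo_L(2))
  then have "k \<le> 4" using power_le_imp_le_exp[of 2 k 4] by simp
  ultimately show ?thesis using e by blast
qed

text \<open>On the image of \<open>g\<close> minus the identity, \<open>g\<close> acts as -1, which
  is trivial modulo 2. So the image lies in the kernel, and the square of the order of the kernel is
  at least 16.\<close>

lemma zbasis_Fix_invol_2:
  assumes g: "invol g"
  shows "\<exists>k e. k \<in> {2, 3, 4} \<and> zbasis 2 (Fix 2 {g}) (NL 2) k e"
proof -
  have a: "aut g" and gg: "\<And>x. x \<in> L \<Longrightarrow> g (g x) = x" using g by (auto simp: invol_def)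
  let ?f = "\<lambda>x. g x - x"
  have "card (quo (NL 2) L) = card (quo (NL 2) {x \<in> L. ?f x \<in> NL 2}) * card (quo (NL 2) (?f ` L))"
    by (rule card_quo_kernel_image_2)
       (auto simp: L_subgroup NL_subset autD[OF a] intro!: NL_closed(2) NL_aut[OF a])
  moreover have "{x \<in> L. ?f x \<in> NL 2} = Fix 2 {g}" by (auto simp: Fix_def)
  ultimately have c: "16 = card (quo (NL 2) (Fix 2 {g})) * card (quo (NL 2) (?f ` L))"
    by (simp add: card_quo_L)
  have "?f ` L \<subseteq> Fix 2 {g}"
  proof
    fix y assume "y \<in> ?f ` L"
    then obtain x where x: "x \<in> L" "y = g x - x" by blast
    then have "g y - y = 2 \<star> (- y)" by (simp add: autD[OF a] gg sm_numerals)
    then show "y \<in> Fix 2 {g}" using x autD(1)[OF a] NL_I[of "- y" 2] by (simp add: Fix_def)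
  qed
  moreover obtain k e where k: "zbasis 2 (Fix 2 {g}) (NL 2) k e" "card (quo (NL 2) (Fix 2 {g})) = 2 ^ k" "k \<le> 4"
    using zbasis_Fix_2[of "{g}"] a by auto
  moreover have "finite (quo (NL 2) (Fix 2 {g}))"
    by (rule finite_subset[OF quo_mono card_quo_L(1)]) (auto simp: Fix_def)
  ultimately have le: "card (quo (NL 2) (?f ` L)) \<le> 2 ^ k" using card_mono[OF _ quo_mono] by metis
  have "16 \<le> 2 ^ k * (2::nat) ^ k" using mult_le_mono2[OF le, of "2 ^ k"] unfolding c k(2) .
  then have "(2::nat) ^ 4 \<le> 2 ^ (k + k)" by (simp add: power_add)
  then have "4 \<le> k + k" using power_le_imp_le_exp[of 2 4 "k + k"] by simp
  then have "k \<in> {2, 3, 4}" using k(3) by auto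
  then show ?thesis using k by blast
qed

section \<open>Existence of an element of odd trace\<close>

lemma NL_dvd: "N dvd k \<Longrightarrow> x \<in> L \<Longrightarrow> k \<star> x \<in> NL N"
  using NL_I[of "_ \<star> x" N] by (auto simp: dvd_def sm_simps)

lemma NL_minus_iff: "x - y \<in> NL N \<Longrightarrow> x \<in> NL N \<longleftrightarrow> y \<in> NL N"
  by (rule add_subgroup_minus_cong[OF NL_subgroup])

text \<open>If all traces were even, then \<open>L / 2L\<close> would be a commutative local ring with residue field
  \<open>\<F>\<^sub>2\<close>, and some \<open>y\<close> in its socle would have norm divisible by 4; adjoining \<open>y / 2\<close> would give a
  larger order.\<close>

lemma odd_trace_ex: "\<exists>x\<in>L. odd (T x)"
proof (rule ccontr)
  assume "\<not> ?thesis"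
  then have ev: "even (T x)" if "x \<in> L" for x using that by blast
  have comm2: "x * y - y * x \<in> NL 2" if "x \<in> L" "y \<in> L" for x y
  proof -
    have "x * y - y * x = T x \<star> y + T y \<star> x + (T (x * y) - T x * T y) \<star> 1 - 2 \<star> (y * x)"
      using polar[OF that] by (simp add: sm_numerals algebra_simps)
    also have "\<dots> \<in> NL 2"
      using that ev by (intro NL_closed(2,4) NL_dvd) auto
    finally show ?thesis .
  qed
  have sq: "x * x \<in> NL 2" if "x \<in> L" "even (D x)" for x
    unfolding cayley[OF that(1)] using that ev by (intro NL_closed(2) NL_dvd) auto
  \<comment> \<open>The elements of even norm are the maximal ideal; every other element is 1 plus
    one of these.\<close>
  have J: "even (D (x - 1))" if "x \<in> L" "odd (D x)" for x
    using D_add[of x "- 1"] that ev[of x] by (simp add: D_neg D_1 T_neg T_one)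
  \<comment> \<open>Elements of even norm kill \<open>y\<close> modulo 2, so \<open>y * x\<close> is
    congruent to 0 or to \<open>y\<close> for each \<open>x\<close>. With even trace and norm
    divisible by 4 this is what maximality asks for with denominator 2, so \<open>y\<close> would
    lie in 2L.\<close>
  have no_soc: False
    if y: "y \<in> L" "y \<notin> NL 2" "4 dvd D y" "\<And>z. z \<in> L \<Longrightarrow> even (D z) \<Longrightarrow> y * z \<in> NL 2" for y
  proof -
    have "\<exists>w\<in>L. y = 2 \<star> w"
    proof (rule maximal[OF y(1)])
      fix x assume x: "x \<in> L"
      show "\<exists>p\<in>L. \<exists>q\<in>L. y * x = 2 \<star> p + q * y"
      proof (cases "even (D x)")
        case True
        then obtain p where "p \<in> L" "y * x = 2 \<star> p" using y(4)[OF x] by (auto simp: NL_def)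
        then show ?thesis by (intro bexI[of _ p] bexI[of _ 0]) auto
      next
        case False
        then have "y * (x - 1) \<in> NL 2" using y(4)[of "x - 1"] J x by simp
        then obtain p where "p \<in> L" "y * (x - 1) = 2 \<star> p" by (auto simp: NL_def)
        then show ?thesis by (intro bexI[of _ p] bexI[of _ 1]) (auto simp: algebra_simps)
      qed
    next
      obtain t where t: "T y = 2 * t" using ev[OF y(1)] by (auto elim: evenE)
      obtain n where n: "D y = 4 * n" using y(3) by (auto simp: dvd_def)
      have "y * y = (2 * 2) \<star> ((- n) \<star> 1) + 2 \<star> (t \<star> 1 * y)"
        unfolding cayley[OF y(1)] t n by (simp add: sm_simps)
      then show "\<exists>p\<in>L. \<exists>q\<in>L. y * y = (2 * 2) \<star> p + 2 \<star> (q * y)" using L_closed by meson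
    qed simp
    then show False using y(2) by (auto simp: NL_def)
  qed
  show False
  proof (cases "\<exists>x\<in>L. \<exists>z\<in>L. even (D x) \<and> even (D z) \<and> x * z \<notin> NL 2")
    case False
    then have zero: "x * z \<in> NL 2" if "x \<in> L" "z \<in> L" "even (D x)" "even (D z)" for x z
      using that by blast
    \<comment> \<open>In this case products of two elements of even norm vanish modulo 2, so by
      \<open>no_soc\<close> those outside 2L have norm 2 modulo 4. The difference of two such has
      norm divisible by 4 and must lie in 2L. Hence at most four classes modulo 2 remain, instead of
      16.\<close>
    have D2: "D y mod 4 = 2" if "y \<in> L" "even (D y)" "y \<notin> NL 2" for y
    proof -
      have "\<not> 4 dvd D y" using no_soc[OF that(1,3)] zero that by blast
      then show ?thesis using that(2) by presburger
    qed
    have unique: "y - z \<in> NL 2"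
      if "y \<in> L" "even (D y)" "y \<notin> NL 2" "z \<in> L" "even (D z)" "z \<notin> NL 2" for y z
    proof (rule ccontr)
      assume n: "y - z \<notin> NL 2"
      have "y * z \<in> NL 2" using zero that by blast
      then obtain w where w: "w \<in> L" "y * z = 2 \<star> w" by (auto simp: NL_def)
      have T4: "4 dvd T (y * z)" using ev[OF w(1)] by (auto simp: w T_sm elim: evenE)
      have "4 dvd T y * T z" using mult_dvd_mono[of 2 "T y" 2 "T z"] ev that by simp
      moreover have "D (y - z) = D y + D z - T y * T z + T (y * z)"
        using D_add[of y "- z"] that by (simp add: D_neg T_neg)
      ultimately have "4 dvd D (y - z)" using T4 D2[OF that(1-3)] D2[OF that(4-6)] by presburger
      moreover then have "even (D (y - z))" by presburger
      ultimately show False using D2[of "y - z"] n that by auto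
    qed
    obtain y where y: "y \<in> L" "\<And>x. x \<in> L \<Longrightarrow> even (D x) \<Longrightarrow> x \<in> NL 2 \<or> x - y \<in> NL 2"
      using unique by (metis L_closed(1))
    have "quo (NL 2) L \<subseteq> (\<lambda>s. (+) s ` NL 2) ` {0, y, 1, y + 1}"
    proof
      fix Y assume "Y \<in> quo (NL 2) L"
      then obtain x where x: "x \<in> L" "Y = (+) x ` NL 2" by (auto simp: quo_def)
      have "x - 0 \<in> NL 2 \<or> x - y \<in> NL 2 \<or> x - 1 \<in> NL 2 \<or> x - (y + 1) \<in> NL 2"
        using y(2)[OF x(1)] y(2)[of "x - 1"] J[OF x(1)] x(1) by (auto simp: algebra_simps)
      then show "Y \<in> (\<lambda>s. (+) s ` NL 2) ` {0, y, 1, y + 1}"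
        unfolding x(2) coset_eq_iff[OF NL_subgroup, symmetric] by blast
    qed
    then have "card (quo (NL 2) L) \<le> card ((\<lambda>s. (+) s ` NL 2) ` {0, y, 1, y + 1})"
      by (intro card_mono) auto
    also have "\<dots> \<le> card {0, y, 1, y + 1}" by (rule card_image_le) simp
    also have "\<dots> \<le> 4" by (simp add: card_insert_if)
    finally show False by (simp add: card_quo_L)
  next
    case True
    then obtain x z where x: "x \<in> L" "even (D x)" and z: "z \<in> L" "even (D z)" and xz: "x * z \<notin> NL 2" by blast
    \<comment> \<open>This puts \<open>x * z\<close> into the socle. Otherwise left multiplication
      by \<open>x\<close> has the five classes of \<open>0\<close>, \<open>x\<close>,
      \<open>x * z\<close>, \<open>x + x * z\<close> and \<open>x * z * w\<close> in its image
      modulo 2. But \<open>x * x\<close> lies in 2L, so the image is contained in the kernel and has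
      at most 4 elements.\<close>
    have "x * z * w \<in> NL 2" if w: "w \<in> L" "even (D w)" for w
    proof (rule ccontr)
      let ?u = "x * z * w"
      assume u: "?u \<notin> NL 2"
      have xzz: "x * z * z \<in> NL 2" using NL_mult(2)[OF sq[OF z] x(1)] by (simp add: mult.assoc)
      have uw: "?u * w \<in> NL 2" using NL_mult(2)[OF sq[OF w], of "x * z"] x z by (simp add: mult.assoc)
      have uz: "?u * z \<in> NL 2"
      proof -
        have "?u * z - x * z * z * w = (x * z) * (w * z - z * w)" by (simp add: algebra_simps)
        then have "?u * z - x * z * z * w \<in> NL 2"
          using NL_mult(2)[OF comm2[OF w(1) z(1)], of "x * z"] x z by simp
        then show ?thesis using NL_minus_iff NL_mult(1)[OF xzz w(1)] by blast
      qed
      have mult_z: "a * z \<in> NL 2" if "a \<in> NL 2" for a using NL_mult(1)[OF that z(1)] .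
      have 1: "x \<notin> NL 2" using mult_z xz by blast
      have 2: "x + x * z \<notin> NL 2"
        using mult_z[of "x + x * z"] xz NL_closed(2)[OF _ xzz, of "x * z + x * z * z"] by (auto simp: distrib_right)
      have 3: "x * z - x \<notin> NL 2"
        using mult_z[of "x * z - x"] xz NL_minus_iff[of "x * z * z" "x * z" 2] xzz by (auto simp: left_diff_distrib)
      have 4: "?u - x \<notin> NL 2"
        using mult_z[of "?u - x"] xz NL_minus_iff[of "?u * z" "x * z" 2] uz by (auto simp: left_diff_distrib)
      have 5: "?u - x * z \<notin> NL 2"
        using NL_mult(1)[of "?u - x * z" 2 w] w u NL_minus_iff[of "?u * w" "?u" 2] uw by (auto simp: left_diff_distrib)
      have 6: "?u - (x + x * z) \<notin> NL 2"
      proof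
        assume "?u - (x + x * z) \<in> NL 2"
        then have "?u * z - x * z - x * z * z \<in> NL 2"
          using mult_z by (fastforce simp: left_diff_distrib distrib_right diff_diff_eq)
        then have "?u * z - x * z \<in> NL 2" using NL_closed(4)[OF _ xzz] by fastforce
        then show False using NL_minus_iff uz xz by blast
      qed
      let ?f = "\<lambda>t. x * t" and ?q = "\<lambda>s. (+) s ` NL 2"
      let ?C = "quo (NL 2) (?f ` L)"
      have c: "card (quo (NL 2) L) = card (quo (NL 2) {t \<in> L. ?f t \<in> NL 2}) * card ?C"
        using x by (intro card_quo_kernel_image_2) (auto simp: L_subgroup NL_subset distrib_left NL_mult)
      have "?f ` L \<subseteq> {t \<in> L. ?f t \<in> NL 2}"
        using x NL_mult(1)[OF sq[OF x]] by (auto simp: mult.assoc)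
      moreover have "finite (quo (NL 2) {t \<in> L. ?f t \<in> NL 2})"
        using card_quo_L(1) quo_mono[of "{t \<in> L. ?f t \<in> NL 2}" L] finite_subset by blast
      ultimately have le: "card ?C \<le> card (quo (NL 2) {t \<in> L. ?f t \<in> NL 2})" and fin: "finite ?C"
        using card_mono quo_mono finite_subset by metis+
      have "card ?C * card ?C \<le> 16" using c mult_le_mono1[OF le, of "card ?C"] by (simp add: card_quo_L)
      moreover have "5 \<le> card ?C"
      proof -
        have ne: "?q a \<noteq> ?q b" if "a - b \<notin> NL 2" for a b using coset_eq_iff[OF NL_subgroup] that by blast
        have "?q x \<noteq> ?q 0" "?q (x * z) \<noteq> ?q 0" "?q (x + x * z) \<noteq> ?q 0" "?q ?u \<noteq> ?q 0"
          "?q (x * z) \<noteq> ?q x" "?q (x + x * z) \<noteq> ?q x" "?q ?u \<noteq> ?q x"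
          "?q (x + x * z) \<noteq> ?q (x * z)" "?q ?u \<noteq> ?q (x * z)" "?q ?u \<noteq> ?q (x + x * z)"
          using 1 2 3 4 5 6 xz u by (intro ne; simp)+
        then have "card {?q ?u, ?q (x + x * z), ?q (x * z), ?q x, ?q 0} = 5" by simp
        moreover have C: "?q (x * t) \<in> ?C" if "t \<in> L" for t using that unfolding quo_def by blast
        have "{?q ?u, ?q (x + x * z), ?q (x * z), ?q x, ?q 0} \<subseteq> ?C"
          using C[of "z * w"] C[of "1 + z"] C[of z] C[of 1] C[of 0] z w
          by (simp add: distrib_left mult.assoc)
        ultimately show ?thesis using card_mono[OF fin] by metis
      qed
      ultimately show False using mult_le_mono[of 5 "card ?C" 5 "card ?C"] by simp
    qed
    moreover have "4 dvd D (x * z)" using mult_dvd_mono[of 2 "D x" 2 "D z"] x z by (simp add: D_mult)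
    ultimately show False using no_soc[of "x * z"] x z xz by blast
  qed
qed

section \<open>Averaging over the group generated by two involutions\<close>

lemma Fix_comp:
  assumes "aut g" "x \<in> L" "y \<in> L" "g x - x \<in> NL N" "y - x \<in> NL N"
  shows "g y - x \<in> NL N"
proof -
  have eq: "g y - x = g (y - x) + (g x - x)" using assms by (simp add: autD(8)[OF assms(1)])
  show ?thesis unfolding eq using NL_closed(4)[OF NL_aut[OF assms(1,5)] assms(4)] .
qed

text \<open>The orbit sum is fixed by both involutions, hence an integer, and its trace
  \<open>4 * T x\<close> determines which one.\<close>

lemma klein_sum:
  assumes g: "invol g" and h: "invol h" and ne: "\<exists>y\<in>L. g y \<noteq> h y"
    and gh: "\<And>y. y \<in> L \<Longrightarrow> g (h y) = h (g y)" and x: "x \<in> L"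
  shows "x + g x + h x + g (h x) = (2 * T x) \<star> 1"
proof -
  have a: "aut g" "aut h" and gg: "\<And>x. x \<in> L \<Longrightarrow> g (g x) = x" and hh: "\<And>x. x \<in> L \<Longrightarrow> h (h x) = x"
    using g h by (auto simp: invol_def)
  let ?z = "x + g x + h x + g (h x)"
  have z: "?z \<in> L" using x by (simp add: autD(1)[OF a(1)] autD(1)[OF a(2)])
  have "g ?z = ?z" using x by (simp add: autD(1,2)[OF a(1)] autD(1,2)[OF a(2)] gg)
  moreover have "h ?z = ?z"
    using x by (simp add: autD(1,2)[OF a(1)] autD(1,2)[OF a(2)] hh flip: gh)
  ultimately obtain n where n: "?z = n \<star> 1" using fixed_by_two_invols[OF g h ne z] by blast
  have "T ?z = 4 * T x" using x by (simp add: T_add T_aut a autD(1)[OF a(1)] autD(1)[OF a(2)])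
  then show ?thesis using n T_int by simp
qed

text \<open>The orbit sum is an integer congruent to \<open>4 \<star> x\<close>. The set
  \<open>F\<close> is only bounded from above because the full group may be larger than the one
  generated by \<open>g\<close> and \<open>h\<close>.\<close>

lemma zbasis_klein_odd:
  assumes g: "invol g" and h: "invol h" and ne: "\<exists>y\<in>L. g y \<noteq> h y"
    and gh: "\<And>y. y \<in> L \<Longrightarrow> g (h y) = h (g y)"
    and F: "F \<subseteq> Fix N {g, h}" "1 \<in> F" and N: "odd N"
  shows "zbasis N F (NL N) 1 (\<lambda>_. 1)"
proof (rule zbasis_one)
  have a: "aut g" "aut h" using g h by (auto simp: invol_def)
  show "F \<subseteq> L" using F by (auto simp: Fix_def)
  fix x assume "x \<in> F"
  then have x: "x \<in> L" "g x - x \<in> NL N" "h x - x \<in> NL N" using F by (auto simp: Fix_def)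
  have "(x + g x + h x + g (h x)) - 4 \<star> x = (g x - x) + (h x - x) + (g (h x) - x)"
    by (simp add: sm_numerals)
  moreover have "\<dots> \<in> NL N"
    using NL_closed(4)[OF NL_closed(4)[OF x(2,3)] Fix_comp[OF a(1) x(1) autD(1)[OF a(2) x(1)] x(2,3)]] .
  ultimately have "4 \<star> x - (2 * T x) \<star> 1 \<in> NL N"
    using klein_sum[OF g h ne gh x(1)] NL_sym by metis
  moreover have "coprime 4 N" using N coprime_power_left_iff[of 2 2 N] by simp
  ultimately show "\<exists>c n. coprime c N \<and> c \<star> x - n \<star> 1 \<in> NL N" by blast
qed (use F in auto)

text \<open>The braid relation leaves six words in \<open>g\<close> and \<open>h\<close>; their sum
  at \<open>x\<close> is fixed by both, hence an integer, and it is congruent to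
  \<open>6 \<star> x\<close>.\<close>

lemma zbasis_S3_coprime:
  assumes g: "invol g" and h: "invol h" and ne: "\<exists>y\<in>L. g y \<noteq> h y"
    and ghg: "\<And>y. y \<in> L \<Longrightarrow> g (h (g y)) = h (g (h y))"
    and F: "F \<subseteq> Fix N {g, h}" "1 \<in> F" and N: "coprime N 2" "coprime N 3"
  shows "zbasis N F (NL N) 1 (\<lambda>_. 1)"
proof (rule zbasis_one)
  have a: "aut g" "aut h" and gg: "\<And>x. x \<in> L \<Longrightarrow> g (g x) = x" and hh: "\<And>x. x \<in> L \<Longrightarrow> h (h x) = x"
    using g h by (auto simp: invol_def)
  note gL = autD(1)[OF a(1)] and hL = autD(1)[OF a(2)]
  show "F \<subseteq> L" using F by (auto simp: Fix_def)
  fix x assume "x \<in> F"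
  then have x: "x \<in> L" "g x - x \<in> NL N" "h x - x \<in> NL N" using F by (auto simp: Fix_def)
  let ?z = "x + g x + h x + g (h x) + h (g x) + g (h (g x))"
  have z: "?z \<in> L" using x by (simp add: gL hL)
  have "g ?z = ?z" using x by (simp add: autD(2)[OF a(1)] gL hL gg)
  moreover have "h (g (h (g x))) = g (h x)" using ghg[of "g x"] x by (simp add: gg gL hL)
  then have "h ?z = ?z" using x ghg[of x] by (simp add: autD(2)[OF a(2)] gL hL hh)
  ultimately obtain n where n: "?z = n \<star> 1" using fixed_by_two_invols[OF g h ne z] by blast
  have "?z - 6 \<star> x = (g x - x) + (h x - x) + (g (h x) - x) + (h (g x) - x) + (g (h (g x)) - x)"
    by (simp add: sm_numerals)
  moreover have "\<dots> \<in> NL N"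
  proof -
    have gh: "g (h x) - x \<in> NL N" using Fix_comp[OF a(1) x(1) hL[OF x(1)] x(2,3)] .
    have hg: "h (g x) - x \<in> NL N" using Fix_comp[OF a(2) x(1) gL[OF x(1)] x(3,2)] .
    have "g (h (g x)) - x \<in> NL N" using Fix_comp[OF a(1) x(1) _ x(2) hg] x(1) by (simp add: gL hL)
    then show ?thesis using NL_closed(4)[OF NL_closed(4)[OF NL_closed(4)[OF NL_closed(4)[OF x(2,3)] gh] hg]] by blast
  qed
  ultimately have "6 \<star> x - n \<star> 1 \<in> NL N" using n NL_sym by metis
  moreover have "coprime (2 * 3) N" using N coprime_mult_left_iff[of 2 3 N] by (simp add: coprime_commute)
  then have "coprime 6 N" by simp
  ultimately show "\<exists>c n. coprime c N \<and> c \<star> x - n \<star> 1 \<in> NL N" by blast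
qed (use F in auto)

text \<open>Lower bound: the norm element \<open>(1 + g)(1 + h)\<close> of the group acts as \<open>2T = 0\<close> on \<open>L / 2L\<close>.\<close>

lemma zbasis_klein_2:
  assumes g: "invol g" and h: "invol h" and ne: "\<exists>y\<in>L. g y \<noteq> h y"
    and gh: "\<And>y. y \<in> L \<Longrightarrow> g (h y) = h (g y)"
  shows "\<exists>k e. k \<in> {2, 3} \<and> zbasis 2 (Fix 2 {g, h}) (NL 2) k e"
proof -
  have a: "aut g" "aut h" and gg: "\<And>x. x \<in> L \<Longrightarrow> g (g x) = x" and hh: "\<And>x. x \<in> L \<Longrightarrow> h (h x) = x"
    using g h by (auto simp: invol_def)
  note gL = autD(1)[OF a(1)] and hL = autD(1)[OF a(2)]
  let ?F = "Fix 2 {g, h}" and ?A = "\<lambda>x. x + g x" and ?C = "\<lambda>x. x + h x"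
  let ?K = "Fix 2 {g}"
  have F: "add_subgroup ?F" "NL 2 \<subseteq> ?F" "?F \<subseteq> L" using a Fix_subgroup[of "{g, h}"] NL_subset_Fix[of "{g, h}"] by auto (auto simp: Fix_def)
  have K: "add_subgroup ?K" "NL 2 \<subseteq> ?K" "?K \<subseteq> L" using a Fix_subgroup[of "{g}"] NL_subset_Fix[of "{g}"] by auto (auto simp: Fix_def)
  obtain k e where k: "zbasis 2 ?F (NL 2) k e" "card (quo (NL 2) ?F) = 2 ^ k" "k \<le> 4"
    using zbasis_Fix_2[of "{g, h}"] a by auto
  have fin: "finite (quo (NL 2) ?F)" using card_quo_L(1) quo_mono[OF F(3)] finite_subset by blast
  have plus: "x + y \<in> NL 2 \<longleftrightarrow> y - x \<in> NL 2" if "x \<in> L" for x y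
    using that NL_minus_iff[of "x + y" "y - x" 2] NL_I[of x 2] by (simp add: sm_numerals)
  have KA: "{x \<in> L. ?A x \<in> NL 2} = ?K" by (auto simp: Fix_def plus)
  have "card (quo (NL 2) L) = card (quo (NL 2) {x \<in> L. ?A x \<in> NL 2}) * card (quo (NL 2) (?A ` L))"
    by (rule card_quo_kernel_image_2)
       (auto simp: L_subgroup NL_subset autD(2)[OF a(1)] gL intro!: NL_closed(4) NL_aut[OF a(1)])
  then have c1: "16 = card (quo (NL 2) ?K) * card (quo (NL 2) (?A ` L))"
    unfolding KA by (simp add: card_quo_L)
  have hK: "h x \<in> ?K" if "x \<in> ?K" for x
  proof -
    have x: "x \<in> L" "g x - x \<in> NL 2" using that by (auto simp: Fix_def)
    have "g (h x) - h x = h (g x - x)" using x gh by (simp add: autD(8)[OF a(2)] gL)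
    then show ?thesis using NL_aut[OF a(2) x(2)] x by (simp add: Fix_def hL)
  qed
  have FC: "{x \<in> ?K. ?C x \<in> NL 2} = ?F" by (auto simp: Fix_def plus)
  have "card (quo (NL 2) ?K) = card (quo (NL 2) {x \<in> ?K. ?C x \<in> NL 2}) * card (quo (NL 2) (?C ` ?K))"
  proof (rule card_quo_kernel_image_2[OF K])
    show "?C ` ?K \<subseteq> ?K" using hK add_subgroupD(4)[OF K(1)] by blast
    show "?C ` NL 2 \<subseteq> NL 2" using NL_aut[OF a(2)] NL_closed(4) by blast
    show "?C (x + y) = ?C x + ?C y" if "x \<in> ?K" "y \<in> ?K" for x y
      using that autD(2)[OF a(2), of x y] by (simp add: Fix_def)
  qed
  then have c2: "card (quo (NL 2) ?K) = 2 ^ k * card (quo (NL 2) (?C ` ?K))" unfolding FC k(2) .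
  have "?A ` L \<subseteq> ?F"
  proof
    fix y assume "y \<in> ?A ` L"
    then obtain x where x: "x \<in> L" "y = x + g x" by blast
    then have yL: "y \<in> L" and gy: "g y = y" by (simp_all add: gL autD(2)[OF a(1)] gg add.commute)
    have "y + h y = (2 * T x) \<star> 1"
      using klein_sum[OF g h ne gh x(1)] x gh by (simp add: autD(2)[OF a(2)] gL hL add.assoc)
    then have "y + h y \<in> NL 2" using NL_dvd[of 2 "2 * T x" 1] by simp
    then show "y \<in> ?F" using yL gy NL_closed(1) plus by (simp add: Fix_def)
  qed
  then have i1: "card (quo (NL 2) (?A ` L)) \<le> 2 ^ k" using card_mono[OF fin quo_mono] k(2) by metis
  have "?C ` ?K \<subseteq> ?F"
  proof
    fix y assume "y \<in> ?C ` ?K"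
    then obtain x where x: "x \<in> ?K" "y = x + h x" by blast
    then have xL: "x \<in> L" by (simp add: Fix_def)
    have "y \<in> ?K" using x hK add_subgroupD(4)[OF K(1)] by blast
    moreover have "h y = y" using x xL by (simp add: autD(2)[OF a(2)] hL hh add.commute)
    ultimately show "y \<in> ?F" using NL_closed(1) by (simp add: Fix_def)
  qed
  then have i2: "card (quo (NL 2) (?C ` ?K)) \<le> 2 ^ k" using card_mono[OF fin quo_mono] k(2) by metis
  \<comment> \<open>L/2L is cut down by the kernel of \<open>?A\<close>, and this by the kernel of
    \<open>?C\<close> on it. The last kernel is the group of fixed points and both images lie in it,
    so the cube of its order is at least 16.\<close>
  have "16 \<le> (2::nat) ^ k * 2 ^ k * 2 ^ k"
    unfolding c1 c2 using i1 i2 by (intro mult_le_mono) auto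
  then have "(2::nat) ^ 4 \<le> 2 ^ (k + k + k)" by (simp add: power_add)
  then have "4 \<le> k + k + k" using power_le_imp_le_exp[of 2 4 "k + k + k"] by simp
  moreover have "k \<noteq> 4"
  proof
    assume "k = 4"
    then have "quo (NL 2) ?F = quo (NL 2) L"
      using k(2) card_quo_L quo_mono[OF F(3)] by (intro card_subset_eq) auto
    then have FL: "?F = L" by (intro quo_eq_imp_eq[OF NL_subgroup F(1,2,3)])
    \<comment> \<open>A trivial action allows the orbit sum, which is \<open>2 * T x\<close>, to be
      halved twice inside \<open>L\<close>, once for each involution; so 4 divides
      \<open>2 * T x\<close>.\<close>
    have "even (T x)" if x: "x \<in> L" for x
    proof -
      have "x + g x \<in> NL 2" using x FL plus by (auto simp: Fix_def)
      then obtain y where y: "y \<in> L" "x + g x = 2 \<star> y" by (auto simp: NL_def)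
      have "y + h y \<in> NL 2" using y(1) FL plus by (auto simp: Fix_def)
      then obtain z where z: "z \<in> L" "y + h y = 2 \<star> z" by (auto simp: NL_def)
      have "4 \<star> z = 2 \<star> (y + h y)" unfolding z by (simp add: sm_simps(3))
      also have "\<dots> = (x + g x) + h (x + g x)" using y by (simp add: sm_simps autD(9)[OF a(2)])
      also have "\<dots> = (2 * T x) \<star> 1"
        using klein_sum[OF g h ne gh x] x gh by (simp add: autD(2)[OF a(2)] gL hL add.assoc)
      finally have e: "4 \<star> z = (2 * T x) \<star> 1" .
      then obtain n where "z = n \<star> 1" using rational_in_L z by force
      then have "4 * n = 2 * T x" using e int_eq_iff by (simp add: sm_simps(3))
      then show ?thesis by presburger
    qed
    then show False using odd_trace_ex by blast
  qed
  ultimately have "k \<in> {2, 3}" using k(3) by auto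
  then show ?thesis using k(1) by blast
qed
subsection \<open>Products of two involutions of order 3 and 4\<close>

text \<open>The cube of \<open>c\<close> is central while \<open>c\<close> is not, which forces
  \<open>t * t = n\<close>. Then \<open>\<omega>\<close> is \<open>- c\<close> divided by
  \<open>t\<close>. Conjugation by it maps \<open>L\<close> into itself and its square is
  \<open>- \<omega> - 1\<close>, so L + L\<omega> is a ring and maximality applies with denominator
  \<open>t\<close>.\<close>

lemma order_3_element:
  assumes g: "invol g" and h: "invol h" and ne: "\<exists>y\<in>L. g y \<noteq> h y"
    and ghg: "\<And>y. y \<in> L \<Longrightarrow> g (h (g y)) = h (g (h y))"
  obtains \<omega> where "\<omega> \<in> L" "\<omega> * \<omega> = - \<omega> - 1" "\<And>y. y \<in> L \<Longrightarrow> \<omega> * y = g (h y) * \<omega>" "g \<omega> = - 1 - \<omega>"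
proof -
  have a: "aut g" "aut h" and gg: "\<And>x. x \<in> L \<Longrightarrow> g (g x) = x" and hh: "\<And>x. x \<in> L \<Longrightarrow> h (h x) = x"
    using g h by (auto simp: invol_def)
  note gL = autD(1)[OF a(1)] and hL = autD(1)[OF a(2)]
  obtain c where c: "c \<in> L" "c \<noteq> 0" "\<And>y. y \<in> L \<Longrightarrow> c * y = g (h y) * c" "g c = T c \<star> 1 - c"
    using two_invols[OF g h] by blast
  define t where "t = T c"
  define n where "n = D c"
  have cc: "c * c = t \<star> c - n \<star> 1" using cayley[OF c(1)] by (simp add: t_def n_def)
  have not_central: "\<exists>y\<in>L. c * y \<noteq> y * c"
  proof (rule ccontr)
    assume "\<not> ?thesis"
    then have "g (h y) = y" if "y \<in> L" for y
      using that c right_cancel[of "g (h y)" c y] by (simp add: gL hL)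
    then have "h y = g y" if "y \<in> L" for y using that gg[of "h y"] by (simp add: hL)
    then show False using ne by metis
  qed
  have tn: "t * t = n"
  proof (rule ccontr)
    assume neq: "t * t \<noteq> n"
    have ccc: "c * c * c = (t * t - n) \<star> c - (t * n) \<star> 1"
      by (simp add: cc left_diff_distrib sm_simps)
    have "c * y = y * c" if y: "y \<in> L" for y
    proof -
      have "c * c * c * y = c * (c * (c * y))" by (simp add: mult.assoc)
      also have "\<dots> = g (h (g (h (g (h y))))) * (c * c * c)"
        using y by (simp add: c(3) gL hL mult.assoc) (simp add: c(3) gL hL mult.assoc[symmetric])
      also have "g (h (g (h (g (h y))))) = y" using y ghg[of "h (g (h y))"] by (simp add: gL hL gg hh)
      finally have "(t * t - n) \<star> (c * y) = (t * t - n) \<star> (y * c)"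
        unfolding ccc by (simp add: left_diff_distrib right_diff_distrib sm_simps(1,2))
      then show ?thesis using sm_cancel[of "t * t - n"] neq c(1) y L_closed(3) by (metis eq_iff_diff_eq_0)
    qed
    then show False using not_central by blast
  qed
  have t0: "t \<noteq> 0" using tn D_eq_0 c by (auto simp: n_def)
  have "\<exists>w\<in>L. - c = t \<star> w"
  proof (rule maximal)
    fix x assume x: "x \<in> L"
    have "- c * x = t \<star> 0 + g (h x) * (- c)" using c(3)[OF x] by (simp add: sm_simps)
    then show "\<exists>p\<in>L. \<exists>q\<in>L. - c * x = t \<star> p + q * - c"
      by (intro bexI[of _ 0] bexI[of _ "g (h x)"]) (simp_all add: x gL hL)
  next
    have "- c * - c = (t * t) \<star> (- 1) + t \<star> (- 1 * - c)" by (simp add: cc sm_simps tn)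
    then show "\<exists>p\<in>L. \<exists>q\<in>L. - c * - c = (t * t) \<star> p + t \<star> (q * - c)" by (intro bexI[of _ "- 1"]) simp_all
  qed (use c t0 in auto)
  then obtain \<omega> where w: "\<omega> \<in> L" "- c = t \<star> \<omega>" by blast
  have cw: "c = - (t \<star> \<omega>)" using w(2) by (metis minus_minus)
  have "(t * t) \<star> (\<omega> * \<omega>) = (t * t) \<star> (- \<omega> - 1)"
    using cc unfolding cw tn[symmetric] by (simp add: sm_simps)
  then have 1: "\<omega> * \<omega> = - \<omega> - 1" using sm_cancel t0 w by auto
  have 2: "\<omega> * y = g (h y) * \<omega>" if y: "y \<in> L" for y
  proof -
    have "t \<star> (\<omega> * y) = t \<star> (g (h y) * \<omega>)" using c(3)[OF y] unfolding cw by (simp add: sm_simps)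
    then show ?thesis using sm_cancel t0 w y gL hL by auto
  qed
  have "g c = - (t \<star> g \<omega>)" using w(1) unfolding cw by (simp add: autD(7,9)[OF a(1)])
  then have "- (t \<star> g \<omega>) = t \<star> 1 + t \<star> \<omega>"
    using c(4) w(2) by (metis t_def diff_conv_add_uminus)
  then have "t \<star> g \<omega> = - (t \<star> 1 + t \<star> \<omega>)" by (metis minus_minus)
  then have "t \<star> g \<omega> = t \<star> (- 1 - \<omega>)" by (simp add: sm_simps)
  then have "g \<omega> = - 1 - \<omega>" using sm_cancel t0 w gL by auto
  then show ?thesis using that w(1) 1 2 by blast
qed

text \<open>The fourth power of \<open>c\<close> is central, but \<open>c * c\<close> is not since
  \<open>g\<close> and \<open>h\<close> do not commute; hence \<open>t \<noteq> 0\<close> and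
  \<open>t * t = 2 * n\<close>. The element \<open>i\<close> is
  \<open>2 \<star> c - t \<star> 1\<close> divided by \<open>t\<close>, so \<open>1 + i\<close> is
  proportional to \<open>c\<close> and induces the same conjugation.\<close>

lemma order_4_element:
  assumes g: "invol g" and h: "invol h" and ne: "\<exists>y\<in>L. g (h y) \<noteq> h (g y)"
    and ghgh: "\<And>y. y \<in> L \<Longrightarrow> g (h (g (h y))) = h (g (h (g y)))"
  obtains i where "i \<in> L" "i * i = - 1" "\<And>y. y \<in> L \<Longrightarrow> (1 + i) * y = g (h y) * (1 + i)" "g i = - i"
proof -
  have a: "aut g" "aut h" and gg: "\<And>x. x \<in> L \<Longrightarrow> g (g x) = x" and hh: "\<And>x. x \<in> L \<Longrightarrow> h (h x) = x"
    using g h by (auto simp: invol_def)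
  note gL = autD(1)[OF a(1)] and hL = autD(1)[OF a(2)]
  obtain c where c: "c \<in> L" "c \<noteq> 0" "\<And>y. y \<in> L \<Longrightarrow> c * y = g (h y) * c" "g c = T c \<star> 1 - c"
    using two_invols[OF g h] by blast
  define t where "t = T c"
  define n where "n = D c"
  have cc: "c * c = t \<star> c - n \<star> 1" using cayley[OF c(1)] by (simp add: t_def n_def)
  have c2: "c * c * y = g (h (g (h y))) * (c * c)" if "y \<in> L" for y
    using that by (simp add: c(3) gL hL mult.assoc) (simp add: c(3) gL hL mult.assoc[symmetric])
  have ne2: "\<exists>y\<in>L. g (h (g (h y))) \<noteq> y"
  proof (rule ccontr)
    assume "\<not> ?thesis"
    then have *: "g (h (g (h y))) = y" if "y \<in> L" for y using that by blast
    have "g (h y) = h (g y)" if y: "y \<in> L" for y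
      using *[of "h (g y)"] * [OF y] y by (metis gL gg hL hh)
    then show False using ne by blast
  qed
  have not_central: "\<exists>y\<in>L. c * y \<noteq> y * c"
  proof (rule ccontr)
    assume "\<not> ?thesis"
    then have "g (h y) = y" if "y \<in> L" for y
      using that c right_cancel[of "g (h y)" c y] by (simp add: gL hL)
    then show False using ne2 by (metis gL hL)
  qed
  have t0: "t \<noteq> 0"
  proof
    assume "t = 0"
    then have cn: "c * c = - (n \<star> 1)" using cc by (simp add: sm_simps)
    have "g (h (g (h y))) = y" if y: "y \<in> L" for y
    proof (rule right_cancel[of _ "c * c"])
      show "g (h (g (h y))) * (c * c) = y * (c * c)" using c2[OF y] unfolding cn by (simp add: sm_simps)
      show "c * c \<noteq> 0" using mult_eq_0 c by blast
    qed (use y c in \<open>auto simp: gL hL\<close>)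
    then show False using ne2 by blast
  qed
  have tn: "t * t = 2 * n"
  proof (rule ccontr)
    assume neq: "t * t \<noteq> 2 * n"
    let ?k = "t * t * t - t * n - t * n"
    have k0: "?k \<noteq> 0"
    proof
      assume "?k = 0"
      then have "t * (t * t - 2 * n) = 0" by (simp add: algebra_simps)
      then show False using t0 neq by simp
    qed
    have c4: "c * c * (c * c) = ?k \<star> c + (n * n - t * t * n) \<star> 1"
    proof -
      have "c * c * (c * c) = (t \<star> c - n \<star> 1) * (t \<star> c - n \<star> 1)" by (simp only: cc)
      also have "\<dots> = (t * t) \<star> (c * c) - (t * n) \<star> c - (t * n) \<star> c + (n * n) \<star> 1"
        by (simp add: left_diff_distrib right_diff_distrib sm_simps algebra_simps)
      finally have "c * c * (c * c) = (t * t) \<star> (c * c) - (t * n) \<star> c - (t * n) \<star> c + (n * n) \<star> 1" .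
      moreover have "?k \<star> c = (t * t * t) \<star> c - (t * n) \<star> c - (t * n) \<star> c" by (simp only: sm_simps(8))
      ultimately show ?thesis
        unfolding cc by (simp add: sm_simps algebra_simps)
    qed
    have "c * y = y * c" if y: "y \<in> L" for y
    proof -
      have "c * c * (c * c) * y = g (h (g (h (g (h (g (h y))))))) * (c * c * (c * c))"
        using c2[OF y] c2[of "g (h (g (h y)))"] y by (metis gL hL mult.assoc)
      also have "g (h (g (h (g (h (g (h y))))))) = y"
        using y ghgh[of "g (h (g (h y)))"] by (simp add: gL hL gg hh)
      finally have "?k \<star> (c * y) = ?k \<star> (y * c)"
        unfolding c4 by (simp add: distrib_right distrib_left sm_simps(1,2))
      then show ?thesis using sm_cancel[OF _ k0] c y by blast
    qed
    then show False using not_central by blast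
  qed
  let ?c = "2 \<star> c - t \<star> 1"
  \<comment> \<open>Since \<open>t * t = 2 * n\<close>, the element \<open>?c\<close> is
    proportional to \<open>c * c\<close>. It therefore induces the square of the rotation, which
    maps \<open>L\<close> into itself, as maximality requires.\<close>
  have tc: "t \<star> ?c = 2 \<star> (c * c)" unfolding cc using tn by (simp add: sm_simps mult.commute)
  have cx: "?c * x = g (h (g (h x))) * ?c" if x: "x \<in> L" for x
  proof -
    have "t \<star> (?c * x) = (t \<star> ?c) * x" "t \<star> (g (h (g (h x))) * ?c) = g (h (g (h x))) * (t \<star> ?c)"
      by (simp_all add: sm_simps(1,2))
    then have "t \<star> (?c * x) = t \<star> (g (h (g (h x))) * ?c)"
      unfolding tc using c2[OF x] by (simp add: sm_simps)
    then show ?thesis using sm_cancel t0 c x gL hL by auto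
  qed
  have sq: "?c * ?c = (t * t) \<star> (- 1)"
  proof -
    have "?c * ?c = 4 \<star> (c * c) - (t \<star> c + t \<star> c + t \<star> c + t \<star> c) + (t * t) \<star> 1"
      unfolding sm_numerals(1,3) by (simp add: sm_simps algebra_simps)
    also have "\<dots> = (t * t - 4 * n) \<star> 1"
      unfolding cc sm_simps(5) sm_numerals(3)[of "t \<star> c"] by (simp add: sm_simps)
    also have "t * t - 4 * n = - (t * t)" using tn by simp
    finally show ?thesis by (simp add: sm_simps)
  qed
  have "\<exists>w\<in>L. ?c = t \<star> w"
  proof (rule maximal)
    fix x assume x: "x \<in> L"
    have "?c * x = t \<star> 0 + g (h (g (h x))) * ?c" using cx[OF x] by (simp add: sm_simps(12))
    then show "\<exists>p\<in>L. \<exists>q\<in>L. ?c * x = t \<star> p + q * ?c"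
      by (intro bexI[of _ 0] bexI[of _ "g (h (g (h x)))"]) (simp_all add: x gL hL)
  next
    have "?c * ?c = (t * t) \<star> (- 1) + t \<star> (0 * ?c)" unfolding sq by (simp add: sm_simps(12))
    then show "\<exists>p\<in>L. \<exists>q\<in>L. ?c * ?c = (t * t) \<star> p + t \<star> (q * ?c)" by (intro bexI[of _ 0] bexI[of _ "- 1"]) simp_all
  qed (use c t0 in auto)
  then obtain i where i: "i \<in> L" "?c = t \<star> i" by blast
  have "(t * t) \<star> (i * i) = (t * t) \<star> (- 1)" using sq unfolding i(2) by (simp add: sm_simps)
  then have 1: "i * i = - 1" using sm_cancel t0 i by auto
  have ti: "t \<star> (1 + i) = 2 \<star> c" using i(2) by (simp add: sm_simps algebra_simps)
  have 2: "(1 + i) * y = g (h y) * (1 + i)" if y: "y \<in> L" for y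
  proof -
    have "t \<star> ((1 + i) * y) = (t \<star> (1 + i)) * y" "t \<star> (g (h y) * (1 + i)) = g (h y) * (t \<star> (1 + i))"
      by (simp_all add: sm_simps(1,2))
    then have "t \<star> ((1 + i) * y) = t \<star> (g (h y) * (1 + i))"
      unfolding ti using c(3)[OF y] by (simp add: sm_simps)
    then show ?thesis using sm_cancel t0 i y gL hL by auto
  qed
  have "g (t \<star> i) = g ?c" using i(2) by simp
  then have "t \<star> g i = 2 \<star> (t \<star> 1 - c) - t \<star> 1"
    using i(1) c(1,4) by (simp add: autD(4,8,9)[OF a(1)] t_def)
  also have "\<dots> = - ?c" by (simp add: sm_simps sm_numerals)
  finally have "t \<star> g i = t \<star> (- i)" unfolding i(2) by (simp add: sm_simps)
  then have "g i = - i" using sm_cancel t0 i gL by auto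
  then show ?thesis using that i(1) 1 2 by blast
qed

section \<open>The rings generated by \<open>i\<close> and \<omega> are their own
  centralisers\<close>

lemma four_dvd_sum_squares: "4 dvd x * x + y * y \<Longrightarrow> even x \<and> even (y::int)"
proof -
  assume d: "4 dvd x * x + y * y"
  then have "even (x * x + y * y)" by (metis dvd_trans even_numeral)
  then have par: "even x = even y" by simp
  show ?thesis
  proof (rule ccontr)
    assume "\<not> ?thesis"
    then obtain u v where "x = 2 * u + 1" "y = 2 * v + 1" using par by (auto elim!: oddE)
    then have "x * x + y * y = 4 * (u * u + u + v * v + v) + 2" by (simp add: algebra_simps)
    then have "4 dvd (2::int)" using d by (metis dvd_add_right_iff dvd_triv_left)
    then show False by simp
  qed
qed

text \<open>If \<open>z\<close> commutes with \<open>i\<close>, its doubled pure part times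
  \<open>i\<close> is rational, so \<open>4 \<star> z\<close> is an integer combination of 1 and
  \<open>i\<close>. Integrality of the norm makes a sum of two squares divisible by 4, so both roots
  are even: the Gaussian integers are integrally closed.\<close>

lemma
  assumes i: "i \<in> L" "i * i = - 1"
  shows trace_i: "T i = 0" and one_i_independent: "a \<star> 1 + b \<star> i = 0 \<Longrightarrow> a = 0 \<and> b = 0"
    and centralizer_i: "z \<in> L \<Longrightarrow> i * z = z * i \<Longrightarrow> \<exists>a b. z = a \<star> 1 + b \<star> i"
proof -
  have nonint: "i \<noteq> n \<star> 1" for n
  proof
    assume "i = n \<star> 1"
    then have "(n * n) \<star> 1 = ((- 1) \<star> 1 :: 'a)" using i(2) by (simp add: sm_simps)
    then have "n * n = - 1" unfolding int_eq_iff .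
    moreover have "0 \<le> n * n" by simp
    ultimately show False by linarith
  qed
  have "T i \<star> i = (D i - 1) \<star> 1" using cayley[OF i(1)] i(2) by (simp add: sm_simps algebra_simps)
  then show Ti: "T i = 0" using rational_in_L[OF i(1)] nonint by blast
  show ind: "a = 0 \<and> b = 0" if "a \<star> 1 + b \<star> i = 0" for a b
  proof -
    have "b \<star> i = (- a) \<star> 1" using that by (simp add: sm_simps eq_neg_iff_add_eq_0 add.commute)
    then have "b = 0" using rational_in_L[OF i(1)] nonint by blast
    then show ?thesis using that int_eq_iff[of a 0] by (simp add: sm_simps)
  qed
  assume z: "z \<in> L" "i * z = z * i"
  let ?y = "2 \<star> z - T z \<star> 1"
  have y: "?y \<in> L" "T ?y = 0" using z by (simp_all add: T_diff T_sm T_one)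
  have yi: "i * ?y = ?y * i" using z by (simp add: sm_simps algebra_simps)
  define k where "k = T (?y * i)"
  have "?y * i + ?y * i = k \<star> 1" using pure_polar[OF y(1) i(1) y(2) Ti] yi by (simp add: k_def)
  then have "?y * i * i + ?y * i * i = k \<star> i" by (metis distrib_right mult_1_left sm_simps(1))
  then have "- ?y + - ?y = k \<star> i" by (simp only: mult.assoc i(2) mult_minus_right mult_1_right)
  then have z4: "4 \<star> z = (2 * T z) \<star> 1 - k \<star> i" unfolding sm_numerals by (simp add: algebra_simps)
  have "T (k \<star> i) = 0" using i Ti by (simp add: T_sm)
  have Di: "D i = 1" using cayley[OF i(1)] Ti i(2) int_eq_iff[of "D i" 1] by (simp add: sm_simps)
  have "D (4 \<star> z) = D ((2 * T z) \<star> 1 + (- k) \<star> i)" using z4 by (simp add: sm_simps)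
  also have "\<dots> = 4 * (T z * T z) + k * k"
    using i Ti Di by (simp add: D_add D_int D_sm T_sm T_int sm_simps(1,2))
  finally have D4: "16 * D z = 4 * (T z * T z) + k * k" using z by (simp add: D_sm)
  then have "k * k = 2 * (8 * D z - 2 * (T z * T z))" by simp
  then have "even (k * k)" by (metis dvd_triv_left)
  then have "even k" by simp
  then obtain k' where k': "k = 2 * k'" by (auto elim: evenE)
  have "4 * D z = T z * T z + k' * k'" using D4 by (simp add: k')
  then have "even (T z) \<and> even k'" by (intro four_dvd_sum_squares) (metis dvd_triv_left)
  then obtain a b where ab: "T z = 2 * a" "k' = 2 * b" by (auto elim!: evenE)
  have "4 \<star> z = 4 \<star> (a \<star> 1 + (- b) \<star> i)" using z4 unfolding k' ab by (simp add: sm_simps)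
  then have "z = a \<star> 1 + (- b) \<star> i" by (rule sm_cancel) (use z i in auto)
  then show "\<exists>a b. z = a \<star> 1 + b \<star> i" by blast
qed

text \<open>The pure element \<open>1 + 2 \<star> w\<close> has square -3. The norm equation for
  \<open>12 \<star> z\<close> shows that \<open>k = 6 * b\<close> and that \<open>T z\<close> and
  \<open>b\<close> have the same parity; these are exactly the congruences placing \<open>z\<close>
  in the ring generated by \<open>w\<close>.\<close>

lemma
  assumes w: "w \<in> L" "w * w = - w - 1"
  shows trace_omega: "T w = - 1"
    and centralizer_omega: "z \<in> L \<Longrightarrow> w * z = z * w \<Longrightarrow> \<exists>a b. z = a \<star> 1 + b \<star> w"
proof -
  have nonint: "w \<noteq> n \<star> 1" for n
  proof
    assume "w = n \<star> 1"
    then have "(n * n) \<star> 1 = ((- n - 1) \<star> 1 :: 'a)" using w(2) by (simp add: sm_simps)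
    then have "n * n = - n - 1" unfolding int_eq_iff .
    then have "n * (n + 1) = - 1" by (simp add: algebra_simps)
    then have "odd (n * (n + 1))" by simp
    then show False by simp
  qed
  have "(T w + 1) \<star> w = (D w - 1) \<star> 1" using cayley[OF w(1)] w(2) by (simp add: sm_simps algebra_simps)
  then show Tw: "T w = - 1" using rational_in_L[OF w(1), of "T w + 1"] nonint by fastforce
  assume z: "z \<in> L" "w * z = z * w"
  let ?s = "1 + 2 \<star> w"
  have s: "?s \<in> L" "T ?s = 0" using w Tw by (simp_all add: T_add T_sm T_one)
  have ss: "?s * ?s = (- 3) \<star> 1"
    using w(2) by (simp add: sm_simps sm_numerals distrib_left distrib_right)
  let ?y = "2 \<star> z - T z \<star> 1"
  have y: "?y \<in> L" "T ?y = 0" using z by (simp_all add: T_diff T_sm T_one)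
  have ys: "?s * ?y = ?y * ?s" using z by (simp add: sm_simps algebra_simps)
  define k where "k = T (?y * ?s)"
  have "?y * ?s + ?y * ?s = k \<star> 1" using pure_polar[OF y(1) s(1) y(2) s(2)] ys by (simp add: k_def)
  then have "?y * ?s * ?s + ?y * ?s * ?s = k \<star> ?s" by (metis distrib_right mult_1_left sm_simps(1))
  then have "(- 6) \<star> ?y = k \<star> ?s"
    unfolding mult.assoc ss sm_simps(2) sm_simps(7)[symmetric] by simp
  then have z12: "12 \<star> z = (6 * T z) \<star> 1 + (- k) \<star> ?s"
    by (simp add: sm_simps algebra_simps)
  have Ds: "D ?s = 3"
    using cayley[OF s(1)] s(2) ss int_eq_iff[of "- D ?s" "- 3"] by (simp add: sm_simps(7,9,11))
  have "D (12 \<star> z) = 36 * (T z * T z) + 3 * (k * k)"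
    unfolding z12 using s Ds by (simp add: D_add D_int D_sm T_sm T_int sm_simps(1,2))
  then have D12: "48 * D z = 12 * (T z * T z) + k * k" using z by (simp add: D_sm)
  then have "k * k = 2 * (24 * D z - 6 * (T z * T z))" by simp
  then have "even (k * k)" by (metis dvd_triv_left)
  then have "even k" by simp
  then obtain k' where k': "k = 2 * k'" by (auto elim: evenE)
  have D3: "12 * D z = 3 * (T z * T z) + k' * k'" using D12 by (simp add: k')
  then have "k' * k' = 3 * (4 * D z - T z * T z)" by simp
  then have "3 dvd k' * k'" by (metis dvd_triv_left)
  then have "3 dvd k'" using prime_dvd_mult_iff[of "3::int" k' k'] by simp
  then obtain b where b: "k' = 3 * b" by (auto simp: dvd_def)
  have "4 * D z = T z * T z + 3 * (b * b)" using D3 by (simp add: b)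
  then have "T z * T z + 3 * (b * b) = 2 * (2 * D z)" by simp
  then have "even (T z * T z + 3 * (b * b))" by (metis dvd_triv_left)
  then have "even (T z - b)" by simp
  then obtain a where "T z - b = 2 * a" by (rule evenE)
  then have a: "T z = 2 * a + b" by simp
  have "12 \<star> z = 12 \<star> (a \<star> 1 + (- b) \<star> w)"
    using z12 unfolding k' b a by (simp add: sm_simps)
  then have "z = a \<star> 1 + (- b) \<star> w" by (rule sm_cancel) (use z w in auto)
  then show "\<exists>a b. z = a \<star> 1 + b \<star> w" by blast
qed
text \<open>The rotations form a group of odd order 3, so \<open>x\<close> may be replaced by its
  sum \<open>?z\<close> over them. This commutes with \<open>w\<close> and equals
  \<open>m \<star> 1 + b \<star> w\<close>. The reflection changes it by \<open>- b\<close> modulo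
  2, so invariance makes \<open>b\<close> even.\<close>

lemma zbasis_S3_2:
  assumes g: "invol g" and h: "invol h" and ne: "\<exists>y\<in>L. g y \<noteq> h y"
    and ghg: "\<And>y. y \<in> L \<Longrightarrow> g (h (g y)) = h (g (h y))"
    and F: "F \<subseteq> Fix 2 {g, h}" "1 \<in> F"
  shows "zbasis 2 F (NL 2) 1 (\<lambda>_. 1)"
proof (rule zbasis_one)
  have a: "aut g" "aut h" and gg: "\<And>x. x \<in> L \<Longrightarrow> g (g x) = x" and hh: "\<And>x. x \<in> L \<Longrightarrow> h (h x) = x"
    using g h by (auto simp: invol_def)
  note gL = autD(1)[OF a(1)] and hL = autD(1)[OF a(2)]
  obtain w where w: "w \<in> L" "w * w = - w - 1" "\<And>y. y \<in> L \<Longrightarrow> w * y = g (h y) * w" "g w = - 1 - w"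
    using order_3_element[OF g h ne ghg] by blast
  show "F \<subseteq> L" using F by (auto simp: Fix_def)
  fix x assume "x \<in> F"
  then have x: "x \<in> L" "g x - x \<in> NL 2" "h x - x \<in> NL 2" using F by (auto simp: Fix_def)
  let ?z = "x + g (h x) + g (h (g (h x)))"
  have zL: "?z \<in> L" using x by (simp add: gL hL)
  have r: "g (h x) - x \<in> NL 2" using Fix_comp[OF a(1) x(1) hL[OF x(1)] x(2,3)] .
  have "h (g (h x)) - x \<in> NL 2" using Fix_comp[OF a(2) x(1) _ x(3) r] x(1) by (simp add: gL hL)
  then have rr: "g (h (g (h x))) - x \<in> NL 2" using Fix_comp[OF a(1) x(1) _ x(2)] x(1) by (simp add: gL hL)
  have z3: "?z - 3 \<star> x \<in> NL 2"
    using NL_closed(4)[OF r rr] by (simp add: sm_numerals algebra_simps)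
  have "g (h ?z) = ?z"
    using x(1) ghg[of "h (g (h x))"]
    by (simp add: autD(2)[OF a(1)] autD(2)[OF a(2)] gL hL gg hh)
  then have "w * ?z = ?z * w" using w(3)[OF zL] by simp
  then obtain m b where z: "?z = m \<star> 1 + b \<star> w" using centralizer_omega[OF w(1,2) zL] by blast
  have "g ?z - ?z \<in> NL 2"
  proof -
    have "g ?z - ?z = g (?z - 3 \<star> x) - (?z - 3 \<star> x) + 3 \<star> (g x - x)"
      using x(1) zL by (simp add: autD(8,9)[OF a(1)] sm_simps)
    then show ?thesis using NL_aut[OF a(1) z3] z3 x(2) NL_closed(2,4,5) by metis
  qed
  moreover have "g ?z - ?z = - (b \<star> 1) - 2 \<star> (b \<star> w)"
    unfolding z using w(1,4) by (simp add: autD(2,4,9)[OF a(1)] sm_simps(4-9) sm_numerals)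
  ultimately have "- (b \<star> 1) \<in> NL 2" using NL_minus_iff[of "- (b \<star> 1)" _ 2] NL_closed(4)[OF _ NL_I[of "b \<star> w" 2]] w(1)
    by (metis L_closed(7) diff_add_cancel)
  then have "b \<star> 1 \<in> NL 2" using NL_closed(3) by fastforce
  then have "even b" unfolding int_in_NL_iff .
  then have "?z - m \<star> 1 \<in> NL 2" unfolding z using NL_dvd[of 2 b w] w(1) by simp
  then have "3 \<star> x - m \<star> 1 \<in> NL 2" using NL_trans[OF NL_sym[OF z3]] by blast
  moreover have "coprime 3 (2::int)" by simp
  ultimately show "\<exists>c n. coprime c 2 \<and> c \<star> x - n \<star> 1 \<in> NL 2" by blast
qed (use F in auto)

section \<open>The orthogonal complement of a quadratic subring\<close>

definition anti :: "'a \<Rightarrow> 'a set" where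
  "anti s = {w \<in> L. s * w = - (w * s)}"

text \<open>A commutator \<open>v = s * y - y * s\<close> anticommutes with \<open>s\<close> because
  \<open>s * s\<close> is central, and \<open>v, s * v\<close> is an orthogonal family. Elements of
  \<open>anti s\<close> are automatically orthogonal to 1 and \<open>s\<close>, so two pairings
  suffice.\<close>

lemma anti_zbasis:
  assumes s: "s \<in> L" "T s = 0" "\<exists>y\<in>L. s * y \<noteq> y * s"
  shows "add_subgroup (anti s)" "w \<in> anti s \<Longrightarrow> s * w \<in> anti s" "\<exists>e. zbasis 0 (anti s) {0} 2 e"
proof -
  show sub: "add_subgroup (anti s)" by (auto simp: add_subgroup_def anti_def algebra_simps)
  have mul: "s * w \<in> anti s" if "w \<in> anti s" for w
  proof -
    have sw: "s * w = - (w * s)" "w \<in> L" using that by (auto simp: anti_def)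
    have "s * (s * w) = s * - (w * s)" by (simp only: sw(1))
    also have "\<dots> = - (s * w * s)" by (simp add: mult.assoc)
    finally show ?thesis using s(1) sw(2) by (simp add: anti_def)
  qed
  then show "w \<in> anti s \<Longrightarrow> s * w \<in> anti s" .
  have s0: "s \<noteq> 0" using s(3) by auto
  have ss: "s * s = - (D s \<star> 1)" using pure_sq s by blast
  have Ds: "D s \<noteq> 0" using s0 s(1) D_eq_0 by blast
  have T0: "T w = 0" if "w \<in> anti s" for w
  proof -
    have w: "w \<in> L" "s * w = - (w * s)" using that by (auto simp: anti_def)
    have "T (s * (s * w)) = - T (s * (w * s))" unfolding w(2) using s(1) w(1) by (simp add: T_neg)
    also have "T (s * (w * s)) = T (w * s * s)" using T_comm[of s "w * s"] s(1) w(1) by simp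
    finally have "T ((s * s) * w) = - T (w * (s * s))" by (simp add: mult.assoc)
    then have "D s * T w = 0" unfolding ss using w(1) by (simp add: sm_simps T_neg T_sm)
    then show ?thesis using Ds by simp
  qed
  have Ts: "T (w * s) = 0" if "w \<in> anti s" for w
    using that s(1) T_comm[of w s] by (simp add: anti_def T_neg)
  obtain y where y: "y \<in> L" "s * y \<noteq> y * s" using s(3) by blast
  define v where "v = s * y - y * s"
  have v: "v \<in> anti s" "v \<noteq> 0"
  proof -
    have "s * s * y = y * (s * s)" unfolding ss by (simp add: sm_simps)
    then show "v \<in> anti s" using s(1) y(1) by (simp add: anti_def v_def left_diff_distrib right_diff_distrib mult.assoc)
  qed (use y in \<open>simp add: v_def\<close>)
  have vL: "v \<in> L" "s * v = - (v * s)" using v(1) by (auto simp: anti_def)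
  have vv: "v * v = - (D v \<star> 1)" using pure_sq[OF vL(1) T0[OF v(1)]] .
  have sv: "s * v \<in> anti s" "s * v \<noteq> 0" using mul v mult_eq_0 s0 s(1) vL(1) by blast+
  have o: "T (s * v * v) = 0" "T (v * (s * v)) = 0"
    using s(1,2) vL(1) T_comm[of v "s * v"] by (simp_all add: mult.assoc vv sm_simps T_neg T_sm)
  define b where "b i = (if i = 0 then v else s * v)" for i :: nat
  show "\<exists>e. zbasis 0 (anti s) {0} 2 e"
  proof (rule orthogonal_zbasis[OF sub, of 2 b])
    show "anti s \<subseteq> L" by (auto simp: anti_def)
    show "b i \<in> anti s" for i using v sv by (simp add: b_def)
    show "T (b i * b i) \<noteq> 0" for i
      using pure_sq_trace[of v] pure_sq_trace[of "s * v"] T0 v sv vL(1) s(1) by (simp add: b_def)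
    show "T (b i * b j) = 0" if "i < 2" "j < 2" "i \<noteq> j" for i j using that o by (auto simp: b_def)
    fix x assume x: "x \<in> anti s" "\<And>i. i < 2 \<Longrightarrow> T (x * b i) = 0"
    have "x \<in> L" using x(1) by (simp add: anti_def)
    then show "x = 0"
      using trace_form_nondegenerate[OF s(1) s0 s(2) vL(1) v(2) T0[OF v(1)] T0[OF sv(1)], of x]
        T0[OF x(1)] Ts[OF x(1)] x(2)[of 0] x(2)[of 1] by (simp add: b_def)
  qed
qed

text \<open>\<open>anti s\<close> has rank 2 over \<open>\<int>\<close>, and \<open>\<pi>\<close> is a generator of the prime above \<open>p\<close> in \<open>\<int>[s]\<close>, which is
  ramified; so \<open>anti s / \<pi> (anti s)\<close> has order \<open>p\<close>.\<close>

lemma anti_cyclic: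
  fixes m p r :: int
  assumes s: "s \<in> L" "s * s = - (m \<star> 1)" "T s = 0" "\<exists>y\<in>L. s * y \<noteq> y * s"
    and p: "Factorial_Ring.prime p" and mp: "\<And>a. \<not> p * p dvd a * a + m"
    and pi: "\<pi> = r \<star> 1 + s" "\<And>w. w \<in> anti s \<Longrightarrow> \<exists>w'\<in>anti s. p \<star> w = \<pi> * w'"
  shows "\<exists>j\<in>anti s. \<forall>w\<in>anti s. \<exists>q. \<exists>w'\<in>anti s. w = q \<star> j + \<pi> * w'"
proof -
  note M = anti_zbasis[OF s(1,3,4)]
  note Mc = add_subgroupD[OF M(1)] sm_in[OF M(1)]
  obtain e where e: "zbasis 0 (anti s) {0} 2 e" using M(3) by blast
  define f where "f = e 0"
  define f' where "f' = e 1"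
  have sum2: "(\<Sum>i<2. of_int (n i) * e i) = n 0 \<star> f + n 1 \<star> f'" for n
    by (simp add: numeral_2_eq_2 f_def f'_def sm_def)
  have fM: "f \<in> anti s" "f' \<in> anti s" using zbasisD(1)[OF e] by (auto simp: f_def f'_def)
  have span: "\<exists>x y. w = x \<star> f + y \<star> f'" if "w \<in> anti s" for w
    using zbasisD(2)[OF e that] unfolding sum2 by auto
  have ind: "x = 0" if "x \<star> f + y \<star> f' = 0" for x y
    using zbasisD(3)[OF e, of "\<lambda>i. if i = 0 then x else y" 0] that unfolding sum2 by simp
  obtain a c where sf: "s * f = a \<star> f + c \<star> f'" using span[OF M(2)[OF fM(1)]] by blast
  obtain b d where sf': "s * f' = b \<star> f + d \<star> f'" using span[OF M(2)[OF fM(2)]] by blast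
  have "s * (s * f) = (a * a + c * b) \<star> f + (a * c + c * d) \<star> f'"
    by (simp add: sf sf' distrib_left sm_simps)
  moreover have "s * (s * f) = - (m \<star> f)" by (simp add: mult.assoc[symmetric] s(2) sm_simps)
  ultimately have "(a * a + c * b) \<star> f + (a * c + c * d) \<star> f' + m \<star> f = 0"
    by (metis add.left_inverse)
  then have "(a * a + c * b + m) \<star> f + (a * c + c * d) \<star> f' = 0"
    by (simp only: sm_simps(7) ac_simps)
  then have abc: "a * a + c * b + m = 0" by (rule ind)
  have pc: "\<pi> * w = r \<star> w + s * w" for w by (simp add: pi(1) distrib_right sm_simps)
  \<comment> \<open>Modulo \<open>\<pi>\<close> times \<open>anti s\<close>, the element
    \<open>p \<star> u'\<close> vanishes and \<open>l \<star> u'\<close> is a multiple of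
    \<open>u\<close>. By Bezout \<open>u'\<close> is a multiple of \<open>u\<close> as well, so
    \<open>u\<close> generates.\<close>
  have key: "\<exists>j\<in>anti s. \<forall>w\<in>anti s. \<exists>q. \<exists>w'\<in>anti s. w = q \<star> j + \<pi> * w'"
    if u: "u \<in> anti s" and u': "u' \<in> anti s" and su: "s * u = k \<star> u + l \<star> u'" and l: "\<not> p dvd l"
      and sp: "\<And>w. w \<in> anti s \<Longrightarrow> \<exists>x y. w = x \<star> u + y \<star> u'" for u u' k l
  proof -
    have "coprime p l" using l p by (simp add: prime_imp_coprime)
    then obtain x y where xy: "x * p + y * l = 1" using bezout_int coprime_iff_gcd_eq_1 by metis
    obtain t where t: "t \<in> anti s" "p \<star> u' = \<pi> * t" using pi(2)[OF u'] by blast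
    have lu: "l \<star> u' = \<pi> * u - (r + k) \<star> u" unfolding pc su by (simp add: sm_simps)
    have "u' = (x * p + y * l) \<star> u'" unfolding xy by (simp add: sm_simps)
    also have "\<dots> = x \<star> (p \<star> u') + y \<star> (l \<star> u')" by (simp add: sm_simps)
    also have "\<dots> = (- (y * (r + k))) \<star> u + \<pi> * (x \<star> t + y \<star> u)"
      unfolding lu t(2) by (simp add: sm_simps distrib_left)
    finally have "u' = (- (y * (r + k))) \<star> u + \<pi> * (x \<star> t + y \<star> u)" .
    moreover have "x \<star> t + y \<star> u \<in> anti s" using Mc(4,5) t(1) u by blast
    ultimately obtain n t' where t': "t' \<in> anti s" "u' = n \<star> u + \<pi> * t'" by blast
    have "\<exists>q. \<exists>w'\<in>anti s. w = q \<star> u + \<pi> * w'" if "w \<in> anti s" for w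
    proof -
      from sp[OF that] obtain x' y' where "w = x' \<star> u + y' \<star> u'" by blast
      then have "w = (x' + y' * n) \<star> u + \<pi> * (y' \<star> t')"
        unfolding t'(2) by (simp add: sm_simps add.assoc)
      then show ?thesis using Mc(5)[OF t'(1)] by blast
    qed
    then show ?thesis using u by blast
  qed
  \<comment> \<open>Here \<open>b\<close> and \<open>c\<close> are the off-diagonal entries of the
    matrix of \<open>s\<close> in the basis \<open>f, f'\<close>. If \<open>p\<close> divided both,
    \<open>abc\<close> would make \<open>p * p\<close> divide \<open>a * a + m\<close>. So one of
    the two basis elements can serve as \<open>u\<close>.\<close>
  have "\<not> (p dvd b \<and> p dvd c)"
  proof
    assume "p dvd b \<and> p dvd c"
    then have "p * p dvd c * b" by (intro mult_dvd_mono) auto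
    moreover have "a * a + m = - (c * b)" using abc by simp
    ultimately have "p * p dvd a * a + m" by simp
    then show False using mp by blast
  qed
  then consider "\<not> p dvd c" | "\<not> p dvd b" by blast
  then show ?thesis
  proof cases
    case 1
    then show ?thesis using key[OF fM sf] span by blast
  next
    case 2
    have "\<exists>x y. w = x \<star> f' + y \<star> f" if "w \<in> anti s" for w using span[OF that] by (metis add.commute)
    moreover have "s * f' = d \<star> f' + b \<star> f" using sf' by (simp add: add.commute)
    ultimately show ?thesis using key[OF fM(2,1)] 2 by blast
  qed
qed

text \<open>With \<open>s = 1 + 2\<omega>\<close>, the fixed points of the rotation are spanned modulo 3 by \<open>1, s, sj\<close>, and the
  involution negates \<open>s\<close>.\<close>

lemma zbasis_S3_3:
  assumes g: "invol g" and h: "invol h" and ne: "\<exists>y\<in>L. g y \<noteq> h y"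
    and ghg: "\<And>y. y \<in> L \<Longrightarrow> g (h (g y)) = h (g (h y))"
  shows "\<exists>k e. k \<in> {1, 2} \<and> zbasis 3 (Fix 3 {g, h}) (NL 3) k e"
proof -
  have a: "aut g" "aut h" and gg: "\<And>x. x \<in> L \<Longrightarrow> g (g x) = x"
    using g h by (auto simp: invol_def)
  note gL = autD(1)[OF a(1)] and hL = autD(1)[OF a(2)]
  obtain w where w: "w \<in> L" "w * w = - w - 1" "\<And>y. y \<in> L \<Longrightarrow> w * y = g (h y) * w" "g w = - 1 - w"
    using order_3_element[OF g h ne ghg] by blast
  define s where "s = 1 + 2 \<star> w"
  have s: "s \<in> L" "T s = 0" using w(1) trace_omega[OF w(1,2)] by (simp_all add: s_def T_add T_sm T_one)
  have ss: "s * s = - (3 \<star> 1)"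
    using w(2) by (simp add: s_def sm_numerals distrib_left distrib_right)
  have gs: "g s = - s" using w(1,4) by (simp add: s_def autD(2,4,9)[OF a(1)] sm_numerals)
  have comm: "s * y - y * s = 2 \<star> (w * y - y * w)" for y
    by (simp add: s_def sm_numerals algebra_simps)
  have nc: "\<exists>y\<in>L. s * y \<noteq> y * s"
  proof (rule ccontr)
    assume "\<not> ?thesis"
    then have *: "w * y = y * w" if "y \<in> L" for y
      using comm[of y] sm_eq_0_iff[of "w * y - y * w" 2] w(1) that by simp
    have w0: "w \<noteq> 0" using w(2) T_0 T_one trace_omega[OF w(1,2)] by auto
    have "g (h y) = y" if y: "y \<in> L" for y
      using *[OF y] w(3)[OF y] right_cancel[OF _ w0 w(1), of "g (h y)" y] y by (simp add: gL hL)
    then have "g y = h y" if "y \<in> L" for y using that gg[of "h y"] by (simp add: hL)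
    then show False using ne by blast
  qed
  have mod9: "\<not> 3 * 3 dvd x * x + (3::int)" for x
  proof
    assume d: "3 * 3 dvd x * x + (3::int)"
    then obtain q where q: "x * x + 3 = 9 * q" by (auto simp: dvd_def)
    then have "x * x = 3 * (3 * q - 1)" by simp
    then have "3 dvd x * x" by (metis dvd_triv_left)
    then have "3 dvd x" using prime_dvd_mult_iff[of "3::int" x x] by simp
    then obtain y where "x = 3 * y" by (auto simp: dvd_def)
    then have "9 * (y * y) + 3 = 9 * q" using q by simp
    then have "3 = 9 * (q - y * y)" by simp
    then show False by presburger
  qed
  have "\<exists>j\<in>anti s. \<forall>v\<in>anti s. \<exists>q. \<exists>v'\<in>anti s. v = q \<star> j + s * v'"
  proof (rule anti_cyclic[OF s(1) ss s(2) nc _ mod9])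
    show "s = 0 \<star> 1 + s" by (simp add: sm_simps)
    fix v assume v: "v \<in> anti s"
    have "3 \<star> v = s * (- (s * v))" by (simp add: mult.assoc[symmetric] ss sm_simps)
    moreover have "- (s * v) \<in> anti s"
      using anti_zbasis(2)[OF s nc v] add_subgroupD(3)[OF anti_zbasis(1)[OF s nc]] by blast
    ultimately show "\<exists>v'\<in>anti s. 3 \<star> v = s * v'" by blast
  qed simp
  then obtain j where j: "j \<in> anti s" "\<And>v. v \<in> anti s \<Longrightarrow> \<exists>q. \<exists>v'\<in>anti s. v = q \<star> j + s * v'" by blast
  have jL: "j \<in> L" using j(1) by (simp add: anti_def)
  let ?F = "Fix 3 {g, h}" and ?q = "\<lambda>x. (+) x ` NL 3"
  have rep: "\<exists>m q. x - (m \<star> 1 + q \<star> (s * j)) \<in> NL 3" if "x \<in> ?F" for x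
  proof -
    have x: "x \<in> L" "g x - x \<in> NL 3" "h x - x \<in> NL 3" using that by (auto simp: Fix_def)
    have "g (h x) - x \<in> NL 3" using Fix_comp[OF a(1) x(1) hL[OF x(1)] x(2,3)] .
    then have "(g (h x) - x) * w \<in> NL 3" using NL_mult(1) w(1) by blast
    then have "w * x - x * w \<in> NL 3" using w(3)[OF x(1)] by (simp add: left_diff_distrib)
    then have "s * x - x * s \<in> NL 3" unfolding comm by (rule NL_closed(5))
    then obtain v where v: "v \<in> L" "s * x - x * s = 3 \<star> v" by (auto simp: NL_def)
    have "3 \<star> (s * v + v * s) = s * (3 \<star> v) + (3 \<star> v) * s" by (simp add: sm_simps)
    also have "\<dots> = (s * s) * x - x * (s * s)"
      unfolding v(2)[symmetric] by (simp add: left_diff_distrib right_diff_distrib mult.assoc)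
    also have "\<dots> = 0" unfolding ss by (simp add: sm_simps)
    finally have "s * v + v * s = 0" using sm_eq_0_iff[of "s * v + v * s" 3] v(1) s(1) by simp
    then have sv: "s * v = - (v * s)" by (simp add: eq_neg_iff_add_eq_0)
    \<comment> \<open>The commutator of \<open>s\<close> with \<open>s * v\<close> is
      \<open>2 \<star> (s * s * v)\<close>, that is -6 times \<open>v\<close>, and cancels that of
      \<open>s\<close> with \<open>2 \<star> x\<close>. So \<open>?z\<close> commutes with
      \<open>s\<close> exactly, not only modulo 3.\<close>
    let ?z = "2 \<star> x + s * v"
    have zL: "?z \<in> L" using x(1) v(1) s(1) by simp
    have "s * ?z - ?z * s = 2 \<star> (s * x - x * s) + (s * s * v - s * (v * s))"
      by (simp add: sm_simps algebra_simps)
    also have "v * s = - (s * v)" unfolding sv by simp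
    also have "2 \<star> (s * x - x * s) + (s * s * v - s * - (s * v)) = 0"
      unfolding v(2) by (simp add: mult.assoc[symmetric] ss sm_simps) (simp add: sm_numerals)
    finally have "2 \<star> (w * ?z - ?z * w) = 0" unfolding comm .
    then have "w * ?z = ?z * w" using sm_eq_0_iff[of "w * ?z - ?z * w" 2] zL w(1) by simp
    then obtain m b where z: "?z = m \<star> 1 + b \<star> w" using centralizer_omega[OF w(1,2) zL] by blast
    have gz: "?z + g ?z = (2 * m - b) \<star> 1"
      unfolding z using w(1,4) by (simp add: autD(2,4,9)[OF a(1)] sm_simps sm_numerals)
    have gz': "g ?z = 2 \<star> g x - s * g v"
      using x(1) v(1) s(1) by (simp add: autD(2,3,9)[OF a(1)] gs)
    let ?v = "g v - v"
    have vM: "?v \<in> anti s"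
    proof -
      have "g (s * v) = g (- (v * s))" using sv by simp
      then have "- (s * g v) = g v * s" using v(1) s(1) by (simp add: autD(3,7)[OF a(1)] gs)
      then have "s * g v = - (g v * s)" by (metis minus_minus)
      then show ?thesis using v(1) sv gL by (simp add: anti_def algebra_simps)
    qed
    obtain q v' where q: "v' \<in> anti s" "?v = q \<star> j + s * v'" using j(2)[OF vM] by blast
    have v'L: "v' \<in> L" using q(1) by (simp add: anti_def)
    \<comment> \<open>Modulo 3 the left side is \<open>4 \<star> x\<close>, hence \<open>x\<close>.
      On the right, \<open>?v\<close> is \<open>q \<star> j + s * v'\<close>, and
      \<open>s * s = -3\<close> removes the second summand.\<close>
    have e: "2 \<star> x + 2 \<star> g x = (2 * m - b) \<star> 1 + s * ?v"
      using gz unfolding gz' by (simp add: algebra_simps)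
    define K P where "K = (2 * m - b) \<star> (1::'a)" and "P = q \<star> (s * j)"
    have "s * ?v = P - 3 \<star> v'"
      unfolding q(2) P_def by (simp add: distrib_left sm_simps mult.assoc[symmetric] ss)
    then have "K = 2 \<star> x + 2 \<star> g x - (P - 3 \<star> v')" using e by (simp add: K_def)
    then have "x - (K + P) = 3 \<star> (- x - v') - 2 \<star> (g x - x)"
      by (simp add: sm_numerals algebra_simps)
    moreover have "3 \<star> (- x - v') - 2 \<star> (g x - x) \<in> NL 3"
      using NL_closed(2)[OF NL_I NL_closed(5)[OF x(2)]] x(1) v'L by blast
    ultimately show ?thesis unfolding K_def P_def by metis
  qed
  have F: "add_subgroup ?F" "1 \<in> ?F" using Fix_subgroup[of "{g, h}"] one_in_Fix[of "{g, h}"] a by auto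
  have FL: "?F \<subseteq> L" by (auto simp: Fix_def)
  have sub: "quo (NL 3) ?F \<subseteq> (\<lambda>(m, q). ?q (m \<star> 1 + q \<star> (s * j))) ` ({0..<3} \<times> {0..<3})"
  proof
    fix Y assume "Y \<in> quo (NL 3) ?F"
    then obtain x where x: "x \<in> ?F" "Y = ?q x" by (auto simp: quo_def)
    obtain m q where m: "x - (m \<star> 1 + q \<star> (s * j)) \<in> NL 3" using rep[OF x(1)] by blast
    have "(m \<star> 1 + q \<star> (s * j)) - ((m mod 3) \<star> 1 + (q mod 3) \<star> (s * j)) =
        (m - m mod 3) \<star> 1 + (q - q mod 3) \<star> (s * j)"
      by (simp only: sm_simps(8)) simp
    also have "\<dots> \<in> NL 3" using s(1) jL by (intro NL_closed(4) NL_dvd) auto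
    finally have "?q x = ?q ((m mod 3) \<star> 1 + (q mod 3) \<star> (s * j))"
      using NL_trans[OF m] coset_eq_iff[OF NL_subgroup] by blast
    then show "Y \<in> (\<lambda>(m, q). ?q (m \<star> 1 + q \<star> (s * j))) ` ({0..<3} \<times> {0..<3})"
      unfolding x(2) by (intro image_eqI[of _ _ "(m mod 3, q mod 3)"]) auto
  qed
  have fin: "finite (quo (NL 3) ?F)" by (rule finite_subset[OF sub]) simp
  have "card (quo (NL 3) ?F) \<le> card ((\<lambda>(m, q). ?q (m \<star> 1 + q \<star> (s * j))) ` ({0..<3} \<times> {0..<3::int}))"
    by (rule card_mono[OF _ sub]) simp
  also have "\<dots> \<le> card ({0..<3::int} \<times> {0..<3::int})" by (rule card_image_le) simp
  finally have c9: "card (quo (NL 3) ?F) \<le> 9" by simp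
  have *: "of_int 3 * x \<in> NL 3" if "x \<in> ?F" for x using NL_of_int[of x 3] that FL by blast
  obtain k e where e: "zbasis 3 ?F (NL 3) k e"
    using zbasis_exists_prime[OF NL_subgroup F(1) * _ fin] by auto
  have "card (quo (NL 3) ?F) = 3 ^ k" using zbasis_card(2)[OF NL_subgroup F(1) * _ e] by simp
  then have "(3::nat) ^ k \<le> 3 ^ 2" using c9 by simp
  then have "k \<le> 2" using power_le_imp_le_exp[of 3 k 2] by simp
  moreover have "k \<noteq> 0"
  proof
    assume "k = 0"
    then have "1 \<in> NL 3" using zbasisD(2)[OF e F(2)] by simp
    then show False using int_in_NL_iff[of 1 3] by (simp add: sm_simps)
  qed
  ultimately have "k \<in> {1, 2}" by auto
  then show ?thesis using e by blast
qed

text \<open>With \<open>\<pi> = 1 + i\<close>, the fixed points of the rotation are spanned modulo 2 by \<open>1, i, (1 - i)j\<close>, and an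
  element of odd trace shows that \<open>(1 - i)j\<close> is congruent to \<open>1 + i\<close>.\<close>

lemma zbasis_D4_2:
  assumes g: "invol g" and h: "invol h" and ne: "\<exists>y\<in>L. g (h y) \<noteq> h (g y)"
    and ghgh: "\<And>y. y \<in> L \<Longrightarrow> g (h (g (h y))) = h (g (h (g y)))"
  shows "\<exists>e. zbasis 2 (Fix 2 {g, h}) (NL 2) 2 e"
proof -
  have a: "aut g" "aut h" and gg: "\<And>x. x \<in> L \<Longrightarrow> g (g x) = x" and hh: "\<And>x. x \<in> L \<Longrightarrow> h (h x) = x"
    using g h by (auto simp: invol_def)
  note gL = autD(1)[OF a(1)] and hL = autD(1)[OF a(2)]
  obtain i where i: "i \<in> L" "i * i = - 1" "\<And>y. y \<in> L \<Longrightarrow> (1 + i) * y = g (h y) * (1 + i)" "g i = - i"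
    using order_4_element[OF g h ne ghgh] by blast
  have Ti: "T i = 0" using trace_i[OF i(1,2)] .
  have ii: "i * (i * x) = - x" for x by (simp add: mult.assoc[symmetric] i(2))
  define \<pi> where "\<pi> = 1 + i"
  have pi0: "\<pi> \<noteq> 0" "\<pi> \<in> L"
    using one_i_independent[OF i(1,2), of 1 1] i(1) by (auto simp: \<pi>_def sm_simps)
  have pib: "\<pi> * ((1 - i) * x) = 2 \<star> x" "(1 - i) * (\<pi> * x) = 2 \<star> x" for x
    by (simp_all add: \<pi>_def sm_numerals algebra_simps ii)
  have nc: "\<exists>y\<in>L. i * y \<noteq> y * i"
  proof (rule ccontr)
    assume "\<not> ?thesis"
    then have "g (h y) = y" if y: "y \<in> L" for y
      using i(3)[OF y] y right_cancel[OF _ pi0, of "g (h y)" y] by (auto simp: gL hL \<pi>_def algebra_simps)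
    then have "g (h y) = h (g y)" if "y \<in> L" for y using that by (metis gL gg hL hh)
    then show False using ne by blast
  qed
  note M = anti_zbasis[OF i(1) Ti nc]
  note Mc = add_subgroupD[OF M(1)] sm_in[OF M(1)]
  have anL: "x \<in> L" if "x \<in> anti i" for x using that by (simp add: anti_def)
  have bM: "(1 - i) * x \<in> anti i" "\<pi> * x \<in> anti i" if "x \<in> anti i" for x
    using Mc(2)[OF that M(2)[OF that]] Mc(4)[OF that M(2)[OF that]] by (simp_all add: \<pi>_def left_diff_distrib distrib_right)
  have mod4: "\<not> 2 * 2 dvd x * x + (1::int)" for x
    using four_dvd_sum_squares[of x 1] by auto
  have "\<exists>j\<in>anti i. \<forall>v\<in>anti i. \<exists>q. \<exists>v'\<in>anti i. v = q \<star> j + \<pi> * v'"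
  proof (rule anti_cyclic[OF i(1) _ Ti nc _ mod4])
    show "\<pi> = 1 \<star> 1 + i" by (simp add: sm_simps \<pi>_def)
    show "i * i = - (1 \<star> 1)" by (simp add: sm_simps i(2))
    show "\<exists>v'\<in>anti i. 2 \<star> v = \<pi> * v'" if "v \<in> anti i" for v using pib(1) bM(1)[OF that] by metis
  qed simp
  then obtain j where j: "j \<in> anti i" "\<And>v. v \<in> anti i \<Longrightarrow> \<exists>q. \<exists>v'\<in>anti i. v = q \<star> j + \<pi> * v'" by blast
  have bq: "(1 - i) * (q \<star> j + \<pi> * v) - q \<star> ((1 - i) * j) \<in> NL 2" if "v \<in> L" for q v
    using NL_I[OF that, of 2] by (simp add: distrib_left pib(2) sm_simps(2))
  have ind: "even k \<and> even l" if "k \<star> 1 + l \<star> i \<in> NL 2" for k l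
  proof -
    from that obtain v where v: "v \<in> L" "k \<star> 1 + l \<star> i = 2 \<star> v" by (auto simp: NL_def)
    have "2 \<star> (i * v) = i * (k \<star> 1 + l \<star> i)" unfolding v(2) by (simp only: sm_simps(2))
    also have "\<dots> = (k \<star> 1 + l \<star> i) * i" by (simp add: distrib_left distrib_right sm_simps(1,2))
    also have "\<dots> = 2 \<star> (v * i)" unfolding v(2) by (simp only: sm_simps(1))
    finally have "i * v = v * i" by (rule sm_cancel) (use v i in auto)
    then obtain k' l' where "v = k' \<star> 1 + l' \<star> i" using centralizer_i[OF i(1,2) v(1)] by blast
    then have "k \<star> 1 + l \<star> i = (2 * k') \<star> 1 + (2 * l') \<star> i" using v(2) by (simp only: sm_simps(3,4))
    then have "(k - 2 * k') \<star> 1 + (l - 2 * l') \<star> i = 0"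
      by (simp only: sm_simps(8) add_diff_add[symmetric]) simp
    then have "k - 2 * k' = 0 \<and> l - 2 * l' = 0" by (rule one_i_independent[OF i(1,2)])
    then have "k = 2 * k'" "l = 2 * l'" by auto
    then show ?thesis by simp
  qed
  have "\<exists>m\<in>anti i. (1 - i) * m - \<pi> \<in> NL 2"
  proof -
    obtain x where x: "x \<in> L" "odd (T x)" using odd_trace_ex by blast
    define A where "A = T x"
    have oA: "odd A" using x(2) by (simp add: A_def)
    let ?z = "x - i * x * i" and ?m = "x + i * x * i"
    have mM: "?m \<in> anti i"
      using x(1) i(1) by (simp add: anti_def distrib_left distrib_right mult.assoc ii i(2))
    have zL: "?z \<in> L" using x(1) i(1) by simp
    have "i * ?z = ?z * i" by (simp add: left_diff_distrib right_diff_distrib mult.assoc ii i(2))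
    then obtain A' b where z: "?z = A' \<star> 1 + b \<star> i" using centralizer_i[OF i(1,2) zL] by blast
    have "T (i * x * i) = T (i * (i * x))" using T_comm[of "i * x" i] x(1) i(1) by simp
    then have "T ?z = 2 * A" using x(1) i(1) by (simp add: ii T_diff T_neg A_def)
    moreover have "T ?z = 2 * A'" unfolding z using i(1) Ti by (simp add: T_add T_int T_sm)
    ultimately have z: "?z = A \<star> 1 + b \<star> i" using z by simp
    have x2: "2 \<star> x = A \<star> 1 + b \<star> i + ?m" unfolding z[symmetric] by (simp add: sm_numerals)
    have pix: "2 \<star> (\<pi> * x) = (A - b) \<star> 1 + (A + b) \<star> i + \<pi> * ?m"
    proof -
      have "2 \<star> (\<pi> * x) = \<pi> * (A \<star> 1 + b \<star> i + ?m)" unfolding x2[symmetric] by (simp only: sm_simps(2))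
      also have "\<pi> * (A \<star> 1 + b \<star> i + ?m) = \<pi> * (A \<star> 1 + b \<star> i) + \<pi> * ?m" by (rule distrib_left)
      also have "\<pi> * (A \<star> 1 + b \<star> i) = (A - b) \<star> 1 + (A + b) \<star> i"
        by (simp add: \<pi>_def distrib_left distrib_right sm_simps i(2))
      finally show ?thesis .
    qed
    show ?thesis
    \<comment> \<open>If \<open>b\<close> is even, \<open>pix\<close> shows that
      \<open>\<pi> * ?m\<close> is congruent to \<open>\<pi>\<close>, and \<open>1 - i\<close> is
      congruent to \<open>\<pi>\<close>, so \<open>?m\<close> serves. If \<open>b\<close> is odd,
      \<open>\<pi> * ?m\<close> is divisible by 2, so \<open>?m\<close> is \<open>1 - i\<close>
      times some \<open>?m'\<close>, and \<open>x2\<close> shows that \<open>?m'\<close>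
      serves.\<close>
    proof (cases "even b")
      case True
      have "(1 - i) * ?m - \<pi> = 2 \<star> (\<pi> * x - i * ?m) - ((A - b + 1) \<star> 1 + (A + b + 1) \<star> i)"
      proof -
        have "2 \<star> (\<pi> * x - i * ?m) = 2 \<star> (\<pi> * x) - i * ?m - i * ?m"
          by (simp add: sm_simps(5)) (simp add: sm_numerals(1))
        moreover have "\<pi> * ?m = ?m + i * ?m" "(1 - i) * ?m = ?m - i * ?m"
          by (simp_all only: \<pi>_def distrib_right left_diff_distrib mult_1_left)
        moreover have "(A - b + 1) \<star> 1 = (A - b) \<star> (1::'a) + 1" "(A + b + 1) \<star> i = (A + b) \<star> i + i"
          by (simp_all only: sm_simps(7)[of _ 1] sm_simps(10))
        moreover have "p - q - (1 + r) = U - q - q - (V + 1 + (W + r))"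
          if "U = V + W + (p + q)" for U V W p q r :: 'a
          using that by (simp add: algebra_simps)
        ultimately show ?thesis using pix
          by (simp only: \<pi>_def[symmetric] mult_1_left) (simp only: \<pi>_def)
      qed
      also have "\<dots> \<in> NL 2"
        using True oA x(1) i(1) pi0(2) by (intro NL_closed(2,4) NL_I NL_dvd) auto
      finally show ?thesis using mM by blast
    next
      case False
      then have "even (A - b)" "even (A + b)" using oA by auto
      then obtain c d where cd: "A - b = 2 * c" "A + b = 2 * d" by (metis dvd_def)
      let ?m' = "\<pi> * x - (c \<star> 1 + d \<star> i)"
      have pm: "\<pi> * ?m = 2 \<star> ?m'" using pix unfolding cd by (simp add: sm_simps)
      have m'L: "?m' \<in> L" using x(1) i(1) pi0(2) by simp
      have "2 \<star> (i * ?m') = i * (\<pi> * ?m)" unfolding pm by (simp only: sm_simps(2))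
      also have "\<dots> = - (\<pi> * ?m * i)" using bM(2)[OF mM] by (simp add: anti_def)
      also have "\<dots> = 2 \<star> (- (?m' * i))" unfolding pm by (simp only: sm_simps(1,6))
      finally have "i * ?m' = - (?m' * i)" by (rule sm_cancel) (use m'L i in auto)
      then have m'M: "?m' \<in> anti i" using m'L by (simp add: anti_def)
      have "2 \<star> ?m = (1 - i) * (\<pi> * ?m)" by (simp only: pib(2))
      also have "\<dots> = 2 \<star> ((1 - i) * ?m')" unfolding pm by (simp only: sm_simps(2))
      finally have "?m = (1 - i) * ?m'" by (rule sm_cancel) (use m'L x(1) i in auto)
      then have "(1 - i) * ?m' = 2 \<star> x - (A \<star> 1 + b \<star> i)" using x2 by (simp only: add_diff_cancel_left')
      then have "(1 - i) * ?m' - \<pi> = 2 \<star> x - ((A + 1) \<star> 1 + (b + 1) \<star> i)"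
        by (simp only: sm_simps(7)[of _ 1] sm_simps(10) \<pi>_def) (simp add: algebra_simps)
      also have "\<dots> \<in> NL 2"
        using False oA x(1) i(1) by (intro NL_closed(2,4) NL_I NL_dvd) auto
      finally show ?thesis using m'M by blast
    qed
  qed
  then obtain m where m: "m \<in> anti i" "(1 - i) * m - \<pi> \<in> NL 2" by blast
  obtain q v where q: "v \<in> anti i" "m = q \<star> j + \<pi> * v" using j(2)[OF m(1)] by blast
  have qj: "\<pi> - q \<star> ((1 - i) * j) \<in> NL 2"
    using NL_trans[OF NL_sym[OF m(2)], of "q \<star> ((1 - i) * j)"] bq[OF anL[OF q(1)], of q] unfolding q(2) by blast
  have bj: "(1 - i) * j \<in> L" using anL[OF bM(1)[OF j(1)]] .
  have "odd q"
  proof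
    assume "even q"
    then have "\<pi> \<in> NL 2" using NL_minus_iff[OF qj] NL_dvd[OF _ bj] by blast
    then show False using ind[of 1 1] by (simp add: \<pi>_def sm_simps)
  qed
  have pj: "(1 - i) * j - \<pi> \<in> NL 2"
  proof -
    have "q \<star> ((1 - i) * j) - (1 - i) * j = (q - 1) \<star> ((1 - i) * j)" by (simp add: sm_simps(8,10))
    also have "\<dots> \<in> NL 2" using \<open>odd q\<close> bj by (intro NL_dvd) auto
    finally show ?thesis using NL_sym[OF NL_trans[OF qj]] by blast
  qed
  define e where "e n = (if n = 0 then 1 else i)" for n :: nat
  have sum2: "(\<Sum>n<2. of_int (c n) * e n) = c 0 \<star> 1 + c 1 \<star> i" for c
    by (simp add: numeral_2_eq_2 e_def sm_def)
  let ?F = "Fix 2 {g, h}"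
  have "zbasis 2 ?F (NL 2) 2 e"
    unfolding zbasis_def sum2
  proof (intro conjI allI impI ballI)
    have "g (h i) * \<pi> = i * \<pi>" using i(3)[OF i(1)] by (simp add: \<pi>_def distrib_left distrib_right i(2))
    then have "g (h i) = i" using right_cancel[OF _ pi0] i(1) gL hL by blast
    then have "h i = - i" using gg[of "h i"] i(1,4) hL by simp
    moreover have "- i - i = 2 \<star> (- i)" by (simp add: sm_numerals)
    ultimately have "i \<in> ?F" using i(1,4) NL_I[of "- i" 2] by (simp add: Fix_def)
    then show "e n \<in> ?F" for n using one_in_Fix[of "{g, h}"] a by (auto simp: e_def)
    show "2 dvd c n" if "c 0 \<star> 1 + c 1 \<star> i \<in> NL 2" "n < 2"
      for c :: "nat \<Rightarrow> int" and n :: nat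
      using ind[OF that(1)] that(2) by (cases "n = 0") (auto simp: less_2_cases_iff)
    fix x assume "x \<in> ?F"
    then have x: "x \<in> L" "g x - x \<in> NL 2" "h x - x \<in> NL 2" by (auto simp: Fix_def)
    have "g (h x) - x \<in> NL 2" using Fix_comp[OF a(1) x(1) hL[OF x(1)] x(2,3)] .
    then obtain u0 where u0: "u0 \<in> L" "g (h x) - x = 2 \<star> u0" by (auto simp: NL_def)
    \<comment> \<open>Conjugation by \<open>\<pi>\<close> is \<open>g\<close> after
      \<open>h\<close>, so its inverse moves \<open>u0\<close> to the other side of
      \<open>\<pi>\<close>; the commutator of \<open>i\<close> and \<open>x\<close> becomes
      \<open>2 \<star> (\<pi> * u)\<close>.\<close>
    define u where "u = h (g u0)"
    have u: "u \<in> L" "\<pi> * u = u0 * \<pi>"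
      using u0(1) i(3)[of "h (g u0)"] by (simp_all add: u_def gL hL gg hh \<pi>_def)
    have ixe: "i * x - x * i = 2 \<star> (\<pi> * u)"
    proof -
      have "i * x - x * i = \<pi> * x - x * \<pi>" by (simp add: \<pi>_def algebra_simps)
      also have "\<dots> = (g (h x) - x) * \<pi>" using i(3)[OF x(1)] by (simp add: \<pi>_def left_diff_distrib)
      finally show ?thesis unfolding u0(2) u(2) by (simp add: sm_simps(1))
    qed
    have ipi: "i * (\<pi> * y) = \<pi> * (i * y)" for y by (simp add: \<pi>_def algebra_simps)
    have "2 \<star> (\<pi> * (i * u + u * i)) = i * (2 \<star> (\<pi> * u)) + (2 \<star> (\<pi> * u)) * i"
      by (simp only: sm_simps(1,2,4) distrib_left ipi mult.assoc)
    also have "\<dots> = 0" unfolding ixe[symmetric]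
      by (simp add: left_diff_distrib right_diff_distrib mult.assoc ii i(2))
    finally have "\<pi> * (i * u + u * i) = 0"
      using sm_eq_0_iff[of "\<pi> * (i * u + u * i)" 2] pi0(2) i(1) u(1) by simp
    then have "i * u + u * i = 0" using mult_eq_0 pi0 i(1) u(1) by blast
    then have "i * u = - (u * i)" by (simp add: eq_neg_iff_add_eq_0)
    then have uM: "u \<in> anti i" using u(1) by (simp add: anti_def)
    \<comment> \<open>As \<open>i * (1 - i) = \<pi>\<close>, this element has the same commutator
      with \<open>i\<close> as \<open>x\<close>, so \<open>x - ?y\<close> is a combination of 1 and
      \<open>i\<close>. Modulo 2, \<open>?y\<close> is a multiple of \<open>(1 - i) * j\<close>,
      hence of \<open>\<pi>\<close>, and no third basis element arises.\<close>
    let ?y = "(1 - i) * u"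
    have yM: "?y \<in> anti i" using bM(1)[OF uM] .
    have yL: "?y \<in> L" using anL[OF yM] .
    have d: "i * ?y - ?y * i = 2 \<star> (i * ?y)" using yM by (simp add: anti_def sm_numerals)
    have iy: "i * ?y = \<pi> * u" by (simp add: \<pi>_def left_diff_distrib right_diff_distrib distrib_right ii add.commute)
    have "i * ?y - ?y * i = i * x - x * i" using d ixe unfolding iy by metis
    moreover have "i * (x - y) - (x - y) * i = (i * x - x * i) - (i * y - y * i)" for y
      by (simp add: algebra_simps)
    ultimately have "i * (x - ?y) - (x - ?y) * i = 0" by (simp only: diff_self)
    then have "i * (x - ?y) = (x - ?y) * i" by (simp only: eq_iff_diff_eq_0[symmetric])
    then obtain b c where bc: "x - ?y = b \<star> 1 + c \<star> i" using centralizer_i[OF i(1,2)] x(1) yL by blast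
    obtain q' v' where q': "v' \<in> anti i" "u = q' \<star> j + \<pi> * v'" using j(2)[OF uM] by blast
    have "?y - q' \<star> ((1 - i) * j) \<in> NL 2" using bq[OF anL[OF q'(1)]] unfolding q'(2) .
    moreover have "q' \<star> ((1 - i) * j) - q' \<star> \<pi> \<in> NL 2" using NL_closed(5)[OF pj, of q'] by (simp only: sm_simps(5))
    ultimately have "?y - q' \<star> \<pi> \<in> NL 2" by (rule NL_trans)
    moreover have "x - ((b + q') \<star> 1 + (c + q') \<star> i) = ?y - q' \<star> \<pi>"
      using bc by (simp add: \<pi>_def sm_simps algebra_simps)
    ultimately have "x - ((b + q') \<star> 1 + (c + q') \<star> i) \<in> NL 2" by simp
    then show "\<exists>n::nat \<Rightarrow> int. x - (n 0 \<star> 1 + n 1 \<star> i) \<in> NL 2"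
      by (intro exI[of _ "\<lambda>k::nat. if k = 0 then b + q' else c + q'"]) simp
  qed
  then show ?thesis by blast
qed
end

section \<open>Orders as rings of complex matrices\<close>

text \<open>The locale \<open>quat_order\<close> works over a type of class \<open>ring_1\<close>,
  so the matrices form a type of their own. Complex entries provide a square root of every rational
  \<open>a\<close>.\<close>

datatype m2 = M2 (m11: complex) (m12: complex) (m21: complex) (m22: complex)

lemma m2_eq_iff: "x = y \<longleftrightarrow> m11 x = m11 y \<and> m12 x = m12 y \<and> m21 x = m21 y \<and> m22 x = m22 y"
  by (cases x; cases y) simp

instantiation m2 :: ring_1
begin

definition "0 = M2 0 0 0 0"
definition "1 = M2 1 0 0 1"
definition "x + y = M2 (m11 x + m11 y) (m12 x + m12 y) (m21 x + m21 y) (m22 x + m22 y)"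
definition "x - y = M2 (m11 x - m11 y) (m12 x - m12 y) (m21 x - m21 y) (m22 x - m22 y)"
definition "- x = M2 (- m11 x) (- m12 x) (- m21 x) (- m22 x)"
definition "x * y = M2 (m11 x * m11 y + m12 x * m21 y) (m11 x * m12 y + m12 x * m22 y)
  (m21 x * m11 y + m22 x * m21 y) (m21 x * m12 y + m22 x * m22 y)"

instance
  by standard (simp_all add: zero_m2_def one_m2_def plus_m2_def minus_m2_def uminus_m2_def
      times_m2_def m2_eq_iff algebra_simps)

end

lemma m2_sel [simp]:
  "m11 0 = 0" "m12 0 = 0" "m21 0 = 0" "m22 0 = 0"
  "m11 1 = 1" "m12 1 = 0" "m21 1 = 0" "m22 1 = 1"
  "m11 (x + y) = m11 x + m11 y" "m12 (x + y) = m12 x + m12 y"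
  "m21 (x + y) = m21 x + m21 y" "m22 (x + y) = m22 x + m22 y"
  "m11 (x - y) = m11 x - m11 y" "m12 (x - y) = m12 x - m12 y"
  "m21 (x - y) = m21 x - m21 y" "m22 (x - y) = m22 x - m22 y"
  "m11 (- x) = - m11 x" "m12 (- x) = - m12 x" "m21 (- x) = - m21 x" "m22 (- x) = - m22 x"
  "m11 (x * y) = m11 x * m11 y + m12 x * m21 y" "m12 (x * y) = m11 x * m12 y + m12 x * m22 y"
  "m21 (x * y) = m21 x * m11 y + m22 x * m21 y" "m22 (x * y) = m21 x * m12 y + m22 x * m22 y"
  by (simp_all add: zero_m2_def one_m2_def plus_m2_def minus_m2_def uminus_m2_def times_m2_def)

lemma of_nat_m2: "of_nat n = M2 (of_nat n) 0 0 (of_nat n)"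
  by (induction n) (simp_all add: m2_eq_iff)

lemma of_int_m2: "of_int n = M2 (of_int n) 0 0 (of_int n)"
  by (cases n) (simp_all add: of_nat_m2 m2_eq_iff del: of_nat_Suc)

lemma sm_m2: "n \<star> x = M2 (of_int n * m11 x) (of_int n * m12 x) (of_int n * m21 x) (of_int n * m22 x)"
  by (simp add: sm_def of_int_m2 m2_eq_iff)

definition mtr :: "m2 \<Rightarrow> complex" where "mtr x = m11 x + m22 x"

definition mdet :: "m2 \<Rightarrow> complex" where "mdet x = m11 x * m22 x - m12 x * m21 x"

lemma mdet_mult: "mdet (x * y) = mdet x * mdet y"
  by (simp add: mdet_def algebra_simps)

lemma mtr_add: "mtr (x + y) = mtr x + mtr y"
  by (simp add: mtr_def)

lemma mtr_sq: "mtr (x * x) = mtr x * mtr x - 2 * mdet x"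
  by (simp add: mtr_def mdet_def algebra_simps)

lemma m2_cayley: "mtr x = of_int t \<Longrightarrow> mdet x = of_int d \<Longrightarrow> x * x = t \<star> x - d \<star> 1"
proof -
  assume "mtr x = of_int t" "mdet x = of_int d"
  then show ?thesis
    by (simp add: m2_eq_iff sm_m2 mtr_def mdet_def algebra_simps flip: \<open>mtr x = of_int t\<close> \<open>mdet x = of_int d\<close>)
qed

lemma sm_m2_cancel: "n \<star> x = n \<star> y \<Longrightarrow> n \<noteq> 0 \<Longrightarrow> x = (y :: m2)"
  by (simp add: sm_m2 m2_eq_iff)

text \<open>The splitting \<open>(a, b | \<rat>) \<rightarrow> Mat\<^sub>2(\<complex>)\<close> with \<open>i \<mapsto> diag(\<surd>a, -\<surd>a)\<close> and \<open>j \<mapsto> (0, b; 1, 0)\<close>.\<close>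

fun emb :: "rat \<Rightarrow> rat \<Rightarrow> rat \<times> rat \<times> rat \<times> rat \<Rightarrow> m2" where
  "emb a b (x0, x1, x2, x3) = (let s = csqrt (of_rat a) in
     M2 (of_rat x0 + of_rat x1 * s) (of_rat b * (of_rat x2 + of_rat x3 * s))
        (of_rat x2 - of_rat x3 * s) (of_rat x0 - of_rat x1 * s))"

lemma csqrt_sq: "csqrt (of_rat a) * csqrt (of_rat a) = of_rat a"
  by (metis power2_csqrt power2_eq_square)

lemma emb_add: "emb a b (quat_add x y) = emb a b x + emb a b y"
  by (cases x; cases y) (simp add: Let_def m2_eq_iff of_rat_add algebra_simps)

lemma emb_mult: "emb a b (quat_mult a b x y) = emb a b x * emb a b y"
proof -
  have s: "z * csqrt (of_rat a) * csqrt (of_rat a) = z * of_rat a"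
    "csqrt (of_rat a) * (csqrt (of_rat a) * z) = of_rat a * z" for z
    using csqrt_sq[of a] by (metis mult.assoc)+
  obtain x0 x1 x2 x3 y0 y1 y2 y3 where "x = (x0, x1, x2, x3)" "y = (y0, y1, y2, y3)"
    by (metis surj_pair)
  then show ?thesis
    by (simp add: Let_def m2_eq_iff of_rat_add of_rat_mult of_rat_diff algebra_simps csqrt_sq s)
qed

text \<open>Entries come in pairs with \<open>s\<close> and \<open>- s\<close>; sums and differences
  recover the coordinates, whether or not \<open>a\<close> is a square.\<close>

lemma emb_inj:
  assumes "a \<noteq> 0" "b \<noteq> 0"
  shows "inj (emb a b)"
proof (rule injI)
  fix x y assume e: "emb a b x = emb a b y"
  obtain x0 x1 x2 x3 y0 y1 y2 y3 where xy: "x = (x0, x1, x2, x3)" "y = (y0, y1, y2, y3)"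
    by (metis surj_pair)
  let ?s = "csqrt (of_rat a)"
  have s: "?s \<noteq> 0" using assms by simp
  have sep: "p = p' \<and> q = q'"
    if "of_rat p + of_rat q * ?s = of_rat p' + of_rat q' * ?s"
      "of_rat p - of_rat q * ?s = of_rat p' - of_rat q' * ?s" for p q p' q'
  proof -
    have "(of_rat p + of_rat q * ?s) + (of_rat p - of_rat q * ?s) =
        (of_rat p' + of_rat q' * ?s) + (of_rat p' - of_rat q' * ?s)"
      using that by (simp only:)
    then have "2 * of_rat p = (2 * of_rat p' :: complex)" by simp
    then have "p = p'" by simp
    then show ?thesis using that s by simp
  qed
  show "x = y" using e assms sep[of x0 x1 y0 y1] sep[of x2 x3 y2 y3] by (simp add: xy Let_def)
qed

lemma emb_one: "emb a b (1, 0, 0, 0) = 1"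
  by (simp add: m2_eq_iff)

lemma emb_trace: "mtr (emb a b x) \<in> \<rat>"
  by (cases x) (simp add: mtr_def Let_def)

lemma emb_div: "n \<noteq> 0 \<Longrightarrow> \<exists>y. n \<star> emb a b y = emb a b x"
proof -
  assume n: "n \<noteq> 0"
  obtain x0 x1 x2 x3 where x: "x = (x0, x1, x2, x3)" by (metis surj_pair)
  show ?thesis
    using n by (intro exI[of _ "(x0 / of_int n, x1 / of_int n, x2 / of_int n, x3 / of_int n)"])
      (simp add: x Let_def sm_m2 of_rat_divide field_simps)
qed

declare emb.simps [simp del]

text \<open>A denominator \<open>q\<close> of at least 2 would give \<open>q ^ m \<le> d\<close> for
  some \<open>m \<ge> d\<close>, although \<open>q ^ m \<ge> 2 ^ m > m\<close>. Unboundedly many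
  exponents suffice, since for traces only powers of 2 are available.\<close>

lemma Ints_of_powers:
  fixes r :: complex
  assumes r: "r \<in> \<rat>" and d: "d > 0" and p: "\<And>n::nat. \<exists>m\<ge>n. of_nat d * r ^ m \<in> \<int>"
  shows "r \<in> \<int>"
proof -
  obtain p q where pq: "q > 0" "coprime p q" "r = of_int p / of_int q"
    using r by (rule Rats_cases')
  have "q = 1"
  proof (rule ccontr)
    assume "q \<noteq> 1"
    then have q2: "2 \<le> q" using pq by simp
    obtain m where m: "m \<ge> d" "of_nat d * r ^ m \<in> \<int>" using p by blast
    then obtain k where k: "of_nat d * r ^ m = (of_int k :: complex)" by (auto elim: Ints_cases)
    have "of_int (int d * p ^ m) = (of_int (k * q ^ m) :: complex)"
      using k pq by (simp add: pq(3) power_divide field_simps)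
    then have e: "int d * p ^ m = k * q ^ m" by (simp only: of_int_eq_iff)
    have "q ^ m dvd int d * p ^ m" unfolding e by simp
    moreover have "coprime (q ^ m) (p ^ m)" using pq by (simp add: coprime_commute)
    ultimately have "q ^ m dvd int d" by (simp add: coprime_dvd_mult_left_iff)
    then have "q ^ m \<le> int d" using d by (intro zdvd_imp_le) auto
    moreover have "2 ^ m \<le> q ^ m" using q2 by (intro power_mono) auto
    moreover have "int m < 2 ^ m" by (metis of_nat_less_two_power)
    ultimately show False using m(1) by linarith
  qed
  then show ?thesis using pq by simp
qed

text \<open>Determinants are multiplicative and expressible by traces through \<open>mtr_sq\<close>,
  so all powers of \<open>mdet x\<close> have denominator dividing \<open>2 * d * d\<close>. Traces
  are not multiplicative, but the square of \<open>mtr y\<close> is the trace of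
  \<open>y * y\<close> plus the integer \<open>mdet y\<close>; iterating, the powers of
  \<open>mtr x\<close> with exponent \<open>2 ^ n\<close> are traces of elements of
  \<open>L\<close>.\<close>

lemma m2_order_integral:
  assumes L: "1 \<in> L" "\<And>x y. x \<in> L \<Longrightarrow> y \<in> L \<Longrightarrow> x * y \<in> L" "add_subgroup L"
    and Q: "\<And>x. x \<in> L \<Longrightarrow> mtr x \<in> \<rat>" and d: "d > 0" "\<And>x. x \<in> L \<Longrightarrow> of_nat d * mtr x \<in> \<int>"
    and x: "x \<in> L"
  shows "mtr x \<in> \<int>" and "mdet x \<in> \<int>"
proof -
  have det: "mdet x \<in> \<int>" if x: "x \<in> L" for x
  proof (rule Ints_of_powers)
    have "mdet x = (mtr x * mtr x - mtr (x * x)) / 2" by (simp add: mtr_sq)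
    moreover have "(mtr x * mtr x - mtr (x * x)) / 2 \<in> \<rat>" using Q[OF x] Q[OF L(2)[OF x x]] by simp
    ultimately show "mdet x \<in> \<rat>" by metis
    have pow: "x ^ n \<in> L" for n by (induction n) (use L x in auto)
    have dpow: "mdet (x ^ n) = mdet x ^ n" for n
      by (induction n) (simp_all add: mdet_mult, simp add: mdet_def)
    show "\<exists>m\<ge>n. of_nat (2 * d * d) * mdet x ^ m \<in> \<int>" for n
    proof (intro exI[of _ n] conjI)
      have "of_nat (2 * d * d) * mdet x ^ n =
          (of_nat d * mtr (x ^ n)) * (of_nat d * mtr (x ^ n)) - of_nat d * (of_nat d * mtr (x ^ n * x ^ n))"
        unfolding dpow[symmetric] mtr_sq by (simp add: algebra_simps)
      also have "\<dots> \<in> \<int>"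
        using d(2)[OF pow] d(2)[OF L(2)[OF pow pow]] by (blast intro: Ints_diff Ints_mult Ints_of_nat)
      finally show "of_nat (2 * d * d) * mdet x ^ n \<in> \<int>" .
    qed simp
  qed (use d in simp)
  show "mdet x \<in> \<int>" using det x .
  have sq: "\<exists>y\<in>L. mtr y = mtr x ^ (2 ^ n)" for n
  proof (induction n)
    case 0
    then show ?case using x by auto
  next
    case (Suc n)
    then obtain y where y: "y \<in> L" "mtr y = mtr x ^ (2 ^ n)" by blast
    obtain k where k: "mdet y = of_int k" using det[OF y(1)] by (auto elim: Ints_cases)
    have "mtr (y * y + k \<star> 1) = mtr (y * y) + 2 * mdet y" by (simp add: mtr_def sm_m2 k)
    also have "\<dots> = mtr x ^ (2 ^ Suc n)" unfolding mtr_sq y(2) power_Suc mult_2 power_add by simp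
    finally have "mtr (y * y + k \<star> 1) = mtr x ^ (2 ^ Suc n)" .
    moreover have "y * y + k \<star> 1 \<in> L"
      using add_subgroupD(4)[OF L(3) L(2)[OF y(1) y(1)] sm_in[OF L(3,1)]] .
    ultimately show ?case by blast
  qed
  show "mtr x \<in> \<int>"
  proof (rule Ints_of_powers[OF Q[OF x] d(1)])
    fix n :: nat
    obtain y where "y \<in> L" "mtr y = mtr x ^ (2 ^ n)" using sq by blast
    then have "of_nat d * mtr x ^ (2 ^ n) \<in> \<int>" using d(2) by metis
    moreover have "n \<le> 2 ^ n" using less_exp[of n] by simp
    ultimately show "\<exists>m\<ge>n. of_nat d * mtr x ^ m \<in> \<int>" by blast
  qed
qed

text \<open>On the image of the order the trace is an integer, and real part and floor only extract
  it as an \<open>int\<close>.\<close>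

definition mT :: "m2 \<Rightarrow> int" where "mT x = \<lfloor>Re (mtr x)\<rfloor>"

definition mD :: "m2 \<Rightarrow> int" where "mD x = \<lfloor>Re (mdet x)\<rfloor>"

lemma common_denominator:
  fixes f :: "'a \<Rightarrow> complex"
  assumes "finite S" "\<And>s. s \<in> S \<Longrightarrow> f s \<in> \<rat>"
  shows "\<exists>d::nat. d > 0 \<and> (\<forall>s\<in>S. of_nat d * f s \<in> \<int>)"
  using assms
proof (induction S)
  case empty
  then show ?case by (intro exI[of _ 1]) auto
next
  case (insert s S)
  then obtain d where d: "d > 0" "\<And>s. s \<in> S \<Longrightarrow> of_nat d * f s \<in> \<int>" by auto
  have "f s \<in> \<rat>" using insert.prems by simp
  then obtain p q where pq: "q > 0" "f s = of_int p / of_int q" by (rule Rats_cases')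
  have "of_nat (d * nat q) * f s = of_int (int d * p)" using pq by simp
  then have "of_nat (d * nat q) * f s \<in> \<int>" by (metis Ints_of_int)
  moreover have "of_nat (d * nat q) * f s' \<in> \<int>" if "s' \<in> S" for s'
  proof -
    have "of_nat (d * nat q) * f s' = of_nat (nat q) * (of_nat d * f s')" by simp
    also have "\<dots> \<in> \<int>" using Ints_of_nat d(2)[OF that] by (rule Ints_mult)
    finally show ?thesis .
  qed
  ultimately have "\<forall>s'\<in>insert s S. of_nat (d * nat q) * f s' \<in> \<int>" by blast
  moreover have "d * nat q > 0" using d(1) pq(1) by simp
  ultimately show ?case by blast
qed

text \<open>\<open>\<Phi>_div\<close> supplies the denominators needed to enlarge the order,
  \<open>\<Phi>_trace\<close> is the source of integrality, and \<open>Units_B\<close> becomes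
  anisotropy of the norm.\<close>

locale embedded_order = Ring.ring B for B :: "('a, 'm) ring_scheme" (structure) +
  fixes \<O> :: "'a set" and \<Phi> :: "'a \<Rightarrow> m2"
  assumes inj: "inj_on \<Phi> (carrier B)"
    and \<Phi>_add: "x \<in> carrier B \<Longrightarrow> y \<in> carrier B \<Longrightarrow> \<Phi> (x \<oplus> y) = \<Phi> x + \<Phi> y"
    and \<Phi>_mult: "x \<in> carrier B \<Longrightarrow> y \<in> carrier B \<Longrightarrow> \<Phi> (x \<otimes> y) = \<Phi> x * \<Phi> y"
    and \<Phi>_one: "\<Phi> \<one> = 1"
    and \<Phi>_trace: "x \<in> carrier B \<Longrightarrow> mtr (\<Phi> x) \<in> \<rat>"
    and \<Phi>_div: "x \<in> carrier B \<Longrightarrow> n \<noteq> 0 \<Longrightarrow> \<exists>y\<in>carrier B. n \<star> \<Phi> y = \<Phi> x"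
    and \<Phi>_noncomm: "\<exists>x\<in>carrier B. \<exists>y\<in>carrier B. \<Phi> x * \<Phi> y \<noteq> \<Phi> y * \<Phi> x"
    and Units_B: "Units B = carrier B - {\<zero>}"
    and maximal_\<O>: "maximal_order B \<O>"
begin

lemma \<Phi>_zero: "\<Phi> \<zero> = 0"
  using \<Phi>_add[of \<zero> \<zero>] by simp

lemma \<Phi>_neg: "x \<in> carrier B \<Longrightarrow> \<Phi> (\<ominus> x) = - \<Phi> x"
  using \<Phi>_add[of "\<ominus> x" x] \<Phi>_zero by (simp add: l_neg eq_neg_iff_add_eq_0)

lemma \<Phi>_nat: "x \<in> carrier B \<Longrightarrow> \<Phi> ([n] \<cdot> x) = int n \<star> \<Phi> x" for n :: nat
  by (induction n) (simp_all add: \<Phi>_zero \<Phi>_add sm_simps add.commute)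

lemma order_\<O>: "is_order B \<O>"
  using maximal_\<O> by (simp add: maximal_order_def)

lemma subring_\<O>: "subring \<O> B"
  using order_\<O> by (simp add: is_order_def)

lemma \<O>_carrier: "x \<in> \<O> \<Longrightarrow> x \<in> carrier B"
  using subringE(1)[OF subring_\<O>] by blast

lemma \<O>_closed: "\<zero> \<in> \<O>" "\<one> \<in> \<O>" "x \<in> \<O> \<Longrightarrow> y \<in> \<O> \<Longrightarrow> x \<oplus> y \<in> \<O>"
  "x \<in> \<O> \<Longrightarrow> y \<in> \<O> \<Longrightarrow> x \<otimes> y \<in> \<O>" "x \<in> \<O> \<Longrightarrow> \<ominus> x \<in> \<O>"
  using subringE[OF subring_\<O>] by auto

lemma \<O>_scale: "x \<in> carrier B \<Longrightarrow> \<exists>m::nat. m > 0 \<and> [m] \<cdot> x \<in> \<O>"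
  using order_\<O> by (simp add: is_order_def)

abbreviation L :: "m2 set" where "L \<equiv> \<Phi> ` \<O>"

lemma L_add_subgroup: "add_subgroup L"
  unfolding add_subgroup_def
proof (intro conjI ballI)
  show "0 \<in> L" using \<O>_closed(1) \<Phi>_zero by (metis imageI)
  fix x y assume "x \<in> L" "y \<in> L"
  then obtain x' y' where "x = \<Phi> x'" "y = \<Phi> y'" "x' \<in> \<O>" "y' \<in> \<O>" by blast
  moreover then have "\<Phi> (x' \<oplus> \<ominus> y') = \<Phi> x' - \<Phi> y'" by (simp add: \<Phi>_add \<Phi>_neg \<O>_carrier)
  ultimately show "x - y \<in> L" using \<O>_closed(3,5) by (metis imageI)
qed

lemma L_mult: "x \<in> L \<Longrightarrow> y \<in> L \<Longrightarrow> x * y \<in> L"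
  using \<O>_closed(4) by (auto simp: \<Phi>_mult[symmetric] \<O>_carrier)

lemma L_one: "1 \<in> L"
  using \<O>_closed(2) \<Phi>_one by (metis imageI)

lemma generators: "\<exists>S. finite S \<and> S \<subseteq> \<O> \<and> \<O> = generate (add_monoid B) S"
  using order_\<O> by (simp add: is_order_def)

lemma generate_add_induct:
  assumes "x \<in> generate (add_monoid B) S" "S \<subseteq> carrier B"
    and "P \<zero>" "\<And>s. s \<in> S \<Longrightarrow> P s" "\<And>x. x \<in> carrier B \<Longrightarrow> P x \<Longrightarrow> P (\<ominus> x)"
    and "\<And>x y. x \<in> carrier B \<Longrightarrow> y \<in> carrier B \<Longrightarrow> P x \<Longrightarrow> P y \<Longrightarrow> P (x \<oplus> y)"
  shows "P x \<and> x \<in> carrier B"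
  using assms(1)
proof (induction rule: generate.induct)
  case one
  then show ?case using assms(3) by simp
next
  case (incl h)
  then show ?case using assms(2,4) by blast
next
  case (inv h)
  then have "h \<in> carrier B" "P h" using assms(2,4) by blast+
  then show ?case using assms(5) by (simp flip: a_inv_def)
next
  case (eng h1 h2)
  then show ?case using assms(6) by simp
qed

text \<open>The trace is additive, so a common denominator for finitely many generators serves the
  whole lattice.\<close>

lemma L_trace_denominator: "\<exists>d::nat. d > 0 \<and> (\<forall>x\<in>L. of_nat d * mtr x \<in> \<int>)"
proof -
  obtain S where S: "finite S" "S \<subseteq> \<O>" "\<O> = generate (add_monoid B) S" using generators by blast
  have SB: "S \<subseteq> carrier B" using S(2) \<O>_carrier by blast
  obtain d :: nat where d: "d > 0" "\<forall>s\<in>S. of_nat d * mtr (\<Phi> s) \<in> \<int>"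
    using common_denominator[OF S(1), of "\<lambda>s. mtr (\<Phi> s)"] \<Phi>_trace SB by blast
  have "of_nat d * mtr (\<Phi> x) \<in> \<int> \<and> x \<in> carrier B" if "x \<in> \<O>" for x
  proof (rule generate_add_induct[OF _ SB])
    show "x \<in> generate (add_monoid B) S" using that S(3) by simp
    show "of_nat d * mtr (\<Phi> \<zero>) \<in> \<int>" by (simp add: \<Phi>_zero mtr_def)
    show "of_nat d * mtr (\<Phi> s) \<in> \<int>" if "s \<in> S" for s using d(2) that by blast
    show "of_nat d * mtr (\<Phi> (\<ominus> x)) \<in> \<int>" if "x \<in> carrier B" "of_nat d * mtr (\<Phi> x) \<in> \<int>" for x
    proof -
      have "of_nat d * mtr (\<Phi> (\<ominus> x)) = - (of_nat d * mtr (\<Phi> x))"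
        using that(1) by (simp add: \<Phi>_neg mtr_def algebra_simps)
      then show ?thesis using that(2) by simp
    qed
    show "of_nat d * mtr (\<Phi> (x \<oplus> y)) \<in> \<int>"
      if "x \<in> carrier B" "y \<in> carrier B" "of_nat d * mtr (\<Phi> x) \<in> \<int>" "of_nat d * mtr (\<Phi> y) \<in> \<int>" for x y
    proof -
      have "of_nat d * mtr (\<Phi> (x \<oplus> y)) = of_nat d * mtr (\<Phi> x) + of_nat d * mtr (\<Phi> y)"
        using that(1,2) by (simp add: \<Phi>_add mtr_def algebra_simps)
      then show ?thesis using that(3,4) by simp
    qed
  qed
  then show ?thesis using d(1) by blast
qed

lemma L_integral: assumes "x \<in> L" shows "mtr x = of_int (mT x)" "mdet x = of_int (mD x)"
proof -
  obtain d :: nat where d: "d > 0" "\<And>x. x \<in> L \<Longrightarrow> of_nat d * mtr x \<in> \<int>"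
    using L_trace_denominator by blast
  have Q: "\<And>x. x \<in> L \<Longrightarrow> mtr x \<in> \<rat>" using \<Phi>_trace \<O>_carrier by blast
  note I = m2_order_integral[OF L_one L_mult L_add_subgroup Q d assms]
  have "z = of_int \<lfloor>Re z\<rfloor>" if "z \<in> \<int>" for z :: complex using that by (auto elim!: Ints_cases)
  then show "mtr x = of_int (mT x)" "mdet x = of_int (mD x)" using I by (simp_all add: mT_def mD_def)
qed

text \<open>For \<open>e = c / d\<close> the hypotheses say that \<open>e * x\<close> and
  \<open>e * e\<close> lie in L + Le, so \<open>O'\<close> is a ring. It is generated additively by
  \<open>S\<close> and the products of \<open>S\<close> with \<open>e0\<close>, hence an order
  containing \<open>\<O>\<close>; maximality puts \<open>e0\<close> into
  \<open>\<O>\<close>.\<close>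

lemma maximal_L:
  assumes c: "c \<in> L" and d: "d \<noteq> 0"
    and cx: "\<And>x. x \<in> L \<Longrightarrow> \<exists>p\<in>L. \<exists>q\<in>L. c * x = d \<star> p + q * c"
    and cc: "\<exists>p\<in>L. \<exists>q\<in>L. c * c = (d * d) \<star> p + d \<star> (q * c)"
  shows "\<exists>w\<in>L. c = d \<star> w"
proof -
  note Lc = add_subgroupD[OF L_add_subgroup] L_mult L_one
  obtain c0 where c0: "c0 \<in> \<O>" "c = \<Phi> c0" using c by blast
  obtain e0 where e0: "e0 \<in> carrier B" "d \<star> \<Phi> e0 = c" using \<Phi>_div[OF \<O>_carrier[OF c0(1)] d] c0 by auto
  define e where "e = \<Phi> e0"
  have ce: "c = d \<star> e" using e0 by (simp add: e_def)
  have ex: "\<exists>p\<in>L. \<exists>q\<in>L. e * x = p + q * e" if x: "x \<in> L" for x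
  proof -
    obtain p q where pq: "p \<in> L" "q \<in> L" "c * x = d \<star> p + q * c" using cx[OF x] by blast
    then have "d \<star> (e * x) = d \<star> (p + q * e)" unfolding ce by (simp add: sm_simps)
    then show ?thesis using sm_m2_cancel d pq by blast
  qed
  have ee: "\<exists>p\<in>L. \<exists>q\<in>L. e * e = p + q * e"
  proof -
    obtain p q where pq: "p \<in> L" "q \<in> L" "c * c = (d * d) \<star> p + d \<star> (q * c)" using cc by blast
    then have "(d * d) \<star> (e * e) = (d * d) \<star> (p + q * e)" unfolding ce by (simp add: sm_simps)
    then show ?thesis using sm_m2_cancel[of "d * d"] d pq by auto
  qed
  define O' where "O' = {p \<oplus> q \<otimes> e0 | p q. p \<in> \<O> \<and> q \<in> \<O>}"
  have O'I: "p \<oplus> q \<otimes> e0 \<in> O'" if "p \<in> \<O>" "q \<in> \<O>" for p q using that by (auto simp: O'_def)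
  have \<Phi>O': "\<Phi> (p \<oplus> q \<otimes> e0) = \<Phi> p + \<Phi> q * e" if "p \<in> \<O>" "q \<in> \<O>" for p q
    using that e0 by (simp add: \<Phi>_add \<Phi>_mult \<O>_carrier e_def)
  have O'B: "O' \<subseteq> carrier B" using e0 by (auto simp: O'_def \<O>_carrier)
  have O'_iff: "u \<in> O' \<longleftrightarrow> (\<exists>p\<in>L. \<exists>q\<in>L. \<Phi> u = p + q * e)" if u: "u \<in> carrier B" for u
  proof
    assume "u \<in> O'"
    then show "\<exists>p\<in>L. \<exists>q\<in>L. \<Phi> u = p + q * e" using \<Phi>O' by (auto simp: O'_def)
  next
    assume "\<exists>p\<in>L. \<exists>q\<in>L. \<Phi> u = p + q * e"
    then obtain p q where pq: "p \<in> \<O>" "q \<in> \<O>" "\<Phi> u = \<Phi> p + \<Phi> q * e" by blast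
    then have "\<Phi> u = \<Phi> (p \<oplus> q \<otimes> e0)" using \<Phi>O' by simp
    then have "u = p \<oplus> q \<otimes> e0" using inj u pq e0 \<O>_carrier by (auto dest!: inj_onD)
    then show "u \<in> O'" using O'I pq by blast
  qed
  have mulL: "\<exists>p\<in>L. \<exists>q\<in>L. x * y = p + q * e"
    if "\<exists>p\<in>L. \<exists>q\<in>L. x = p + q * e" "\<exists>p\<in>L. \<exists>q\<in>L. y = p + q * e" for x y
  proof -
    obtain p q p' q' where pq: "p \<in> L" "q \<in> L" "p' \<in> L" "q' \<in> L" "x = p + q * e" "y = p' + q' * e"
      using \<open>\<exists>p\<in>L. \<exists>q\<in>L. x = p + q * e\<close> \<open>\<exists>p\<in>L. \<exists>q\<in>L. y = p + q * e\<close> by metis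
    obtain a b where ab: "a \<in> L" "b \<in> L" "e * p' = a + b * e" using ex pq by metis
    obtain a' b' where ab': "a' \<in> L" "b' \<in> L" "e * q' = a' + b' * e" using ex pq by metis
    obtain m n where mn: "m \<in> L" "n \<in> L" "e * e = m + n * e" using ee by metis
    have "x * y = p * p' + p * q' * e + q * (e * p') + q * (e * q') * e"
      by (simp add: pq(5,6) distrib_left distrib_right mult.assoc add.assoc)
    also have "\<dots> = p * p' + p * q' * e + q * (a + b * e) + (q * a' * e + q * b' * (e * e))"
      unfolding ab(3) ab'(3) by (simp add: distrib_left distrib_right mult.assoc)
    also have "\<dots> = (p * p' + q * a + q * b' * m) + (p * q' + q * b + q * a' + q * b' * n) * e"
      unfolding mn(3) by (simp add: distrib_left distrib_right mult.assoc add_ac)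
    finally show ?thesis using pq ab ab' mn Lc(4,5) by metis
  qed
  have O'_subring: "subring O' B"
  proof (rule subringI[OF O'B])
    have "\<Phi> \<one> = 1 + 0 * e" using \<Phi>_one by simp
    then show "\<one> \<in> O'" using O'_iff[of \<one>] Lc(1,6) by blast
  next
    fix h assume h: "h \<in> O'"
    then obtain p q where "p \<in> L" "q \<in> L" "\<Phi> h = p + q * e" using O'_iff O'B by blast
    then have "\<Phi> (\<ominus> h) = - p + (- q) * e" "- p \<in> L" "- q \<in> L" using h O'B Lc(3) by (auto simp: \<Phi>_neg)
    then show "\<ominus> h \<in> O'" using O'_iff[of "\<ominus> h"] h O'B by blast
  next
    fix h h' assume h: "h \<in> O'" "h' \<in> O'"
    then have hB: "h \<in> carrier B" "h' \<in> carrier B" using O'B by auto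
    show "h \<otimes> h' \<in> O'"
      using mulL[of "\<Phi> h" "\<Phi> h'"] O'_iff[OF hB(1)] O'_iff[OF hB(2)] O'_iff[of "h \<otimes> h'"] h hB by (simp add: \<Phi>_mult)
    obtain p q p' q' where pq: "p \<in> L" "q \<in> L" "\<Phi> h = p + q * e" "p' \<in> L" "q' \<in> L" "\<Phi> h' = p' + q' * e"
      using O'_iff[OF hB(1)] O'_iff[OF hB(2)] h by blast
    then have "\<Phi> (h \<oplus> h') = (p + p') + (q + q') * e" "p + p' \<in> L" "q + q' \<in> L"
      using hB Lc(4) by (simp_all add: \<Phi>_add algebra_simps)
    then show "h \<oplus> h' \<in> O'" using O'_iff[of "h \<oplus> h'"] hB by blast
  qed
  obtain S where S: "finite S" "S \<subseteq> \<O>" "\<O> = generate (add_monoid B) S" using generators by blast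
  have SB: "S \<subseteq> carrier B" using S(2) \<O>_carrier by blast
  define S' where "S' = S \<union> (\<lambda>s. s \<otimes> e0) ` S"
  have O_O': "\<O> \<subseteq> O'"
  proof
    fix p assume "p \<in> \<O>"
    then show "p \<in> O'" using O'I[OF _ \<O>_closed(1)] e0 \<O>_carrier by simp
  qed
  have S'O': "S' \<subseteq> O'"
    unfolding S'_def using S(2) O_O' O'I[OF \<O>_closed(1)] e0 \<O>_carrier by fastforce
  have S'B: "S' \<subseteq> carrier B" using S'O' O'B by blast
  have gen1: "\<O> \<subseteq> generate (add_monoid B) S'"
    unfolding S(3) S'_def by (rule add.mono_generate) blast
  have gen2: "q \<otimes> e0 \<in> generate (add_monoid B) S'" if q: "q \<in> \<O>" for q
  proof -
    have "q \<otimes> e0 \<in> generate (add_monoid B) S' \<and> q \<in> carrier B"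
    proof (rule generate_add_induct[OF _ SB])
      show "q \<in> generate (add_monoid B) S" using q S(3) by simp
      show "\<zero> \<otimes> e0 \<in> generate (add_monoid B) S'" using generate.one[of "add_monoid B" S'] e0 by simp
      show "s \<otimes> e0 \<in> generate (add_monoid B) S'" if "s \<in> S" for s
        using that by (auto simp: S'_def intro: generate.incl)
      show "\<ominus> x \<otimes> e0 \<in> generate (add_monoid B) S'"
        if "x \<in> carrier B" "x \<otimes> e0 \<in> generate (add_monoid B) S'" for x
        using add.generate_m_inv_closed[OF S'B that(2)] that(1) e0 by (simp add: l_minus flip: a_inv_def)
      show "(x \<oplus> y) \<otimes> e0 \<in> generate (add_monoid B) S'"
        if "x \<in> carrier B" "y \<in> carrier B" "x \<otimes> e0 \<in> generate (add_monoid B) S'"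
          "y \<otimes> e0 \<in> generate (add_monoid B) S'" for x y
        using generate.eng[OF that(3,4)] that(1,2) e0 by (simp add: l_distr)
    qed
    then show ?thesis by simp
  qed
  have "O' = generate (add_monoid B) S'"
  proof
    show "O' \<subseteq> generate (add_monoid B) S'"
    proof
      fix u assume "u \<in> O'"
      then obtain p q where "p \<in> \<O>" "q \<in> \<O>" "u = p \<oplus> q \<otimes> e0" by (auto simp: O'_def)
      then show "u \<in> generate (add_monoid B) S'" using generate.eng[of p "add_monoid B" S'] gen1 gen2 by auto
    qed
    show "generate (add_monoid B) S' \<subseteq> O'"
      using S'O' subring.axioms(1)[OF O'_subring] by (rule add.generate_subgroup_incl)
  qed
  moreover have "finite S'" using S(1) by (simp add: S'_def)
  ultimately have "is_order B O'"
    unfolding is_order_def using O'_subring S'O' \<O>_scale O_O' by blast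
  then have "O' = \<O>" using maximal_\<O> O_O' by (simp add: maximal_order_def)
  moreover have "\<Phi> e0 = 0 + 1 * e" by (simp add: e_def)
  then have "e0 \<in> O'" using O'_iff[OF e0(1)] Lc(1,6) by blast
  ultimately show ?thesis using ce e_def by blast
qed

sublocale quat_order L mT mD
proof
  have T: "mT x = t" if "x \<in> L" "mtr x = of_int t" for x t
    using L_integral(1)[OF that(1)] that(2) by simp
  have D: "mD x = t" if "x \<in> L" "mdet x = of_int t" for x t
    using L_integral(2)[OF that(1)] that(2) by simp
  note Lc = add_subgroupD[OF L_add_subgroup] L_mult L_one
  show "add_subgroup L" by (rule L_add_subgroup)
  show "1 \<in> L" by (rule L_one)
  show "x * y \<in> L" if "x \<in> L" "y \<in> L" for x y using that by (rule L_mult)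
  show "mT (x + y) = mT x + mT y" if "x \<in> L" "y \<in> L" for x y
    using T[OF Lc(4)[OF that]] L_integral(1)[OF that(1)] L_integral(1)[OF that(2)] by (simp add: mtr_add)
  show "mT 1 = 2" by (rule T) (simp_all add: mtr_def L_one)
  show "mT (x * y) = mT (y * x)" for x y by (simp add: mT_def mtr_def algebra_simps)
  show "x * x = mT x \<star> x - mD x \<star> 1" if "x \<in> L" for x using L_integral[OF that] by (rule m2_cayley)
  show "mD (x * y) = mD x * mD y" if "x \<in> L" "y \<in> L" for x y
    using D[OF L_mult[OF that]] L_integral(2)[OF that(1)] L_integral(2)[OF that(2)] by (simp add: mdet_mult)
  \<comment> \<open>The inverse of a nonzero element may lie outside \<open>\<O>\<close>, but the
    determinant is multiplicative on all of \<open>m2\<close>.\<close>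
  show "x = 0" if "x \<in> L" "mD x = 0" for x
  proof (rule ccontr)
    assume "x \<noteq> 0"
    from that(1) obtain x' where x': "x' \<in> \<O>" "x = \<Phi> x'" by blast
    then have "x' \<in> Units B" using \<open>x \<noteq> 0\<close> \<Phi>_zero \<O>_carrier Units_B by auto
    then obtain y where "y \<in> carrier B" "x' \<otimes> y = \<one>" by (auto simp: Units_def)
    then have "x * \<Phi> y = 1" using x' \<Phi>_mult \<O>_carrier \<Phi>_one by metis
    then have "mdet x * mdet (\<Phi> y) = 1" by (simp add: mdet_mult[symmetric]) (simp add: mdet_def)
    then show False using L_integral(2)[OF that(1)] that(2) by simp
  qed
  show "\<exists>x\<in>L. \<exists>y\<in>L. x * y \<noteq> y * x"
  proof -
    obtain x y where xy: "x \<in> carrier B" "y \<in> carrier B" "\<Phi> x * \<Phi> y \<noteq> \<Phi> y * \<Phi> x"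
      using \<Phi>_noncomm by blast
    obtain m :: nat where m: "m > 0" "[m] \<cdot> x \<in> \<O>" using \<O>_scale xy by blast
    obtain n :: nat where n: "n > 0" "[n] \<cdot> y \<in> \<O>" using \<O>_scale xy by blast
    have "\<Phi> ([m] \<cdot> x) * \<Phi> ([n] \<cdot> y) = (int m * int n) \<star> (\<Phi> x * \<Phi> y)"
      "\<Phi> ([n] \<cdot> y) * \<Phi> ([m] \<cdot> x) = (int m * int n) \<star> (\<Phi> y * \<Phi> x)"
      using xy by (simp_all add: \<Phi>_nat sm_simps mult.commute)
    moreover have "int m * int n \<noteq> 0" using m n by simp
    ultimately have "\<Phi> ([m] \<cdot> x) * \<Phi> ([n] \<cdot> y) \<noteq> \<Phi> ([n] \<cdot> y) * \<Phi> ([m] \<cdot> x)"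
      using sm_m2_cancel xy(3) by metis
    then show ?thesis using m n by blast
  qed
  show "\<exists>w\<in>L. c = d \<star> w"
    if "c \<in> L" "d \<noteq> 0" "\<And>x. x \<in> L \<Longrightarrow> \<exists>p\<in>L. \<exists>q\<in>L. c * x = d \<star> p + q * c"
      "\<exists>p\<in>L. \<exists>q\<in>L. c * c = (d * d) \<star> p + d \<star> (q * c)" for c d
    using that by (rule maximal_L)
qed

end

lemma embedding_exists:
  assumes "quaternion_algebra B" "division_algebra B" "maximal_order B \<O>"
  shows "\<exists>\<Phi>. embedded_order B \<O> \<Phi>"
proof -
  obtain a b where R: "Ring.ring B" and ab: "a \<noteq> 0" "b \<noteq> 0" "B \<simeq> quat_ring a b"
    using assms(1) by (auto simp: quaternion_algebra_def)
  then obtain h where h: "h \<in> ring_iso B (quat_ring a b)" by (auto simp: is_ring_iso_def)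
  interpret Ring.ring B by (rule R)
  have hom: "h (x \<oplus>\<^bsub>B\<^esub> y) = quat_add (h x) (h y)" "h (x \<otimes>\<^bsub>B\<^esub> y) = quat_mult a b (h x) (h y)"
    if "x \<in> carrier B" "y \<in> carrier B" for x y
    using ring_iso_memE(2,3)[OF h that] by (simp_all add: quat_ring_def)
  have one: "h \<one>\<^bsub>B\<^esub> = (1, 0, 0, 0)" using ring_iso_memE(4)[OF h] by (simp add: quat_ring_def)
  have bij: "bij_betw h (carrier B) UNIV" using ring_iso_memE(5)[OF h] by (simp add: quat_ring_def)
  have surj: "\<exists>x\<in>carrier B. h x = y" for y using bij by (metis UNIV_I bij_betw_iff_bijections)
  have "embedded_order B \<O> (\<lambda>x. emb a b (h x))"
  proof
    show "inj_on (\<lambda>x. emb a b (h x)) (carrier B)"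
      using inj_onD[OF bij_betw_imp_inj_on[OF bij]] injD[OF emb_inj[OF ab(1,2)]] by (meson inj_onI)
    show "\<exists>y\<in>carrier B. n \<star> emb a b (h y) = emb a b (h x)" if "n \<noteq> 0" for x n
      using emb_div[OF that, of a b "h x"] surj by metis
    show "\<exists>x\<in>carrier B. \<exists>y\<in>carrier B. emb a b (h x) * emb a b (h y) \<noteq> emb a b (h y) * emb a b (h x)"
    proof -
      obtain x y where xy: "x \<in> carrier B" "h x = (0, 1, 0, 0)" "y \<in> carrier B" "h y = (0, 0, 1, 0)"
        using surj by metis
      have "quat_mult a b (h x) (h y) \<noteq> quat_mult a b (h y) (h x)" by (simp add: xy)
      then have "emb a b (quat_mult a b (h x) (h y)) \<noteq> emb a b (quat_mult a b (h y) (h x))"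
        using emb_inj[OF ab(1,2)] by (auto dest: injD)
      then show ?thesis unfolding emb_mult using xy by blast
    qed
    show "Units B = carrier B - {\<zero>\<^bsub>B\<^esub>}" using assms(2) by (simp add: division_algebra_def)
  qed (use assms(3) in \<open>auto simp: hom one emb_add emb_mult emb_one emb_trace\<close>)
  then show ?thesis by blast
qed

section \<open>Dihedral groups of automorphisms\<close>

context quat_order
begin

text \<open>Faithfulness is expressed on \<open>L\<close>, as nothing is said about the maps outside
  it. Relations between automorphisms become arithmetic modulo \<open>n\<close> in the model
  group.\<close>

definition dihedral_action :: "nat \<Rightarrow> (int \<times> bool \<Rightarrow> 'a \<Rightarrow> 'a) \<Rightarrow> bool" where
  "dihedral_action n \<theta> \<longleftrightarrow>
     (\<forall>p\<in>carrier (dihedral_group n). aut (\<theta> p)) \<and>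
     (\<forall>p\<in>carrier (dihedral_group n). \<forall>q\<in>carrier (dihedral_group n). \<forall>x\<in>L.
        \<theta> (p \<otimes>\<^bsub>dihedral_group n\<^esub> q) x = \<theta> p (\<theta> q x)) \<and>
     (\<forall>p\<in>carrier (dihedral_group n). \<forall>q\<in>carrier (dihedral_group n).
        (\<forall>x\<in>L. \<theta> p x = \<theta> q x) \<longrightarrow> p = q)"

abbreviation FixD :: "int \<Rightarrow> nat \<Rightarrow> (int \<times> bool \<Rightarrow> 'a \<Rightarrow> 'a) \<Rightarrow> 'a set" where
  "FixD N n \<theta> \<equiv> Fix N (\<theta> ` carrier (dihedral_group n))"

context
  fixes n :: nat and \<theta> :: "int \<times> bool \<Rightarrow> 'a \<Rightarrow> 'a"
  assumes act: "dihedral_action n \<theta>" and n: "n > 0"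
begin

lemma carrier_iff: "(u, e) \<in> carrier (dihedral_group n) \<longleftrightarrow> 0 \<le> u \<and> u < int n"
  by (auto simp: dihedral_group_def)

lemma act_aut: "0 \<le> u \<Longrightarrow> u < int n \<Longrightarrow> aut (\<theta> (u, e))"
  using act by (auto simp: dihedral_action_def dihedral_group_def)

lemma act_mult:
  "0 \<le> u \<Longrightarrow> u < int n \<Longrightarrow> 0 \<le> v \<Longrightarrow> v < int n \<Longrightarrow> x \<in> L \<Longrightarrow>
    \<theta> (u, e) (\<theta> (v, f) x) = \<theta> ((if e then u - v else u + v) mod int n, e \<noteq> f) x"
proof -
  assume "0 \<le> u" "u < int n" "0 \<le> v" "v < int n" and x: "x \<in> L"
  then have "(u, e) \<in> carrier (dihedral_group n)" "(v, f) \<in> carrier (dihedral_group n)"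
    by (simp_all add: carrier_iff)
  then have "\<theta> ((u, e) \<otimes>\<^bsub>dihedral_group n\<^esub> (v, f)) x = \<theta> (u, e) (\<theta> (v, f) x)"
    using act x unfolding dihedral_action_def by blast
  then show ?thesis by (simp add: dihedral_group_def)
qed

lemma act_inj:
  "0 \<le> u \<Longrightarrow> u < int n \<Longrightarrow> 0 \<le> v \<Longrightarrow> v < int n \<Longrightarrow> (u, e) \<noteq> (v, f) \<Longrightarrow>
    \<exists>x\<in>L. \<theta> (u, e) x \<noteq> \<theta> (v, f) x"
  using act unfolding dihedral_action_def by (metis carrier_iff)

text \<open>The map \<open>\<theta> (0, False)\<close> is idempotent and injective on
  \<open>L\<close>.\<close>

lemma act_one: "x \<in> L \<Longrightarrow> \<theta> (0, False) x = x"
proof -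
  assume x: "x \<in> L"
  have a: "aut (\<theta> (0, False))" using act_aut n by simp
  have "\<theta> (0, False) (\<theta> (0, False) x - x) = 0"
    using x n act_mult[of 0 0 x False False] autD(1,8)[OF a] by simp
  then show ?thesis using autD(5)[OF a, of "\<theta> (0, False) x - x"] x autD(1)[OF a x] by simp
qed

lemma act_invol:
  assumes u: "0 \<le> u" "u < int n"
  shows "invol (\<theta> (u, True))"
  unfolding invol_def
proof (intro conjI ballI)
  show "aut (\<theta> (u, True))" using act_aut u by blast
  show "\<theta> (u, True) (\<theta> (u, True) x) = x" if "x \<in> L" for x
    using act_mult[OF u u that, of True True] act_one[OF that] by simp
  show "\<exists>x\<in>L. \<theta> (u, True) x \<noteq> x"
    using act_inj[OF u, of 0 True False] n act_one by auto
qed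

lemma FixD_subset: "S \<subseteq> carrier (dihedral_group n) \<Longrightarrow> FixD N n \<theta> \<subseteq> Fix N (\<theta> ` S)"
  by (auto simp: Fix_def)

lemma one_in_FixD: "1 \<in> FixD N n \<theta>"
  using act by (intro one_in_Fix) (auto simp: dihedral_action_def)

lemma FixD_two:
  assumes u: "0 \<le> u" "u < int n" "0 \<le> v" "v < int n"
  shows "FixD N n \<theta> \<subseteq> Fix N {\<theta> (u, e), \<theta> (v, f)}"
  using FixD_subset[of "{(u, e), (v, f)}" N] u by (simp add: carrier_iff)

text \<open>\<open>\<sigma>\<close> and \<open>\<sigma>\<rho>\<close> generate the dihedral group.\<close>

lemma FixD_eq: "FixD N n \<theta> = Fix N {\<theta> (0, True), \<theta> ((- 1) mod int n, True)}"
proof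
  have m: "0 \<le> (- 1) mod int n" "(- 1) mod int n < int n" using n by simp_all
  show "FixD N n \<theta> \<subseteq> Fix N {\<theta> (0, True), \<theta> ((- 1) mod int n, True)}"
    using n m by (intro FixD_two) auto
  show "Fix N {\<theta> (0, True), \<theta> ((- 1) mod int n, True)} \<subseteq> FixD N n \<theta>"
  proof
    fix x assume "x \<in> Fix N {\<theta> (0, True), \<theta> ((- 1) mod int n, True)}"
    then have x: "x \<in> L" "\<theta> (0, True) x - x \<in> NL N" "\<theta> ((- 1) mod int n, True) x - x \<in> NL N"
      by (auto simp: Fix_def)
    \<comment> \<open>The product of the two reflections is the rotation by 1, since the first
      components give \<open>0 - (- 1)\<close>. Its powers are all rotations, and one reflection
      supplies the rest.\<close>
    have rot: "\<theta> (int k mod int n, False) x - x \<in> NL N" for k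
    proof (induction k)
      case 0
      then show ?case using act_one[OF x(1)] NL_closed(1) by simp
    next
      case (Suc k)
      let ?k = "int k mod int n"
      have k: "0 \<le> ?k" "?k < int n" using n by simp_all
      have kL: "\<theta> (?k, False) x \<in> L" using autD(1)[OF act_aut[OF k] x(1)] .
      have "\<theta> ((- 1) mod int n, True) (\<theta> (?k, False) x) - x \<in> NL N"
        by (rule Fix_comp[OF act_aut[OF m] x(1) kL x(3) Suc])
      then have "\<theta> (0, True) (\<theta> ((- 1) mod int n, True) (\<theta> (?k, False) x)) - x \<in> NL N"
        using n by (intro Fix_comp[OF act_aut x(1) _ x(2)] autD(1)[OF act_aut[OF m] kL]) auto
      moreover have "\<theta> (0, True) (\<theta> ((- 1) mod int n, True) (\<theta> (?k, False) x)) =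
          \<theta> (int (Suc k) mod int n, False) x"
        using n act_mult[OF _ _ m kL, of 0 True True] act_mult[OF _ _ k x(1), of "1 mod int n" False False]
        by (simp add: mod_simps add.commute)
      ultimately show ?case by simp
    qed
    have "\<theta> p x - x \<in> NL N" if "p \<in> carrier (dihedral_group n)" for p
    proof -
      obtain u e where p: "p = (u, e)" by (cases p)
      have u: "0 \<le> u" "u < int n" using that by (simp_all add: p carrier_iff)
      have r: "\<theta> (u, False) x - x \<in> NL N" using rot[of "nat u"] u by simp
      show ?thesis
      proof (cases e)
        case True
        have s: "\<theta> (0, True) x \<in> L" using n autD(1)[OF act_aut x(1)] by simp
        have "\<theta> (u, False) (\<theta> (0, True) x) - x \<in> NL N"
          by (rule Fix_comp[OF act_aut[OF u] x(1) s r x(2)])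
        moreover have "\<theta> (u, False) (\<theta> (0, True) x) = \<theta> (u, True) x"
          using act_mult[OF u, of 0 x False True] n x(1) u by simp
        ultimately show ?thesis using p True by simp
      qed (use r p in simp)
    qed
    then show "x \<in> FixD N n \<theta>" using x(1) by (auto simp: Fix_def)
  qed
qed

text \<open>For even \<open>n\<close> the rotation by \<open>n div 2\<close> is central, so a
  reflection and its product with this rotation generate a Klein four-group.\<close>

lemma zbasis_FixD_klein:
  assumes "even n" "odd N"
  shows "zbasis N (FixD N n \<theta>) (NL N) 1 (\<lambda>_. 1)"
proof -
  let ?m = "int n div 2"
  have m: "0 < ?m" "?m < int n" "int n = 2 * ?m" using n assms(1) by (auto elim!: evenE)
  have "- ?m = ?m - int n" using m(3) by linarith
  then have "- ?m mod int n = (?m - int n) mod int n" by (simp only:)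
  also have "\<dots> = ?m" using m(1,2) by simp
  finally have "- ?m mod int n = ?m" .
  show ?thesis
  proof (rule zbasis_klein_odd[OF _ _ _ _ _ one_in_FixD assms(2)])
    show "invol (\<theta> (0, True))" "invol (\<theta> (?m, True))" using m n by (auto intro!: act_invol)
    show "\<exists>y\<in>L. \<theta> (0, True) y \<noteq> \<theta> (?m, True) y" using m by (intro act_inj) auto
    show "\<theta> (0, True) (\<theta> (?m, True) y) = \<theta> (?m, True) (\<theta> (0, True) y)" if "y \<in> L" for y
      using that m n \<open>- ?m mod int n = ?m\<close> by (simp add: act_mult)
    show "FixD N n \<theta> \<subseteq> Fix N {\<theta> (0, True), \<theta> (?m, True)}" using m n by (intro FixD_two) auto
  qed
qed

end

lemma zbasis_FixD_1_odd:
  assumes "dihedral_action 1 \<theta>" "odd N"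
  shows "\<exists>e. zbasis N (FixD N 1 \<theta>) (NL N) 2 e"
  using zbasis_Fix_invol_odd[OF act_invol[OF assms(1)] assms(2)] FixD_eq[OF assms(1)] by simp

lemma zbasis_FixD_1_2:
  assumes "dihedral_action 1 \<theta>"
  shows "\<exists>k e. k \<in> {2, 3, 4} \<and> zbasis 2 (FixD 2 1 \<theta>) (NL 2) k e"
  using zbasis_Fix_invol_2[OF act_invol[OF assms(1)]] FixD_eq[OF assms(1)] by simp

lemma zbasis_FixD_2_2:
  assumes "dihedral_action 2 \<theta>"
  shows "\<exists>k e. k \<in> {2, 3} \<and> zbasis 2 (FixD 2 2 \<theta>) (NL 2) k e"
proof -
  note act = assms and n = zero_less_numeral[where 'a = nat]
  have "FixD 2 2 \<theta> = Fix 2 {\<theta> (0, True), \<theta> (1, True)}" using FixD_eq[OF act] by simp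
  moreover have "\<exists>k e. k \<in> {2, 3} \<and> zbasis 2 (Fix 2 {\<theta> (0, True), \<theta> (1, True)}) (NL 2) k e"
    by (intro zbasis_klein_2 act_invol[OF act n] act_inj[OF act n]) (auto simp: act_mult[OF act n])
  ultimately show ?thesis by simp
qed

lemma S3_relation:
  assumes act: "dihedral_action 3 \<theta>" and y: "y \<in> L"
  shows "\<theta> (0, True) (\<theta> (2, True) (\<theta> (0, True) y)) = \<theta> (2, True) (\<theta> (0, True) (\<theta> (2, True) y))"
  using y by (simp add: act_mult[OF act] autD(1)[OF act_aut[OF act]])

lemma zbasis_FixD_3_coprime:
  assumes act: "dihedral_action 3 \<theta>" and N: "coprime N 2" "coprime N 3"
  shows "zbasis N (FixD N 3 \<theta>) (NL N) 1 (\<lambda>_. 1)"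
  by (rule zbasis_S3_coprime[OF act_invol[OF act] act_invol[OF act] act_inj[OF act] S3_relation[OF act]
        FixD_two[OF act] one_in_FixD[OF act] N]) simp_all

lemma zbasis_FixD_3_2:
  assumes act: "dihedral_action 3 \<theta>"
  shows "zbasis 2 (FixD 2 3 \<theta>) (NL 2) 1 (\<lambda>_. 1)"
  by (rule zbasis_S3_2[OF act_invol[OF act] act_invol[OF act] act_inj[OF act] S3_relation[OF act]
        FixD_two[OF act] one_in_FixD[OF act]]) simp_all

lemma zbasis_FixD_3_3:
  assumes act: "dihedral_action 3 \<theta>"
  shows "\<exists>k e. k \<in> {1, 2} \<and> zbasis 3 (FixD 3 3 \<theta>) (NL 3) k e"
proof -
  have "FixD 3 3 \<theta> = Fix 3 {\<theta> (0, True), \<theta> (2, True)}" using FixD_eq[OF act] by simp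
  moreover have "\<exists>k e. k \<in> {1, 2} \<and> zbasis 3 (Fix 3 {\<theta> (0, True), \<theta> (2, True)}) (NL 3) k e"
    by (rule zbasis_S3_3[OF act_invol[OF act] act_invol[OF act] act_inj[OF act] S3_relation[OF act]]) simp_all
  ultimately show ?thesis by simp
qed

text \<open>\<open>(0, True)\<close> and \<open>(2, True)\<close> differ by a rotation of order 3
  and generate a dihedral subgroup of order 6. Its fixed points modulo 2 are already spanned by 1,
  which the whole group fixes.\<close>

lemma zbasis_FixD_6_2:
  assumes act: "dihedral_action 6 \<theta>"
  shows "zbasis 2 (FixD 2 6 \<theta>) (NL 2) 1 (\<lambda>_. 1)"
proof -
  have "\<theta> (0, True) (\<theta> (2, True) (\<theta> (0, True) y)) = \<theta> (2, True) (\<theta> (0, True) (\<theta> (2, True) y))"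
    if "y \<in> L" for y using that by (simp add: act_mult[OF act] autD(1)[OF act_aut[OF act]])
  from zbasis_S3_2[OF act_invol[OF act] act_invol[OF act] act_inj[OF act] this
      FixD_two[OF act] one_in_FixD[OF act]] show ?thesis by simp
qed

lemma zbasis_FixD_4_2:
  assumes act: "dihedral_action 4 \<theta>"
  shows "\<exists>e. zbasis 2 (FixD 2 4 \<theta>) (NL 2) 2 e"
proof -
  have "FixD 2 4 \<theta> = Fix 2 {\<theta> (0, True), \<theta> (3, True)}" using FixD_eq[OF act] by simp
  moreover have "\<exists>e. zbasis 2 (Fix 2 {\<theta> (0, True), \<theta> (3, True)}) (NL 2) 2 e"
  proof (rule zbasis_D4_2[OF act_invol[OF act] act_invol[OF act]])
    have "\<exists>y\<in>L. \<theta> (1, False) y \<noteq> \<theta> (3, False) y" by (rule act_inj[OF act]) simp_all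
    then show "\<exists>y\<in>L. \<theta> (0, True) (\<theta> (3, True) y) \<noteq> \<theta> (3, True) (\<theta> (0, True) y)"
      by (auto simp: act_mult[OF act])
  qed (auto simp: act_mult[OF act] autD(1)[OF act_aut[OF act]])
  ultimately show ?thesis by simp
qed

end

section \<open>Transport of automorphisms and cosets between the order and its matrix image\<close>

context embedded_order
begin

abbreviation OR where "OR \<equiv> B\<lparr>carrier := \<O>\<rparr>"

lemma ring_R: "Ring.ring OR"
  by (rule subring_is_ring[OF subring_\<O>])

lemma inj_\<O>: "inj_on \<Phi> \<O>"
  using inj \<O>_carrier by (meson inj_on_subset subsetI)

definition transport :: "('a \<Rightarrow> 'a) \<Rightarrow> m2 \<Rightarrow> m2" where
  "transport g y = \<Phi> (g (inv_into \<O> \<Phi> y))"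

lemma transport_\<Phi>: "x \<in> \<O> \<Longrightarrow> transport g (\<Phi> x) = \<Phi> (g x)"
  by (simp add: transport_def inv_into_f_f[OF inj_\<O>])

lemma ring_autoD:
  assumes "g \<in> ring_auto OR"
  shows "x \<in> \<O> \<Longrightarrow> g x \<in> \<O>" "x \<in> \<O> \<Longrightarrow> y \<in> \<O> \<Longrightarrow> g (x \<oplus> y) = g x \<oplus> g y"
    "x \<in> \<O> \<Longrightarrow> y \<in> \<O> \<Longrightarrow> g (x \<otimes> y) = g x \<otimes> g y" "g \<one> = \<one>" "inj_on g \<O>" "g \<in> extensional \<O>" "g \<in> Bij \<O>"
proof -
  have g: "g \<in> Ring.ring_hom OR OR" "g \<in> Bij \<O>" using assms by (auto simp: ring_auto_def)
  show "x \<in> \<O> \<Longrightarrow> g x \<in> \<O>" "x \<in> \<O> \<Longrightarrow> y \<in> \<O> \<Longrightarrow> g (x \<oplus> y) = g x \<oplus> g y"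
    "x \<in> \<O> \<Longrightarrow> y \<in> \<O> \<Longrightarrow> g (x \<otimes> y) = g x \<otimes> g y" "g \<one> = \<one>"
    using ring_hom_memE[OF g(1)] by simp_all
  show "inj_on g \<O>" "g \<in> extensional \<O>" "g \<in> Bij \<O>" using g(2) by (auto simp: Bij_def bij_betw_def)
qed

lemma aut_transport:
  assumes g: "g \<in> ring_auto OR"
  shows "aut (transport g)"
proof -
  note gD = ring_autoD[OF g]
  have add: "transport g (\<Phi> x + \<Phi> y) = transport g (\<Phi> x) + transport g (\<Phi> y)" if "x \<in> \<O>" "y \<in> \<O>" for x y
    using that by (simp add: \<Phi>_add[symmetric] \<O>_carrier transport_\<Phi> \<O>_closed(3) gD)
  have g0: "g \<zero> = \<zero>"
  proof -
    have "transport g 0 = 0" using add[OF \<O>_closed(1,1)] by (simp add: \<Phi>_zero)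
    then have "\<Phi> (g \<zero>) = 0" using transport_\<Phi>[OF \<O>_closed(1), of g] by (simp add: \<Phi>_zero)
    then show ?thesis using inj_onD[OF inj_\<O>, of "g \<zero>" \<zero>] gD(1) \<O>_closed(1) \<Phi>_zero by simp
  qed
  have "x = 0" if "x \<in> L" "transport g x = 0" for x
  proof -
    from that(1) obtain x' where x': "x' \<in> \<O>" "x = \<Phi> x'" by blast
    then have "\<Phi> (g x') = \<Phi> \<zero>" using that(2) by (simp add: transport_\<Phi> \<Phi>_zero)
    then have "g x' = g \<zero>" using inj_onD[OF inj_\<O>] gD(1) x' \<O>_closed(1) g0 by metis
    then have "x' = \<zero>" using inj_onD[OF gD(5)] x' \<O>_closed(1) by metis
    then show ?thesis using x' \<Phi>_zero by simp
  qed
  moreover have "transport g (x * y) = transport g x * transport g y" if "x \<in> L" "y \<in> L" for x y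
  proof -
    obtain x' y' where "x' \<in> \<O>" "y' \<in> \<O>" "x = \<Phi> x'" "y = \<Phi> y'" using \<open>x \<in> L\<close> \<open>y \<in> L\<close> by blast
    then show ?thesis by (simp add: \<Phi>_mult[symmetric] \<O>_carrier transport_\<Phi> \<O>_closed(4) gD)
  qed
  moreover have "transport g 1 = 1"
    using transport_\<Phi>[OF \<O>_closed(2), of g] \<Phi>_one gD(4) by simp
  ultimately show ?thesis
    unfolding aut_def using add gD(1) by (auto simp: transport_\<Phi>)
qed

lemma transport_compose: "h \<in> ring_auto OR \<Longrightarrow> x \<in> L \<Longrightarrow>
    transport (compose \<O> g h) x = transport g (transport h x)"
  by (auto simp: transport_\<Phi> compose_def ring_autoD)

lemma transport_inj:
  assumes g: "g \<in> ring_auto OR" and h: "h \<in> ring_auto OR" and e: "\<And>x. x \<in> L \<Longrightarrow> transport g x = transport h x"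
  shows "g = h"
proof (rule extensionalityI[OF ring_autoD(6)[OF g] ring_autoD(6)[OF h]])
  fix x assume x: "x \<in> \<O>"
  then have "\<Phi> (g x) = \<Phi> (h x)" using e[of "\<Phi> x"] by (simp add: transport_\<Phi>)
  then show "g x = h x" using inj_onD[OF inj_\<O>] ring_autoD(1)[OF g x] ring_autoD(1)[OF h x] by blast
qed

text \<open>The given isomorphism goes from \<open>G\<close> to the model group; its inverse
  \<open>\<phi>\<close> indexes \<open>G\<close>. Multiplication in \<open>G\<close> is composition
  restricted to \<open>\<O>\<close>, so transport turns \<open>\<phi>\<close> into an action on
  \<open>L\<close>.\<close>

lemma dihedral_action_exists:
  assumes sub: "subgroup G (RingAutoGroup OR)" and iso: "(RingAutoGroup OR)\<lparr>carrier := G\<rparr> \<cong> dihedral_group n"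
  shows "\<exists>\<theta>. dihedral_action n \<theta> \<and> \<theta> ` carrier (dihedral_group n) = transport ` G"
proof -
  let ?D = "dihedral_group n" and ?A = "(RingAutoGroup OR)\<lparr>carrier := G\<rparr>"
  obtain \<psi> where \<psi>: "\<psi> \<in> hom ?A ?D" "bij_betw \<psi> G (carrier ?D)"
    using iso by (auto simp: is_iso_def iso_def)
  have GA: "G \<subseteq> ring_auto OR" using subgroup.subset[OF sub] by (simp add: RingAutoGroup_def)
  have mult: "g \<otimes>\<^bsub>RingAutoGroup OR\<^esub> h = compose \<O> g h" if "g \<in> G" "h \<in> G" for g h
    using that GA ring_autoD(7) by (simp add: RingAutoGroup_def BijGroup_def subset_iff)
  have Gm: "compose \<O> g h \<in> G" if "g \<in> G" "h \<in> G" for g h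
    using subgroup.m_closed[OF sub that] mult[OF that] by simp
  define \<phi> where "\<phi> = inv_into G \<psi>"
  have \<phi>: "bij_betw \<phi> (carrier ?D) G" unfolding \<phi>_def by (rule bij_betw_inv_into[OF \<psi>(2)])
  have \<phi>G: "\<phi> p \<in> G" if "p \<in> carrier ?D" for p using bij_betwE[OF \<phi>] that by blast
  have \<psi>\<phi>: "\<psi> (\<phi> p) = p" if "p \<in> carrier ?D" for p
    unfolding \<phi>_def using f_inv_into_f[of p \<psi> G] that bij_betw_imp_surj_on[OF \<psi>(2)] by simp
  have \<phi>m: "\<phi> (p \<otimes>\<^bsub>?D\<^esub> q) = compose \<O> (\<phi> p) (\<phi> q)" if "p \<in> carrier ?D" "q \<in> carrier ?D" for p q
  proof -
    have "\<psi> (compose \<O> (\<phi> p) (\<phi> q)) = \<psi> (\<phi> p) \<otimes>\<^bsub>?D\<^esub> \<psi> (\<phi> q)"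
      using \<psi>(1) \<phi>G[OF that(1)] \<phi>G[OF that(2)] mult by (fastforce simp: hom_def)
    then have "\<psi> (compose \<O> (\<phi> p) (\<phi> q)) = p \<otimes>\<^bsub>?D\<^esub> q" using that \<psi>\<phi> by simp
    then show ?thesis using Gm[OF \<phi>G[OF that(1)] \<phi>G[OF that(2)]] \<psi>(2)
      unfolding \<phi>_def by (metis bij_betw_inv_into_left)
  qed
  have "dihedral_action n (\<lambda>p. transport (\<phi> p))"
    unfolding dihedral_action_def
  proof (intro conjI ballI impI)
    show "aut (transport (\<phi> p))" if "p \<in> carrier ?D" for p using aut_transport \<phi>G[OF that] GA by blast
    show "transport (\<phi> (p \<otimes>\<^bsub>?D\<^esub> q)) x = transport (\<phi> p) (transport (\<phi> q) x)"
      if "p \<in> carrier ?D" "q \<in> carrier ?D" "x \<in> L" for p q x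
      using \<phi>m[OF that(1,2)] transport_compose[OF _ that(3)] \<phi>G[OF that(2)] GA by auto
    show "p = q" if "p \<in> carrier ?D" "q \<in> carrier ?D" "\<forall>x\<in>L. transport (\<phi> p) x = transport (\<phi> q) x" for p q
    proof -
      have "\<phi> p = \<phi> q" using transport_inj[of "\<phi> p" "\<phi> q"] that \<phi>G GA by blast
      then show ?thesis using \<psi>\<phi> that by metis
    qed
  qed
  moreover have "(\<lambda>p. transport (\<phi> p)) ` carrier ?D = transport ` G"
    using bij_betw_imp_surj_on[OF \<phi>] by (metis image_image)
  ultimately show ?thesis by blast
qed

lemma \<Phi>_multiples: "\<Phi> ` multiples OR N = NL (int N)"
proof -
  have p: "[m] \<cdot>\<^bsub>OR\<^esub> x = [m] \<cdot> x" for x and m :: nat by (simp add: add_pow_def nat_pow_def)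
  have "\<Phi> ` multiples OR N = (\<lambda>x. \<Phi> ([N] \<cdot> x)) ` \<O>" by (simp add: multiples_def p image_image)
  also have "\<dots> = (\<lambda>x. int N \<star> \<Phi> x) ` \<O>" by (intro image_cong) (simp_all add: \<Phi>_nat \<O>_carrier)
  finally show ?thesis by (simp add: NL_def image_image)
qed

lemma multiples_subset: "multiples OR N \<subseteq> \<O>"
proof -
  interpret R: Ring.ring OR by (rule ring_R)
  show ?thesis using R.add.nat_pow_closed by (auto simp: multiples_def)
qed

definition ocoset :: "nat \<Rightarrow> 'a \<Rightarrow> 'a set" where "ocoset N x = multiples OR N +>\<^bsub>OR\<^esub> x"

lemma ocoset_image: "ocoset N x = (\<lambda>h. h \<oplus> x) ` multiples OR N"
  by (auto simp: ocoset_def a_r_coset_def')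

lemma \<Phi>_ocoset: "x \<in> \<O> \<Longrightarrow> \<Phi> ` ocoset N x = (+) (\<Phi> x) ` NL (int N)"
proof -
  assume x: "x \<in> \<O>"
  have "\<Phi> ` ocoset N x = (\<lambda>h. \<Phi> (h \<oplus> x)) ` multiples OR N" by (simp add: ocoset_image image_image)
  also have "\<dots> = (\<lambda>h. \<Phi> x + \<Phi> h) ` multiples OR N"
    using x subsetD[OF multiples_subset] by (intro image_cong) (auto simp: \<Phi>_add \<O>_carrier add.commute)
  finally show ?thesis by (simp add: image_image flip: \<Phi>_multiples)
qed

lemma ocoset_subset: "x \<in> \<O> \<Longrightarrow> ocoset N x \<subseteq> \<O>"
  using multiples_subset \<O>_closed(3) by (auto simp: ocoset_image)

lemma ocoset_eq_iff: "x \<in> \<O> \<Longrightarrow> y \<in> \<O> \<Longrightarrow> ocoset N x = ocoset N y \<longleftrightarrow> \<Phi> x - \<Phi> y \<in> NL (int N)"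
  using inj_on_image_eq_iff[OF inj_\<O> ocoset_subset ocoset_subset, of x y N N] \<Phi>_ocoset
    coset_eq_iff[OF NL_subgroup] by auto

lemma carrier_mod_ring: "carrier (mod_ring OR N) = ocoset N ` \<O>"
  by (auto simp: mod_ring_def FactRing_def A_RCOSETS_def' ocoset_def)

lemma ocoset_add: "x \<in> \<O> \<Longrightarrow> y \<in> \<O> \<Longrightarrow> ocoset N x \<oplus>\<^bsub>mod_ring OR N\<^esub> ocoset N y = ocoset N (x \<oplus> y)"
proof -
  assume xy: "x \<in> \<O>" "y \<in> \<O>"
  interpret R: Ring.ring OR by (rule ring_R)
  have "additive_subgroup (multiples OR N) OR"
  proof (rule additive_subgroup.intro, rule R.add.subgroupI)
    show "multiples OR N \<subseteq> carrier OR" using multiples_subset by simp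
    show "multiples OR N \<noteq> {}" using R.zero_closed by (auto simp: multiples_def)
    show "\<ominus>\<^bsub>OR\<^esub> a \<in> multiples OR N" if "a \<in> multiples OR N" for a
    proof -
      obtain a' where a': "a' \<in> carrier OR" "a = [N] \<cdot>\<^bsub>OR\<^esub> a'"
        using \<open>a \<in> multiples OR N\<close> unfolding multiples_def by blast
      then have "\<ominus>\<^bsub>OR\<^esub> a = [N] \<cdot>\<^bsub>OR\<^esub> (\<ominus>\<^bsub>OR\<^esub> a')" by (simp only: R.add.nat_pow_inv)
      then show ?thesis unfolding multiples_def using R.a_inv_closed[OF a'(1)] by blast
    qed
    show "a \<oplus>\<^bsub>OR\<^esub> b \<in> multiples OR N" if "a \<in> multiples OR N" "b \<in> multiples OR N" for a b
    proof -
      obtain a' b' where ab: "a' \<in> carrier OR" "b' \<in> carrier OR" "a = [N] \<cdot>\<^bsub>OR\<^esub> a'" "b = [N] \<cdot>\<^bsub>OR\<^esub> b'"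
        using \<open>a \<in> multiples OR N\<close> \<open>b \<in> multiples OR N\<close> unfolding multiples_def by blast
      then have "a \<oplus>\<^bsub>OR\<^esub> b = [N] \<cdot>\<^bsub>OR\<^esub> (a' \<oplus>\<^bsub>OR\<^esub> b')" by (simp only: R.add.nat_pow_distrib)
      then show ?thesis unfolding multiples_def using ab(1,2) R.a_closed by blast
    qed
  qed
  then have "abelian_subgroup (multiples OR N) OR" using R.abelian_group_axioms by (rule abelian_subgroupI3)
  then show ?thesis
    using abelian_subgroup.a_rcos_sum[of "multiples OR N" OR x y] xy
    by (simp add: mod_ring_def FactRing_def ocoset_def)
qed

lemma fixed_points_eq:
  assumes "G \<subseteq> ring_auto OR"
  shows "fixed_points OR N G = ocoset N ` {x \<in> \<O>. \<Phi> x \<in> Fix (int N) (transport ` G)}"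
proof -
  have *: "reduce_auto OR N g (ocoset N x) = ocoset N x \<longleftrightarrow> transport g (\<Phi> x) - \<Phi> x \<in> NL (int N)"
    if "x \<in> \<O>" "g \<in> G" for x g
  proof -
    have g: "g \<in> ring_auto OR" using assms that by blast
    have "reduce_auto OR N g (ocoset N x) = ocoset N (g x)"
      using reduce_auto_coset[OF ring_R g, of x N] that by (simp add: ocoset_def)
    then show ?thesis using ocoset_eq_iff[OF ring_autoD(1)[OF g that(1)] that(1)] that(1) by (simp add: transport_\<Phi>)
  qed
  then show ?thesis
    unfolding fixed_points_def carrier_mod_ring by (auto simp: Fix_def)
qed

text \<open>A coefficient function is sent to the coset of the corresponding combination of the
  \<open>e i\<close>. Bijectivity is \<open>zbasis_bij_betw\<close> read through
  \<open>\<Phi>\<close>; the map starts at \<open>zmod_power\<close> and is inverted at the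
  end.\<close>

lemma fixed_group_iso:
  assumes G: "G \<subseteq> ring_auto OR" and N: "N > 0"
    and e: "zbasis (int N) (Fix (int N) (transport ` G)) (NL (int N)) k e"
  shows "fixed_group OR N G \<cong> zmod_power N k"
proof -
  let ?F = "Fix (int N) (transport ` G)"
  have F: "add_subgroup ?F" using aut_transport G by (intro Fix_subgroup) auto
  have FL: "?F \<subseteq> L" by (auto simp: Fix_def)
  have Z: "Group.group (zmod_power N k)" unfolding zmod_power_def by (rule product_group) simp
  have cZ: "carrier (zmod_power N k) = PiE {..<k} (\<lambda>_. {0..<int N})"
    using N by (simp add: zmod_power_def carrier_integer_mod_group)
  define s where "s n = (\<Sum>i<k. of_int (n i) * e i)" for n :: "nat \<Rightarrow> int"
  have sF: "s n \<in> ?F" for n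
    unfolding s_def using zbasisD(1)[OF e]
    by (intro add_subgroup_sum[OF F] add_subgroup_of_int_mult[OF F]) auto
  define r where "r n = inv_into \<O> \<Phi> (s n)" for n
  have r: "r n \<in> \<O>" "\<Phi> (r n) = s n" for n
    using sF FL by (auto simp: r_def intro!: inv_into_into f_inv_into_f)
  have rbij: "bij_betw (\<lambda>n. (+) (s n) ` NL (int N)) (PiE {..<k} (\<lambda>_. {0..<int N})) (quo (NL (int N)) ?F)"
    unfolding s_def
  proof (rule zbasis_bij_betw[OF NL_subgroup F _ _ e])
    show "of_int (int N) * x \<in> NL (int N)" if "x \<in> ?F" for x using NL_of_int FL that by blast
  qed (use N in simp)
  have "bij_betw (\<lambda>n. ocoset N (r n)) (carrier (zmod_power N k)) (fixed_points OR N G)"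
    unfolding bij_betw_def
  proof
    show "inj_on (\<lambda>n. ocoset N (r n)) (carrier (zmod_power N k))"
      using bij_betw_imp_inj_on[OF rbij] unfolding cZ inj_on_def
      by (simp add: ocoset_eq_iff r coset_eq_iff[OF NL_subgroup])
    show "(\<lambda>n. ocoset N (r n)) ` carrier (zmod_power N k) = fixed_points OR N G"
    proof
      show "(\<lambda>n. ocoset N (r n)) ` carrier (zmod_power N k) \<subseteq> fixed_points OR N G"
        using sF by (auto simp: fixed_points_eq[OF G] r)
      show "fixed_points OR N G \<subseteq> (\<lambda>n. ocoset N (r n)) ` carrier (zmod_power N k)"
      proof
        fix C assume "C \<in> fixed_points OR N G"
        then obtain x where x: "x \<in> \<O>" "\<Phi> x \<in> ?F" "C = ocoset N x" by (auto simp: fixed_points_eq[OF G])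
        then have "(+) (\<Phi> x) ` NL (int N) \<in> quo (NL (int N)) ?F" by (auto simp: quo_def)
        then have "(+) (\<Phi> x) ` NL (int N) \<in> (\<lambda>n. (+) (s n) ` NL (int N)) ` carrier (zmod_power N k)"
          unfolding cZ bij_betw_imp_surj_on[OF rbij] .
        then obtain n where n: "n \<in> carrier (zmod_power N k)" "(+) (\<Phi> x) ` NL (int N) = (+) (s n) ` NL (int N)"
          by (elim imageE)
        then have "C = ocoset N (r n)" using x r by (simp add: ocoset_eq_iff coset_eq_iff[OF NL_subgroup])
        then show "C \<in> (\<lambda>n. ocoset N (r n)) ` carrier (zmod_power N k)" using n(1) by blast
      qed
    qed
  qed
  moreover have "ocoset N (r (n \<otimes>\<^bsub>zmod_power N k\<^esub> m)) = ocoset N (r n) \<oplus>\<^bsub>mod_ring OR N\<^esub> ocoset N (r m)" for n m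
  proof -
    \<comment> \<open>Addition in \<open>zmod_power\<close> reduces coefficients modulo
      \<open>N\<close>; the carries contribute only multiples of \<open>N\<close>.\<close>
    have "s (n \<otimes>\<^bsub>zmod_power N k\<^esub> m) - (s n + s m) =
        (\<Sum>i<k. of_int (- ((n i + m i) div int N)) * (of_int (int N) * e i))"
      unfolding s_def sum.distrib[symmetric] sum_subtractf[symmetric]
    proof (rule sum.cong)
      fix i assume "i \<in> {..<k}"
      then have "(n \<otimes>\<^bsub>zmod_power N k\<^esub> m) i = (n i + m i) - (n i + m i) div int N * int N"
        by (simp add: zmod_power_def minus_div_mult_eq_mod)
      then have q: "(n \<otimes>\<^bsub>zmod_power N k\<^esub> m) i = n i + m i + - ((n i + m i) div int N) * int N" by simp
      show "of_int ((n \<otimes>\<^bsub>zmod_power N k\<^esub> m) i) * e i - (of_int (n i) * e i + of_int (m i) * e i) =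
          of_int (- ((n i + m i) div int N)) * (of_int (int N) * e i)"
        unfolding q of_int_add of_int_mult by (simp add: distrib_right left_diff_distrib mult.assoc)
    qed simp
    also have "\<dots> \<in> NL (int N)"
    proof (rule add_subgroup_sum[OF NL_subgroup], rule add_subgroup_of_int_mult[OF NL_subgroup])
      fix i assume "i \<in> {..<k}"
      then have "e i \<in> L" using zbasisD(1)[OF e] FL by auto
      then show "of_int (int N) * e i \<in> NL (int N)" by (rule NL_of_int)
    qed
    finally have "ocoset N (r (n \<otimes>\<^bsub>zmod_power N k\<^esub> m)) = ocoset N (r n \<oplus> r m)"
      using r \<O>_closed(3) by (simp add: ocoset_eq_iff \<Phi>_add \<O>_carrier)
    then show ?thesis using r by (simp add: ocoset_add)
  qed
  ultimately have "(\<lambda>n. ocoset N (r n)) \<in> Group.iso (zmod_power N k) (fixed_group OR N G)"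
    by (auto simp: iso_def hom_def fixed_group_def bij_betw_def)
  then show ?thesis using group.iso_sym[OF Z] by (auto simp: is_iso_def)
qed

end

section \<open>Evaluation for each dihedral type\<close>

lemma zmod_power_1_iso: "N > 0 \<Longrightarrow> zmod_power N 1 \<cong> integer_mod_group N"
proof -
  assume N: "N > 0"
  have "(\<lambda>f. f 0) \<in> Group.iso (zmod_power N 1) (integer_mod_group N)"
    unfolding iso_def
  proof (intro CollectI conjI)
    show "(\<lambda>f. f 0) \<in> hom (zmod_power N 1) (integer_mod_group N)"
      by (auto simp: hom_def zmod_power_def)
    show "bij_betw (\<lambda>f. f 0) (carrier (zmod_power N 1)) (carrier (integer_mod_group N))"
      by (rule bij_betw_byWitness[where f' = "\<lambda>x. \<lambda>i\<in>{..<1}. x"])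
         (auto simp: zmod_power_def PiE_def extensional_def fun_eq_iff)
  qed
  then show ?thesis by (auto simp: is_iso_def)
qed

theorem theorem2p6:
  fixes B :: "('a, 'm) ring_scheme" and \<O> :: "'a set" and G :: "('a \<Rightarrow> 'a) set"
  defines "R \<equiv> B\<lparr>carrier := \<O>\<rparr>"
  defines "\<G> \<equiv> (RingAutoGroup R)\<lparr>carrier := G\<rparr>"
  assumes "quaternion_algebra B" and "indefinite B" and "division_algebra B"
    and "maximal_order B \<O>"
    and "subgroup G (RingAutoGroup R)"
    and "\<exists>n\<in>{1, 2, 3, 4, 6}. \<G> \<cong> dihedral_group n"
  shows
    "(\<forall>N\<ge>1. coprime N 2 \<and> coprime N 3 \<longrightarrow>
        (\<G> \<cong> dihedral_group 1 \<longrightarrow> fixed_group R N G \<cong> zmod_power N 2) \<and>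
        ((\<exists>n\<in>{2, 3, 4, 6}. \<G> \<cong> dihedral_group n) \<longrightarrow> fixed_group R N G \<cong> integer_mod_group N))
     \<and>
     ((\<G> \<cong> dihedral_group 1 \<longrightarrow> fixed_group R 3 G \<cong> zmod_power 3 2) \<and>
      ((\<exists>n\<in>{2, 4, 6}. \<G> \<cong> dihedral_group n) \<longrightarrow> fixed_group R 3 G \<cong> integer_mod_group 3) \<and>
      (\<G> \<cong> dihedral_group 3 \<longrightarrow>
         fixed_group R 3 G \<cong> integer_mod_group 3 \<or> fixed_group R 3 G \<cong> zmod_power 3 2))
     \<and>
     ((\<G> \<cong> dihedral_group 1 \<longrightarrow>
         fixed_group R 2 G \<cong> zmod_power 2 2 \<or> fixed_group R 2 G \<cong> zmod_power 2 3 \<or>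
         fixed_group R 2 G \<cong> zmod_power 2 4) \<and>
      (\<G> \<cong> dihedral_group 2 \<longrightarrow>
         fixed_group R 2 G \<cong> zmod_power 2 2 \<or> fixed_group R 2 G \<cong> zmod_power 2 3) \<and>
      (\<G> \<cong> dihedral_group 4 \<longrightarrow> fixed_group R 2 G \<cong> zmod_power 2 2) \<and>
      ((\<exists>n\<in>{3, 6}. \<G> \<cong> dihedral_group n) \<longrightarrow> fixed_group R 2 G \<cong> integer_mod_group 2))"
proof -
  obtain \<Phi> where "embedded_order B \<O> \<Phi>"
    using embedding_exists assms(3,5,6) by blast
  then interpret embedded_order B \<O> \<Phi> .
  have G: "G \<subseteq> ring_auto R"
    using subgroup.subset[OF assms(7)] by (simp add: RingAutoGroup_def)
  have sub: "subgroup G (RingAutoGroup (B\<lparr>carrier := \<O>\<rparr>))" using assms(7) by (simp add: R_def)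
  have act: "\<exists>\<theta>. dihedral_action n \<theta> \<and> \<theta> ` carrier (dihedral_group n) = transport ` G"
    if "\<G> \<cong> dihedral_group n" for n
    using dihedral_action_exists[OF sub, of n] that by (simp add: \<G>_def R_def)
  have fg: "fixed_group R N G \<cong> zmod_power N k"
    if "zbasis (int N) (Fix (int N) (transport ` G)) (NL (int N)) k e" "N > 0" for N k e
    using fixed_group_iso[of G N k e] G that by (simp add: R_def)
  have fg1: "fixed_group R N G \<cong> integer_mod_group N"
    if "zbasis (int N) (Fix (int N) (transport ` G)) (NL (int N)) 1 e" "N > 0" for N e
    using iso_trans[OF fg[OF that] zmod_power_1_iso[OF that(2)]] .
  have D1_odd: "fixed_group R N G \<cong> zmod_power N 2" if "\<G> \<cong> dihedral_group 1" "odd N" for N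
  proof -
    obtain \<theta> where \<theta>: "dihedral_action 1 \<theta>" "\<theta> ` carrier (dihedral_group 1) = transport ` G"
      using act \<open>\<G> \<cong> dihedral_group 1\<close> by blast
    obtain e where "zbasis (int N) (Fix (int N) (transport ` G)) (NL (int N)) 2 e"
      using zbasis_FixD_1_odd[OF \<theta>(1), of "int N"] \<open>odd N\<close> unfolding \<theta>(2) by auto
    then show ?thesis using fg \<open>odd N\<close> odd_pos by blast
  qed
  \<comment> \<open>A Klein four-subgroup has order prime to every odd \<open>N\<close>, so the case
    \<open>N = 3\<close> is covered together with the \<open>N\<close> coprime to 6.\<close>
  have even_odd: "fixed_group R N G \<cong> integer_mod_group N"
    if "\<G> \<cong> dihedral_group n" "n \<in> {2, 4, 6}" "odd N" for n N
  proof -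
    obtain \<theta> where \<theta>: "dihedral_action n \<theta>" "\<theta> ` carrier (dihedral_group n) = transport ` G"
      using act \<open>\<G> \<cong> dihedral_group n\<close> by blast
    have "zbasis (int N) (Fix (int N) (transport ` G)) (NL (int N)) 1 (\<lambda>_. 1)"
      using zbasis_FixD_klein[OF \<theta>(1), of "int N"] that(2,3) unfolding \<theta>(2) by auto
    then show ?thesis using fg1 \<open>odd N\<close> odd_pos by blast
  qed
  have D3_coprime: "fixed_group R N G \<cong> integer_mod_group N"
    if "\<G> \<cong> dihedral_group 3" "N > 0" "coprime N 2" "coprime N 3" for N
  proof -
    obtain \<theta> where \<theta>: "dihedral_action 3 \<theta>" "\<theta> ` carrier (dihedral_group 3) = transport ` G"
      using act \<open>\<G> \<cong> dihedral_group 3\<close> by blast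
    have "coprime (int N) (int 2)" "coprime (int N) (int 3)"
      using that(3,4) unfolding coprime_int_iff by simp_all
    then have "zbasis (int N) (Fix (int N) (transport ` G)) (NL (int N)) 1 (\<lambda>_. 1)"
      using zbasis_FixD_3_coprime[OF \<theta>(1), of "int N"] unfolding \<theta>(2) by simp
    then show ?thesis using fg1 \<open>N > 0\<close> by blast
  qed
  have D3_3: "fixed_group R 3 G \<cong> integer_mod_group 3 \<or> fixed_group R 3 G \<cong> zmod_power 3 2"
    if "\<G> \<cong> dihedral_group 3"
  proof -
    from act[OF that] obtain \<theta> where \<theta>: "dihedral_action 3 \<theta>" "\<theta> ` carrier (dihedral_group 3) = transport ` G"
      by blast
    obtain k e where k: "k \<in> {1, 2}" "zbasis (int 3) (Fix (int 3) (transport ` G)) (NL (int 3)) k e"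
      using zbasis_FixD_3_3[OF \<theta>(1)] unfolding \<theta>(2) by auto
    then consider "k = 1" | "k = 2" by blast
    then show ?thesis by cases (use k(2) fg[of 3] fg1[of 3] in auto)
  qed
  have D1_2: "\<exists>k\<in>{2, 3, 4}. fixed_group R 2 G \<cong> zmod_power 2 k" if "\<G> \<cong> dihedral_group 1"
  proof -
    from act[OF that] obtain \<theta> where \<theta>: "dihedral_action 1 \<theta>" "\<theta> ` carrier (dihedral_group 1) = transport ` G"
      by blast
    obtain k e where "k \<in> {2, 3, 4}" "zbasis (int 2) (Fix (int 2) (transport ` G)) (NL (int 2)) k e"
      using zbasis_FixD_1_2[OF \<theta>(1)] unfolding \<theta>(2) by auto
    then show ?thesis using fg[of 2, OF _ zero_less_numeral] by blast
  qed
  have D2_2: "\<exists>k\<in>{2, 3}. fixed_group R 2 G \<cong> zmod_power 2 k" if "\<G> \<cong> dihedral_group 2"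
  proof -
    from act[OF that] obtain \<theta> where \<theta>: "dihedral_action 2 \<theta>" "\<theta> ` carrier (dihedral_group 2) = transport ` G"
      by blast
    obtain k e where "k \<in> {2, 3}" "zbasis (int 2) (Fix (int 2) (transport ` G)) (NL (int 2)) k e"
      using zbasis_FixD_2_2[OF \<theta>(1)] unfolding \<theta>(2) by auto
    then show ?thesis using fg[of 2, OF _ zero_less_numeral] by blast
  qed
  have D4_2: "fixed_group R 2 G \<cong> zmod_power 2 2" if "\<G> \<cong> dihedral_group 4"
  proof -
    from act[OF that] obtain \<theta> where \<theta>: "dihedral_action 4 \<theta>" "\<theta> ` carrier (dihedral_group 4) = transport ` G"
      by blast
    obtain e where "zbasis (int 2) (Fix (int 2) (transport ` G)) (NL (int 2)) 2 e"
      using zbasis_FixD_4_2[OF \<theta>(1)] unfolding \<theta>(2) by auto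
    then show ?thesis using fg[of 2, OF _ zero_less_numeral] by blast
  qed
  have D36_2: "fixed_group R 2 G \<cong> integer_mod_group 2" if "\<G> \<cong> dihedral_group n" "n \<in> {3, 6}" for n
  proof -
    obtain \<theta> where \<theta>: "dihedral_action n \<theta>" "\<theta> ` carrier (dihedral_group n) = transport ` G"
      using act \<open>\<G> \<cong> dihedral_group n\<close> by blast
    have "zbasis 2 (FixD 2 n \<theta>) (NL 2) 1 (\<lambda>_. 1)"
      using \<theta>(1) that(2) zbasis_FixD_3_2[of \<theta>] zbasis_FixD_6_2[of \<theta>] by blast
    then have "zbasis (int 2) (Fix (int 2) (transport ` G)) (NL (int 2)) 1 (\<lambda>_. 1)"
      unfolding \<theta>(2) by simp
    then show ?thesis by (rule fg1) simp
  qed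
  have odd: "odd N" if "coprime N 2" for N :: nat
    using that by simp
  show ?thesis
  proof (intro conjI allI impI)
    fix N :: nat assume N: "1 \<le> N" "coprime N 2 \<and> coprime N 3"
    show "fixed_group R N G \<cong> zmod_power N 2" if "\<G> \<cong> dihedral_group 1"
      using D1_odd[OF that] odd N by blast
    show "fixed_group R N G \<cong> integer_mod_group N" if "\<exists>n\<in>{2, 3, 4, 6}. \<G> \<cong> dihedral_group n"
      using that even_odd D3_coprime odd N by fastforce
  next
    show "fixed_group R 3 G \<cong> zmod_power 3 2" if "\<G> \<cong> dihedral_group 1"
      using D1_odd[OF that, of 3] by simp
    show "fixed_group R 3 G \<cong> integer_mod_group 3" if "\<exists>n\<in>{2, 4, 6}. \<G> \<cong> dihedral_group n"
      using that even_odd[of _ 3] by auto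
    show "fixed_group R 3 G \<cong> integer_mod_group 3 \<or> fixed_group R 3 G \<cong> zmod_power 3 2"
      if "\<G> \<cong> dihedral_group 3" by (rule D3_3[OF that])
    show "fixed_group R 2 G \<cong> zmod_power 2 2 \<or> fixed_group R 2 G \<cong> zmod_power 2 3 \<or>
        fixed_group R 2 G \<cong> zmod_power 2 4" if "\<G> \<cong> dihedral_group 1"
      using D1_2[OF that] by blast
    show "fixed_group R 2 G \<cong> zmod_power 2 2 \<or> fixed_group R 2 G \<cong> zmod_power 2 3"
      if "\<G> \<cong> dihedral_group 2" using D2_2[OF that] by blast
    show "fixed_group R 2 G \<cong> zmod_power 2 2" if "\<G> \<cong> dihedral_group 4" by (rule D4_2[OF that])
    show "fixed_group R 2 G \<cong> integer_mod_group 2" if "\<exists>n\<in>{3, 6}. \<G> \<cong> dihedral_group n"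
      using that D36_2 by blast
  qed
qed

end
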